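(* Suppose assumptions (A1'), (A2), (A3), (A4) listed in the context hold. Let $(\overline{x}, \overline{y})$ be the unique solution $(x,y)=(\overline x,\overline y)$ of $$ \begin{aligned} &\dot{y}(t) = g(x(t),y(t),t) && \text{for a.e. } t\in J_T,\\ & y(0) = y_0,\\ &\dot{x}(t)\,(x(t)-\xi) \leq 0 && \text{for all } \xi\in [F_-(y(t)), F_+(y(t))],\ \text{for a.e. } t\in J_T,\\ &x(0) = \min \{\max \{F_-(y_0) , x_0\} ,F_+(y_0)\},\\ &x(t)\in [F_-(y(t)), F_+(y(t))] && \text{for all } t\in\overline{J_T}. \end{aligned} $$ Then $\overline{y}\in \mathrm{C}(\overline{J_T})\cap\mathrm{C}^1(J_T)$ and $\overline{y}\in \mathrm{W}^{1,\infty}(J_T)$. For arbitrary $\eta_1>0$ there exists an $\varepsilon_{\eta_1}>0$ such that for all $\varepsilon\in (0,\varepsilon_{\eta_1})$ there exists a time $t(\varepsilon)\in [0,T)$ with $$ \|y_{\varepsilon} - \overline{y}\|_{\mathrm{C}(\overline{J_T})} + \|x_{\varepsilon} - \overline{x}\|_{ \mathrm{C}([t(\varepsilon),T]) } <\eta_1 . $$ If $x_0\in [F_-(y_0),F_+(y_0)]$, then $t(\varepsilon)=0$. Otherwise, $t(\varepsilon) \leq \varepsilon\, C(\eta_1)$ for some $C(\eta_1)>0$ (independent of $\varepsilon$). Consequently, the following hold as $\varepsilon\to0$: (N1) If $x_0\in [F_-(y_0),F_+(y_0)]$, then $y_{\varepsilon} \rightarrow \overline{y}$ in $\mathrm{C}(\overline{J_T})\cap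 \mathrm{C}^1(J_T)$ and $x_\varepsilon \rightarrow \overline{x}$ in $\mathrm{C}(\overline{J_T})$. (N2) Otherwise, for arbitrary $\eta_2\in(0,T)$, $y_{\varepsilon} \rightarrow \overline{y}$ in $\mathrm{C}(\overline{J_T})\cap \mathrm{C}^1(\eta_2,T)$ and $x_\varepsilon \rightarrow \overline{x}$ in $\mathrm{C}([\eta_2,T])$. (N3) For any $q\in(1,+\infty)$, $y_\varepsilon\to \overline{y}$ in $\mathrm{W}^{1,q}(J_T)$ and $x_\varepsilon\to \overline{x}$ in $\mathrm{L}^q(J_T)$.
   Context: Let $T>0$, $J_T:=(0,T)$, $(x_0,y_0)\in\mathbb{R}^2$. For $\varepsilon>0$, $(x_\varepsilon,y_\varepsilon)$ denotes the solution on $\overline{J_T}$ of the planar fast-slow system $$\varepsilon \dot{x} = f(x,y),\qquad \dot{y} = g(x,y,t),\qquad (x(0),y(0))=(x_0,y_0).$$ Assumptions: (A1') $g\in \mathrm{C}^2(\mathbb{R}^3)$ and $f\in \mathrm{C}^2(\mathbb{R}^2)$. (A2) There are functions $F_+>F_-$ from $\mathbb{R}$ to $\mathbb{R}$ such that $f(x,y)<0$ if $x>F_+(y)$, $f(x,y)=0$ if $x\in[F_-(y),F_+(y)]$, and $f(x,y)>0$ otherwise (i.e. if $x<F_-(y)$). (A3) $F_+,F_-$ are Lipschitz continuous with Lipschitz constants $L_+$ and $L_-$, and are monotone increasing functions. (A4) $|g(x,y,t)|\le M(t)\,(1+\mathcal{G}(x)+|y|)$, with $M>0$ continuous and $\mathcal{G}$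 bounded. The spaces $\mathrm{C}(\cdot)$ and $\mathrm{C}^1(\cdot)$ carry the sup-norms of the function, respectively of the function and its first derivative. *)

theory Defs
  imports "HOL-Analysis.Analysis"
begin

text \<open>
  \<open>C2\<close> is twice continuous Frechet differentiability on the whole space; no bounds on the
  function or its derivatives are required.
\<close>

definition C2 :: "('a::real_normed_vector \<Rightarrow> real) \<Rightarrow> bool" where
  "C2 h \<longleftrightarrow> (\<exists>(h' :: 'a \<Rightarrow> 'a \<Rightarrow>\<^sub>L real) (h'' :: 'a \<Rightarrow> 'a \<Rightarrow>\<^sub>L ('a \<Rightarrow>\<^sub>L real)).
     (\<forall>p. (h has_derivative blinfun_apply (h' p)) (at p)) \<and>
     (\<forall>p. (h' has_derivative blinfun_apply (h'' p)) (at p)) \<and>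
     continuous_on UNIV h'')"

text \<open>
  The norms below are real suprema, so they are meaningful only for functions on which the
  supremum is finite. \<open>C_norm\<close> is only used for continuous functions on compact intervals.
  \<open>C1_space\<close> is only used on open sets; boundedness is part of membership so that \<open>C1_norm\<close>
  is finite on it.
\<close>

definition C_norm :: "real set \<Rightarrow> (real \<Rightarrow> real) \<Rightarrow> real" where
  "C_norm S u = (SUP t\<in>S. \<bar>u t\<bar>)"

definition C1_space :: "real set \<Rightarrow> (real \<Rightarrow> real) set" where
  "C1_space S = {u. u C1_differentiable_on S \<and> bounded (u ` S) \<and> bounded (deriv u ` S)}"

definition C1_norm :: "real set \<Rightarrow> (real \<Rightarrow> real) \<Rightarrow> real" where
  "C1_norm S u = C_norm S u + C_norm S (deriv u)"

definition Lq_space :: "real \<Rightarrow> real set \<Rightarrow> (real \<Rightarrow> real) set" where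
  "Lq_space q S = {u. u \<in> borel_measurable (lebesgue_on S) \<and>
     integrable (lebesgue_on S) (\<lambda>t. \<bar>u t\<bar> powr q)}"

definition Lq_norm :: "real \<Rightarrow> real set \<Rightarrow> (real \<Rightarrow> real) \<Rightarrow> real" where
  "Lq_norm q S u = (integral\<^sup>L (lebesgue_on S) (\<lambda>t. \<bar>u t\<bar> powr q)) powr (1 / q)"

definition Linf_space :: "real set \<Rightarrow> (real \<Rightarrow> real) set" where
  "Linf_space S = {u. u \<in> borel_measurable (lebesgue_on S) \<and>
     (\<exists>C. AE t in lebesgue_on S. \<bar>u t\<bar> \<le> C)}"

text \<open>
  Weak derivatives on the open interval \<open>(a,b)\<close>, tested against compactly supported \<open>C\<^sup>1\<close>
  functions. Both \<open>u\<close> and \<open>v\<close> are to be integrable on \<open>(a,b)\<close>: Bochner integrals of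
  non-integrable functions are 0, so \<open>weak_deriv\<close> is only used together with membership
  in one of the Lebesgue spaces (with exponent at least 1).
\<close>

definition test_function :: "real \<Rightarrow> real \<Rightarrow> (real \<Rightarrow> real) \<Rightarrow> bool" where
  "test_function a b \<phi> \<longleftrightarrow>
     \<phi> C1_differentiable_on UNIV \<and> closure {t. \<phi> t \<noteq> 0} \<subseteq> {a<..<b}"

definition weak_deriv :: "real \<Rightarrow> real \<Rightarrow> (real \<Rightarrow> real) \<Rightarrow> (real \<Rightarrow> real) \<Rightarrow> bool" where
  "weak_deriv a b u v \<longleftrightarrow> (\<forall>\<phi>. test_function a b \<phi> \<longrightarrow>
     integral\<^sup>L (lebesgue_on {a<..<b}) (\<lambda>t. u t * deriv \<phi> t) =
     - integral\<^sup>L (lebesgue_on {a<..<b}) (\<lambda>t. v t * \<phi> t))"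

definition W1inf_space :: "real \<Rightarrow> real \<Rightarrow> (real \<Rightarrow> real) set" where
  "W1inf_space a b =
     {u \<in> Linf_space {a<..<b}. \<exists>v \<in> Linf_space {a<..<b}. weak_deriv a b u v}"

text \<open>
  Convergence of a family \<open>u \<epsilon>\<close>, \<open>\<epsilon> > 0\<close>, to \<open>w\<close> as \<open>\<epsilon> \<rightarrow> 0\<close> in the respective spaces,
  including membership of all functions involved. In \<open>converges_W1q\<close> the functions \<open>v \<epsilon>\<close>
  and \<open>z\<close> are the weak derivatives, which are determined up to null sets.
\<close>

definition converges_C :: "real set \<Rightarrow> (real \<Rightarrow> real \<Rightarrow> real) \<Rightarrow> (real \<Rightarrow> real) \<Rightarrow> bool" where
  "converges_C S u w \<longleftrightarrow>
     continuous_on S w \<and> (\<forall>\<epsilon>>0. continuous_on S (u \<epsilon>)) \<and>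
     ((\<lambda>\<epsilon>. C_norm S (\<lambda>t. u \<epsilon> t - w t)) \<longlongrightarrow> 0) (at_right 0)"

definition converges_C1 :: "real set \<Rightarrow> (real \<Rightarrow> real \<Rightarrow> real) \<Rightarrow> (real \<Rightarrow> real) \<Rightarrow> bool" where
  "converges_C1 S u w \<longleftrightarrow>
     w \<in> C1_space S \<and> (\<forall>\<epsilon>>0. u \<epsilon> \<in> C1_space S) \<and>
     ((\<lambda>\<epsilon>. C1_norm S (\<lambda>t. u \<epsilon> t - w t)) \<longlongrightarrow> 0) (at_right 0)"

definition converges_Lq ::
  "real \<Rightarrow> real set \<Rightarrow> (real \<Rightarrow> real \<Rightarrow> real) \<Rightarrow> (real \<Rightarrow> real) \<Rightarrow> bool" where
  "converges_Lq q S u w \<longleftrightarrow>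
     w \<in> Lq_space q S \<and> (\<forall>\<epsilon>>0. u \<epsilon> \<in> Lq_space q S) \<and>
     ((\<lambda>\<epsilon>. Lq_norm q S (\<lambda>t. u \<epsilon> t - w t)) \<longlongrightarrow> 0) (at_right 0)"

definition converges_W1q ::
  "real \<Rightarrow> real \<Rightarrow> real \<Rightarrow> (real \<Rightarrow> real \<Rightarrow> real) \<Rightarrow> (real \<Rightarrow> real) \<Rightarrow> bool" where
  "converges_W1q q a b u w \<longleftrightarrow>
     converges_Lq q {a<..<b} u w \<and>
     (\<exists>v z. weak_deriv a b w z \<and> (\<forall>\<epsilon>>0. weak_deriv a b (u \<epsilon>) (v \<epsilon>)) \<and>
        converges_Lq q {a<..<b} v z)"

text \<open>Points are passed as tuples: \<open>f (x, y)\<close> and \<open>g (x, y, t)\<close>.\<close>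

definition fast_slow_solution ::
  "real \<Rightarrow> (real \<times> real \<Rightarrow> real) \<Rightarrow> (real \<times> real \<times> real \<Rightarrow> real) \<Rightarrow> real \<Rightarrow> real \<Rightarrow>
   real \<Rightarrow> (real \<Rightarrow> real) \<Rightarrow> (real \<Rightarrow> real) \<Rightarrow> bool" where
  "fast_slow_solution T f g x0 y0 \<epsilon> x y \<longleftrightarrow>
     x 0 = x0 \<and> y 0 = y0 \<and>
     (\<forall>t\<in>{0..T}.
        (x has_real_derivative f (x t, y t) / \<epsilon>) (at t within {0..T}) \<and>
        (y has_real_derivative g (x t, y t, t)) (at t within {0..T}))"

text \<open>
  The limit problem is posed for continuous representatives of \<open>W\<^sup>1\<^sup>,\<^sup>1(0,T)\<close> functions
  \<open>x\<close>, \<open>y\<close>; \<open>x'\<close> and \<open>y'\<close> are their derivatives. (Mere continuity and almost everywhere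
  differentiability would not give uniqueness.)
\<close>

definition limit_solution ::
  "real \<Rightarrow> (real \<Rightarrow> real) \<Rightarrow> (real \<Rightarrow> real) \<Rightarrow> (real \<times> real \<times> real \<Rightarrow> real) \<Rightarrow>
   real \<Rightarrow> real \<Rightarrow> (real \<Rightarrow> real) \<Rightarrow> (real \<Rightarrow> real) \<Rightarrow> bool" where
  "limit_solution T Fm Fp g x0 y0 x y \<longleftrightarrow>
     continuous_on {0..T} x \<and> continuous_on {0..T} y \<and>
     (\<exists>x' \<in> Lq_space 1 {0<..<T}. \<exists>y' \<in> Lq_space 1 {0<..<T}.
        weak_deriv 0 T x x' \<and> weak_deriv 0 T y y' \<and>
        (AE t in lebesgue_on {0<..<T}. y' t = g (x t, y t, t)) \<and>
        (AE t in lebesgue_on {0<..<T}. \<forall>\<xi>\<in>{Fm (y t)..Fp (y t)}. x' t * (x t - \<xi>) \<le> 0)) \<and>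
     y 0 = y0 \<and>
     x 0 = min (max (Fm y0) x0) (Fp y0) \<and>
     (\<forall>t\<in>{0..T}. x t \<in> {Fm (y t)..Fp (y t)})"

end

theory Submission
  imports Defs
begin

text \<open>
  The limit \<open>x\<close> is driven by \<open>y\<close> through a generalised play: it stays in the moving interval
  \<open>[Fm (y t), Fp (y t)]\<close>, cannot increase while it is strictly above the lower end, and cannot decrease
  while it is strictly below the upper end. The fast equation satisfies the same two monotonicity
  rules exactly, because \<open>f\<close> has the right sign, and it violates the constraint by at most a small
  \<open>\<delta>\<close> after a short initial layer. So both the limit problem and the fast-slow system produce
  ``\<open>\<delta>\<close>-approximate'' solutions of one and the same problem (\<open>approx_sol\<close>), with \<open>\<delta> = 0\<close> for the
  limit problem, and everything follows from one stability estimate for such solutions.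
  
  Stability rests on a comparison for the play (\<open>play_compare\<close>): two \<open>x\<close>-components differ at most by
  their initial difference or by \<open>\<delta> + L sup \<bar>y1 - y2\<bar>\<close>, since wherever the difference exceeds this
  value, the larger component is above its lower boundary and hence cannot grow, while the smaller one
  is below its upper boundary and cannot fall. The \<open>y\<close>-components solve an ODE with locally Lipschitz
  right-hand side, and an exponentially weighted supremum closes the estimate: two \<open>\<delta>\<close>-approximate
  solutions differ by at most a constant times \<open>\<delta>\<close> (\<open>approx_sol_stable\<close>).
  
  The fast-slow solution becomes \<open>\<delta>\<close>-approximate once it is frozen during the initial layer, that is,
  once \<open>t\<close> is replaced by \<open>max t \<tau>\<close> with an entrance time \<open>\<tau> = O(\<epsilon>)\<close> (\<open>initial_layer\<close>): outside a
  \<open>\<delta>\<close>-neighbourhood of the interval \<open>f\<close> is bounded away from zero on the relevant compact set, so \<open>x\<close>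
  moves with speed of order \<open>1 / \<epsilon>\<close>, while the interval moves with bounded speed. Stability with
  \<open>\<delta> = 0\<close> gives uniqueness for the limit problem; the frozen solutions are Cauchy as \<open>\<delta> \<rightarrow> 0\<close> and
  their uniform limit is a solution, which gives existence; stability between the frozen solution and
  the limit gives the quantitative approximation, from which all convergence statements are read off.
  
  The limit problem is stated with weak derivatives. A fundamental theorem of calculus for weak
  derivatives (\<open>weak_deriv_has_integral\<close>) turns the variational inequality into the monotonicity rules.
  Conversely, an exact solution has a Lipschitz \<open>x\<close>, and the Radon-Nikodym theorem together with
  Lebesgue's differentiation theorem gives its derivative almost everywhere
  (\<open>lipschitz_weak_derivative\<close>), whose sign is then determined by the monotonicity rules.
\<close>

section \<open>Barriers and growth estimates\<close>

text \<open>
  The time of the last visit to \<open>{..c}\<close> before \<open>t\<close> starts an interval on which the hypothesis applies.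
  Asking for monotonicity only above the barrier is what makes the lemma usable for functions that are
  not differentiable.
\<close>

lemma upper_barrier:
  fixes h :: "real \<Rightarrow> real"
  assumes cont: "continuous_on {a..b} h" and init: "h a \<le> c"
    and dec: "\<And>s t. \<lbrakk>a \<le> s; s < t; t \<le> b; \<And>r. s < r \<Longrightarrow> r \<le> t \<Longrightarrow> c < h r\<rbrakk> \<Longrightarrow> h t \<le> h s"
    and t: "t \<in> {a..b}"
  shows "h t \<le> c"
proof (rule ccontr)
  assume "\<not> h t \<le> c"
  then have ht: "c < h t" by simp
  define S where "S = {r \<in> {a..t}. h r \<le> c}"
  have cont': "continuous_on {a..t} h"
    using cont t by (auto intro: continuous_on_subset)
  have "S = {a..t} \<inter> h -` {..c}" by (auto simp: S_def)
  then have "closed S"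
    using continuous_on_closed_vimage[of "{a..t}" h] cont' by (metis Int_commute closed_atLeastAtMost closed_atMost)
  then have "compact S"
    unfolding compact_eq_bounded_closed
    by (auto simp: S_def intro: bounded_subset[OF bounded_closed_interval[of a t]])
  moreover have "S \<noteq> {}" using init t by (auto simp: S_def)
  ultimately obtain s where s: "s \<in> S" "\<And>r. r \<in> S \<Longrightarrow> r \<le> s"
    by (meson compact_attains_sup)
  have hs: "h s \<le> c" "a \<le> s" "s \<le> t" using s(1) by (auto simp: S_def)
  then have "s < t" using ht by (cases "s = t") auto
  have "h t \<le> h s"
  proof (rule dec)
    fix r assume r: "s < r" "r \<le> t"
    show "c < h r"
    proof (rule ccontr)
      assume "\<not> c < h r"
      then have "r \<in> S" using r hs by (auto simp: S_def)
      then show False using s(2)[of r] r by simp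
    qed
  qed (use hs \<open>s < t\<close> t in auto)
  then show False using hs ht by simp
qed

lemma deriv_bound_diff:
  fixes u p :: "real \<Rightarrow> real"
  assumes ab: "a \<le> b"
    and cu: "continuous_on {a..b} u" and cp: "continuous_on {a..b} p"
    and du: "\<And>t. a < t \<Longrightarrow> t < b \<Longrightarrow> (u has_real_derivative u' t) (at t)"
    and dp: "\<And>t. a < t \<Longrightarrow> t < b \<Longrightarrow> (p has_real_derivative p' t) (at t)"
    and le: "\<And>t. a < t \<Longrightarrow> t < b \<Longrightarrow> u' t \<le> p' t"
  shows "u b - u a \<le> p b - p a"
proof -
  have "(\<lambda>t. p t - u t) a \<le> (\<lambda>t. p t - u t) b"
  proof (rule DERIV_nonneg_imp_increasing_open[OF ab])
    fix t assume "a < t" "t < b"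
    then show "\<exists>y. ((\<lambda>t. p t - u t) has_real_derivative y) (at t) \<and> 0 \<le> y"
      using du dp le by (intro exI[of _ "p' t - u' t"]) (auto intro!: derivative_intros)
  qed (intro continuous_intros cu cp)
  then show ?thesis by simp
qed

lemma deriv_abs_bound_diff:
  fixes u p :: "real \<Rightarrow> real"
  assumes ab: "a \<le> b"
    and cu: "continuous_on {a..b} u" and cp: "continuous_on {a..b} p"
    and du: "\<And>t. a < t \<Longrightarrow> t < b \<Longrightarrow> (u has_real_derivative u' t) (at t)"
    and dp: "\<And>t. a < t \<Longrightarrow> t < b \<Longrightarrow> (p has_real_derivative p' t) (at t)"
    and le: "\<And>t. a < t \<Longrightarrow> t < b \<Longrightarrow> \<bar>u' t\<bar> \<le> p' t"
  shows "\<bar>u b - u a\<bar> \<le> p b - p a"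
proof -
  have "u b - u a \<le> p b - p a"
    using le by (intro deriv_bound_diff[OF ab cu cp du dp]) (auto simp: abs_le_iff)
  moreover have "(\<lambda>t. - u t) b - (\<lambda>t. - u t) a \<le> p b - p a"
    using le by (intro deriv_bound_diff[OF ab _ cp _ dp, where u' = "\<lambda>t. - u' t"])
      (auto simp: abs_le_iff intro!: continuous_intros cu derivative_intros du)
  ultimately show ?thesis by simp
qed

text \<open>
  The function \<open>ln (1 + y\<^sup>2)\<close> is smooth where \<open>ln (1 + \<bar>y\<bar>)\<close> is not, and its derivative
  \<open>2 y y' / (1 + y\<^sup>2)\<close> is at most \<open>4 A\<close>.
\<close>

lemma linear_growth_bound:
  fixes y :: "real \<Rightarrow> real"
  assumes c: "continuous_on {0..T} y" and A: "0 \<le> A"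
    and d: "\<And>t. 0 < t \<Longrightarrow> t < T \<Longrightarrow> (y has_real_derivative y' t) (at t)"
    and le: "\<And>t. 0 < t \<Longrightarrow> t < T \<Longrightarrow> \<bar>y' t\<bar> \<le> A * (1 + \<bar>y t\<bar>)"
    and t: "t \<in> {0..T}"
  shows "\<bar>y t\<bar> \<le> (1 + (y 0)\<^sup>2) * exp (4 * A * T)"
proof -
  have pos: "0 < 1 + (y s)\<^sup>2" for s
    by (metis zero_le_power2 add_pos_nonneg zero_less_one)
  have ln: "ln (1 + (y t)\<^sup>2) - ln (1 + (y 0)\<^sup>2) \<le> 4 * A * t - 4 * A * 0"
  proof (rule deriv_bound_diff)
    show "0 \<le> t" using t by simp
    show "continuous_on {0..t} (\<lambda>t. ln (1 + (y t)\<^sup>2))"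
      using pos t by (intro continuous_intros continuous_on_subset[OF c]) (auto simp: less_le)
    show "continuous_on {0..t} (\<lambda>t. 4 * A * t)" by (intro continuous_intros)
    fix s assume s: "0 < s" "s < t"
    then have sT: "s < T" using t by simp
    show "((\<lambda>t. ln (1 + (y t)\<^sup>2)) has_real_derivative (2 * y s * y' s / (1 + (y s)\<^sup>2))) (at s)"
      using pos[of s] by (auto intro!: derivative_eq_intros d[OF s(1) sT] simp: field_simps)
    show "((*) (4 * A) has_real_derivative 4 * A) (at s)"
      by (auto intro!: derivative_eq_intros)
    have "y s * y' s \<le> \<bar>y s\<bar> * \<bar>y' s\<bar>" by (metis abs_ge_self abs_mult)
    also have "\<dots> \<le> \<bar>y s\<bar> * (A * (1 + \<bar>y s\<bar>))"
      by (intro mult_left_mono le[OF s(1) sT]) auto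
    also have "\<dots> = A * (\<bar>y s\<bar> + (y s)\<^sup>2)" by (simp add: algebra_simps power2_eq_square)
    also have "\<dots> \<le> A * (2 * (1 + (y s)\<^sup>2))"
    proof (intro mult_left_mono A)
      have "2 * \<bar>y s\<bar> \<le> 1 + (y s)\<^sup>2" 
        using zero_le_power2[of "\<bar>y s\<bar> - 1"] by (simp add: power2_eq_square algebra_simps)
      then show "\<bar>y s\<bar> + (y s)\<^sup>2 \<le> 2 * (1 + (y s)\<^sup>2)"
        using zero_le_power2[of "y s"] by argo
    qed
    finally show "2 * y s * y' s / (1 + (y s)\<^sup>2) \<le> 4 * A"
      using pos[of s] by (simp add: field_simps)
  qed
  have "\<bar>y t\<bar> \<le> 1 + (y t)\<^sup>2"
    using zero_le_power2[of "\<bar>y t\<bar> - 1"] zero_le_power2[of "y t"]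
    by (simp add: power2_eq_square algebra_simps)
  also have "\<dots> = exp (ln (1 + (y t)\<^sup>2))" using pos by simp
  also have "\<dots> \<le> exp (ln (1 + (y 0)\<^sup>2) + 4 * A * T)"
    using ln t mult_left_mono[of t T "4 * A"] A by (intro iffD2[OF exp_le_cancel_iff]) auto
  also have "\<dots> = (1 + (y 0)\<^sup>2) * exp (4 * A * T)" using pos by (simp add: exp_add)
  finally show ?thesis .
qed

section \<open>The generalised play\<close>

text \<open>
  The play with curved boundaries \<open>Fm\<close>, \<open>Fp\<close> and input \<open>y\<close>, with a tolerance \<open>\<delta>\<close> in the constraint only.
  The evolution is encoded by monotonicity instead of a differential inclusion, so that no
  derivative of \<open>x\<close> is needed; the intervals are open on the left because strict inequalities at the
  left end are not available when an excursion starts there.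
\<close>

definition play_within ::
  "real \<Rightarrow> real \<Rightarrow> real \<Rightarrow> (real \<Rightarrow> real) \<Rightarrow> (real \<Rightarrow> real) \<Rightarrow> (real \<Rightarrow> real) \<Rightarrow> (real \<Rightarrow> real) \<Rightarrow> bool" where
  "play_within \<delta> a b Fm Fp x y \<longleftrightarrow>
     continuous_on {a..b} x \<and>
     (\<forall>t\<in>{a..b}. Fm (y t) - \<delta> \<le> x t \<and> x t \<le> Fp (y t) + \<delta>) \<and>
     (\<forall>s t. a \<le> s \<and> s < t \<and> t \<le> b \<and> (\<forall>r\<in>{s<..t}. Fm (y r) < x r) \<longrightarrow> x t \<le> x s) \<and>
     (\<forall>s t. a \<le> s \<and> s < t \<and> t \<le> b \<and> (\<forall>r\<in>{s<..t}. x r < Fp (y r)) \<longrightarrow> x s \<le> x t)"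

text \<open>
  While \<open>x1 - x2 > \<rho>\<close>, the tolerance and the displacement of the boundaries are too small to compensate:
  \<open>x1\<close> lies strictly above its lower boundary and \<open>x2\<close> strictly below its upper one, so \<open>x1 - x2\<close>
  cannot grow and \<open>\<rho>\<close> is a barrier.
\<close>

lemma play_compare_le:
  assumes 1: "play_within \<delta> a b Fm Fp x1 y1" and 2: "play_within \<delta> a b Fm Fp x2 y2"
    and L: "L-lipschitz_on UNIV Fp" "L-lipschitz_on UNIV Fm"
    and D: "\<And>s. s \<in> {a..t} \<Longrightarrow> \<bar>y1 s - y2 s\<bar> \<le> D"
    and init: "x1 a - x2 a \<le> \<rho>" and \<rho>: "\<delta> + L * D \<le> \<rho>"
    and t: "t \<in> {a..b}"
  shows "x1 t - x2 t \<le> \<rho>"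
proof (rule upper_barrier[of a t "\<lambda>t. x1 t - x2 t" \<rho> t])
  have "continuous_on {a..b} (\<lambda>t. x1 t - x2 t)"
    using 1 2 by (auto simp: play_within_def intro!: continuous_intros)
  then show "continuous_on {a..t} (\<lambda>t. x1 t - x2 t)"
    by (rule continuous_on_subset) (use t in auto)
next
  fix s r assume sr: "a \<le> s" "s < r" "r \<le> t" and gt: "\<And>q. s < q \<Longrightarrow> q \<le> r \<Longrightarrow> \<rho> < x1 q - x2 q"
  have lip: "\<bar>F (y1 q) - F (y2 q)\<bar> \<le> L * D" if "L-lipschitz_on UNIV F" "q \<in> {s<..r}" for F q
  proof -
    have "\<bar>F (y1 q) - F (y2 q)\<bar> \<le> L * \<bar>y1 q - y2 q\<bar>"
      using lipschitz_onD[OF that(1), of "y1 q" "y2 q"] by (simp add: dist_real_def)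
    also have "\<dots> \<le> L * D"
      using that sr lipschitz_on_nonneg[OF L(1)] by (intro mult_left_mono D) auto
    finally show ?thesis .
  qed
  have band: "Fm (y2 q) - \<delta> \<le> x2 q" "x1 q \<le> Fp (y1 q) + \<delta>" if "q \<in> {s<..r}" for q
    using 1 2 that sr t by (auto simp: play_within_def)
  have "Fm (y1 q) < x1 q" if "q \<in> {s<..r}" for q
    using lip[OF L(2) that] band[OF that] gt[of q] that \<rho> by (auto simp: abs_le_iff)
  then have "x1 r \<le> x1 s" using 1 sr t unfolding play_within_def by auto
  moreover have "x2 q < Fp (y2 q)" if "q \<in> {s<..r}" for q
    using lip[OF L(1) that] band[OF that] gt[of q] that \<rho> by (auto simp: abs_le_iff)
  then have "x2 s \<le> x2 r" using 2 sr t unfolding play_within_def by auto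
  ultimately show "x1 r - x2 r \<le> x1 s - x2 s" by simp
qed (use init t in auto)

lemma play_compare:
  assumes "play_within \<delta> a b Fm Fp x1 y1" "play_within \<delta> a b Fm Fp x2 y2"
    and "L-lipschitz_on UNIV Fp" "L-lipschitz_on UNIV Fm"
    and D: "\<And>s. s \<in> {a..t} \<Longrightarrow> \<bar>y1 s - y2 s\<bar> \<le> D"
    and init: "\<bar>x1 a - x2 a\<bar> \<le> \<rho>" and \<rho>: "\<delta> + L * D \<le> \<rho>"
    and t: "t \<in> {a..b}"
  shows "\<bar>x1 t - x2 t\<bar> \<le> \<rho>"
proof -
  have "x1 t - x2 t \<le> \<rho>"
    by (rule play_compare_le[OF assms(1,2,3,4) D _ \<rho> t]) (use init in auto)
  moreover have "x2 t - x1 t \<le> \<rho>"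
    by (rule play_compare_le[OF assms(2,1,3,4) _ _ \<rho> t]) (use init D in \<open>auto simp: abs_minus_commute\<close>)
  ultimately show ?thesis by simp
qed

text \<open>
  A constant pair \<open>(x s, y s)\<close> is itself a play, so the comparison also bounds the modulus of
  continuity of a single play.
\<close>

lemma play_lipschitz:
  assumes p: "play_within 0 a b Fm Fp x y" and C: "C-lipschitz_on {a..b} y"
    and L: "L-lipschitz_on UNIV Fp" "L-lipschitz_on UNIV Fm"
  shows "(L * C)-lipschitz_on {a..b} x"
proof -
  have C0: "0 \<le> C" and L0: "0 \<le> L" using C L by (auto intro: lipschitz_on_nonneg)
  have "\<bar>x t - x s\<bar> \<le> L * C * (t - s)" if st: "a \<le> s" "s \<le> t" "t \<le> b" for s t
  proof (rule play_compare[of 0 s b Fm Fp x y "\<lambda>_. x s" "\<lambda>_. y s" L t "C * (t - s)", OF _ _ L])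
    show "play_within 0 s b Fm Fp x y"
      using p st by (auto simp: play_within_def elim: continuous_on_subset)
    show "play_within 0 s b Fm Fp (\<lambda>_. x s) (\<lambda>_. y s)"
      using p st by (auto simp: play_within_def)
    fix r assume r: "r \<in> {s..t}"
    have "\<bar>y r - y s\<bar> \<le> C * (r - s)"
      using lipschitz_onD[OF C, of r s] r st by (auto simp: dist_real_def)
    also have "\<dots> \<le> C * (t - s)" using r C0 by (intro mult_left_mono) auto
    finally show "\<bar>y r - y s\<bar> \<le> C * (t - s)" .
  qed (use st C0 L0 in auto)
  note * = this
  show ?thesis
  proof (rule lipschitz_onI)
    fix s t assume "s \<in> {a..b}" "t \<in> {a..b}"
    then show "dist (x s) (x t) \<le> L * C * dist s t"
      using *[of s t] *[of t s] by (cases "s \<le> t") (auto simp: dist_real_def abs_minus_commute)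
  qed (use C0 L0 in auto)
qed

section \<open>Weak derivatives\<close>

lemma integrable_continuous_bounded_support:
  fixes F :: "real \<Rightarrow> real"
  assumes c: "continuous_on UNIV F" and z: "\<And>t. t \<notin> {p..q} \<Longrightarrow> F t = 0"
  shows "integrable lborel F"
proof -
  have "set_integrable lborel {p..q} F"
    by (rule borel_integrable_atLeastAtMost') (rule continuous_on_subset[OF c], auto)
  moreover have "(\<lambda>t. indicator {p..q} t *\<^sub>R F t) = F"
    using z by (auto simp: fun_eq_iff indicator_def)
  ultimately show ?thesis by (simp add: set_integrable_def)
qed

text \<open>
  The support is closed and contained in the open interval, so the test function vanishes in a
  neighbourhood of every point outside, including the two end points.
\<close>

lemma test_function_facts:
  assumes "test_function a b \<phi>"
  shows "(\<phi> has_real_derivative deriv \<phi> t) (at t)"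
    and "continuous_on UNIV \<phi>" "continuous_on UNIV (deriv \<phi>)"
    and "t \<notin> {a<..<b} \<Longrightarrow> \<phi> t = 0" "t \<notin> {a<..<b} \<Longrightarrow> deriv \<phi> t = 0"
proof -
  obtain D where D: "\<And>t. (\<phi> has_vector_derivative D t) (at t)" "continuous_on UNIV D"
    and S: "closure {t. \<phi> t \<noteq> 0} \<subseteq> {a<..<b}"
    using assms by (auto simp: test_function_def C1_differentiable_on_def)
  have D': "(\<phi> has_real_derivative D t) (at t)" for t
    using D(1) by (simp add: has_real_derivative_iff_has_vector_derivative)
  then have eq: "deriv \<phi> = D" by (auto intro: DERIV_imp_deriv)
  show "(\<phi> has_real_derivative deriv \<phi> t) (at t)" "continuous_on UNIV (deriv \<phi>)"
    using D' D(2) by (auto simp: eq)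
  show "continuous_on UNIV \<phi>"
    using D' DERIV_isCont by (auto simp: continuous_on_eq_continuous_at)
  show "\<phi> t = 0" if "t \<notin> {a<..<b}"
    using that S closure_subset[of "{t. \<phi> t \<noteq> 0}"] by auto
  show "deriv \<phi> t = 0" if "t \<notin> {a<..<b}"
  proof -
    have "open (- closure {t. \<phi> t \<noteq> 0})" "t \<in> - closure {t. \<phi> t \<noteq> 0}" using that S by auto
    moreover have "((\<lambda>_. 0) has_real_derivative 0) (at t)" by simp
    ultimately have "(\<phi> has_real_derivative 0) (at t)"
      using closure_subset[of "{t. \<phi> t \<noteq> 0}"]
      by (rule_tac has_field_derivative_transform_within_open[where f = "\<lambda>_. 0"]) auto
    then show ?thesis by (rule DERIV_imp_deriv)
  qed
qed

text \<open>
  Integration by parts is elementary for difference quotients, by translation invariance of the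
  integral. The Lipschitz bound lets dominated convergence pass to the limit on both sides. Right
  quotients are used because Lebesgue's differentiation theorem enters below in a one-sided form.
\<close>

lemma weak_deriv_if_difference_quotients_converge:
  fixes u w :: "real \<Rightarrow> real"
  assumes ab: "a < b" and lip: "L-lipschitz_on {a..b} u"
    and meas: "w \<in> borel_measurable (lebesgue_on {a<..<b})"
    and lim: "AE t in lebesgue_on {a<..<b}. (\<lambda>n. (u (t + 1 / real (Suc n)) - u t) / (1 / real (Suc n))) \<longlonglongrightarrow> w t"
  shows "weak_deriv a b u w"
  unfolding weak_deriv_def
proof (intro allI impI)
  fix \<phi> assume \<phi>: "test_function a b \<phi>"
  note [simp] = test_function_facts(4,5)[OF \<phi>]
  note D\<phi> = test_function_facts(1)[OF \<phi>] and c\<phi> = test_function_facts(2)[OF \<phi>]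
    and c\<phi>' = test_function_facts(3)[OF \<phi>]
  define h where "h n = 1 / real (Suc n)" for n
  have h: "0 < h n" "h n \<le> 1" for n by (auto simp: h_def)
  have hlim: "h \<longlonglongrightarrow> 0" unfolding h_def by (rule LIMSEQ_Suc[OF lim_1_over_n])
  \<comment> \<open>Extension by constants, so that all integrals can be taken over the whole line.\<close>
  define U where "U t = u (max a (min b t))" for t
  define W where "W t = (if t \<in> {a<..<b} then w t else 0)" for t
  have L0: "0 \<le> L" using lip by (rule lipschitz_on_nonneg)
  have U_lip: "\<bar>U s - U t\<bar> \<le> L * \<bar>s - t\<bar>" for s t
  proof -
    have "\<bar>U s - U t\<bar> \<le> L * \<bar>max a (min b s) - max a (min b t)\<bar>"
      using lipschitz_onD[OF lip, of "max a (min b s)" "max a (min b t)"] ab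
      by (auto simp: U_def dist_real_def)
    also have "\<dots> \<le> L * \<bar>s - t\<bar>" by (intro mult_left_mono L0) auto
    finally show ?thesis .
  qed
  have "L-lipschitz_on UNIV U"
    using U_lip L0 by (auto simp: lipschitz_on_def dist_real_def)
  then have cU: "continuous_on UNIV U" by (rule lipschitz_on_continuous_on)
  have cU': "continuous_on UNIV (\<lambda>t. U (t + c))" for c
    by (rule continuous_on_compose2[OF cU]) (auto intro!: continuous_intros)
  have c\<phi>h: "continuous_on UNIV (\<lambda>t. \<phi> (t - c))" for c
    by (rule continuous_on_compose2[OF c\<phi>]) (auto intro!: continuous_intros)
  have "\<exists>B. \<forall>t\<in>{a..b}. \<bar>F t\<bar> \<le> B" if "continuous_on UNIV F" for F :: "real \<Rightarrow> real"
    using compact_imp_bounded[OF compact_continuous_image[OF continuous_on_subset[OF that], of "{a..b}"]]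
    by (auto simp: bounded_iff)
  from this[OF c\<phi>] this[OF c\<phi>'] this[OF cU] obtain B1 B2 B3 where
    B: "\<And>t. t \<in> {a..b} \<Longrightarrow> \<bar>\<phi> t\<bar> \<le> B1" "\<And>t. t \<in> {a..b} \<Longrightarrow> \<bar>deriv \<phi> t\<bar> \<le> B2"
      "\<And>t. t \<in> {a..b} \<Longrightarrow> \<bar>U t\<bar> \<le> B3" by metis
  have B0: "0 \<le> B1" "0 \<le> B2" "0 \<le> B3" using B[of a] ab by auto
  have B2: "\<bar>deriv \<phi> t\<bar> \<le> B2" for t
    using B(2)[of t] B0 by (cases "t \<in> {a<..<b}") auto
  have B3: "\<bar>U t\<bar> \<le> B3" for t
    using B(3)[of "max a (min b t)"] ab by (auto simp: U_def)
  have [measurable]: "U \<in> borel_measurable borel" "\<phi> \<in> borel_measurable borel"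
      "deriv \<phi> \<in> borel_measurable borel"
    using cU c\<phi> c\<phi>' by (auto intro: borel_measurable_continuous_onI)
  have to_leb: "F \<in> borel_measurable borel \<Longrightarrow> F \<in> borel_measurable lebesgue" for F :: "real \<Rightarrow> real"
    by (intro measurable_completion) simp
  have W_meas: "W \<in> borel_measurable lebesgue"
    using borel_measurable_if[of "{a<..<b}" w] meas by (simp add: W_def[abs_def])

  \<comment> \<open>Translation by \<open>h n\<close> moves the difference quotient from \<open>U\<close> to the test function.\<close>
  have C: "integral\<^sup>L lebesgue (\<lambda>t. (U (t + h n) - U t) / h n * \<phi> t)
      = integral\<^sup>L lebesgue (\<lambda>t. U t * ((\<phi> (t - h n) - \<phi> t) / h n))" for n
  proof -
    have i1: "integrable lborel (\<lambda>t. U (t + h n) * \<phi> t)"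
      by (rule integrable_continuous_bounded_support[of _ a b]) (auto intro!: continuous_intros cU' c\<phi>)
    have i2: "integrable lborel (\<lambda>t. U t * \<phi> t)"
      by (rule integrable_continuous_bounded_support[of _ a b]) (auto intro!: continuous_intros cU c\<phi>)
    have i3: "integrable lborel (\<lambda>t. U t * \<phi> (t - h n))"
    proof (rule integrable_continuous_bounded_support[of _ a "b + h n"])
      show "continuous_on UNIV (\<lambda>t. U t * \<phi> (t - h n))" by (intro continuous_intros cU c\<phi>h)
      show "U t * \<phi> (t - h n) = 0" if "t \<notin> {a..b + h n}" for t
        using that h[of n] by auto
    qed
    have "(\<integral>t. (U (t + h n) - U t) / h n * \<phi> t \<partial>lborel)
       = (\<integral>t. (U (t + h n) * \<phi> t - U t * \<phi> t) / h n \<partial>lborel)"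
      by (simp add: algebra_simps diff_divide_distrib)
    also have "\<dots> = ((\<integral>t. U (t + h n) * \<phi> t \<partial>lborel) - (\<integral>t. U t * \<phi> t \<partial>lborel)) / h n"
      by (simp add: i1 i2)
    also have "(\<integral>t. U (t + h n) * \<phi> t \<partial>lborel) = (\<integral>t. U t * \<phi> (t - h n) \<partial>lborel)"
      using lborel_integral_real_affine[of 1 "\<lambda>t. U t * \<phi> (t - h n)" "h n"] by (simp add: add.commute[of _ "h n"])
    also have "((\<integral>t. U t * \<phi> (t - h n) \<partial>lborel) - (\<integral>t. U t * \<phi> t \<partial>lborel)) / h n
       = (\<integral>t. (U t * \<phi> (t - h n) - U t * \<phi> t) / h n \<partial>lborel)"
      by (simp add: i3 i2)
    also have "\<dots> = (\<integral>t. U t * ((\<phi> (t - h n) - \<phi> t) / h n) \<partial>lborel)"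
      by (simp add: algebra_simps diff_divide_distrib)
    finally show ?thesis by (simp add: integral_completion)
  qed
  have A: "(\<lambda>n. integral\<^sup>L lebesgue (\<lambda>t. (U (t + h n) - U t) / h n * \<phi> t))
      \<longlonglongrightarrow> integral\<^sup>L lebesgue (\<lambda>t. W t * \<phi> t)"
  proof (rule integral_dominated_convergence[where w = "\<lambda>t. L * B1 * indicator {a..b} t"])
    show "(\<lambda>t. W t * \<phi> t) \<in> borel_measurable lebesgue"
      by (intro borel_measurable_times W_meas to_leb) measurable
    show "(\<lambda>t. (U (t + h n) - U t) / h n * \<phi> t) \<in> borel_measurable lebesgue" for n
      by (rule to_leb) measurable
    show "integrable lebesgue (\<lambda>t. L * B1 * indicator {a..b} t)"
      by (intro integrable_mult_right integrable_real_indicator) (auto simp: emeasure_lborel_Icc_eq)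
    show "AE t in lebesgue. norm ((U (t + h n) - U t) / h n * \<phi> t) \<le> L * B1 * indicator {a..b} t" for n
    proof (rule AE_I2)
      fix t
      have "\<bar>(U (t + h n) - U t) / h n\<bar> \<le> L"
        using U_lip[of "t + h n" t] h(1)[of n] by (simp add: abs_divide pos_divide_le_eq)
      then show "norm ((U (t + h n) - U t) / h n * \<phi> t) \<le> L * B1 * indicator {a..b} t"
        using B(1)[of t] L0 B0 unfolding real_norm_def abs_mult[of _ "\<phi> t"]
        by (cases "t \<in> {a<..<b}") (auto simp del: abs_divide intro!: mult_mono)
    qed
    have "AE t in lebesgue. t \<in> {a<..<b} \<longrightarrow>
        (\<lambda>n. (u (t + h n) - u t) / h n) \<longlonglongrightarrow> w t"
      using lim by (subst (asm) AE_restrict_space_iff) (auto simp: h_def)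
    then show "AE t in lebesgue. (\<lambda>n. (U (t + h n) - U t) / h n * \<phi> t) \<longlonglongrightarrow> W t * \<phi> t"
    proof (eventually_elim)
      case (elim t)
      show ?case
      proof (cases "t \<in> {a<..<b}")
        case True
        then have "0 < b - t" by simp
        from order_tendstoD(2)[OF hlim this]
        have "\<forall>\<^sub>F n in sequentially. (u (t + h n) - u t) / h n = (U (t + h n) - U t) / h n"
        proof eventually_elim
          case (elim n)
          then have "max a (min b (t + h n)) = t + h n" "max a (min b t) = t"
            using True h(1)[of n] by auto
          then show ?case by (simp add: U_def)
        qed
        then have "(\<lambda>n. (U (t + h n) - U t) / h n) \<longlonglongrightarrow> W t"
          using Lim_transform_eventually[of "\<lambda>n. (u (t + h n) - u t) / h n" "w t"] elim True
          by (simp only: W_def if_True)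
        then show ?thesis by (intro tendsto_intros)
      qed simp
    qed
  qed
  have E: "(\<lambda>n. integral\<^sup>L lebesgue (\<lambda>t. U t * ((\<phi> (t - h n) - \<phi> t) / h n)))
      \<longlonglongrightarrow> integral\<^sup>L lebesgue (\<lambda>t. U t * (- deriv \<phi> t))"
  proof (rule integral_dominated_convergence[where w = "\<lambda>t. B3 * B2 * indicator {a..b+1} t"])
    show "(\<lambda>t. U t * (- deriv \<phi> t)) \<in> borel_measurable lebesgue"
      by (rule to_leb) measurable
    show "(\<lambda>t. U t * ((\<phi> (t - h n) - \<phi> t) / h n)) \<in> borel_measurable lebesgue" for n
      by (rule to_leb) measurable
    show "integrable lebesgue (\<lambda>t. B3 * B2 * indicator {a..b+1} t)"
      by (intro integrable_mult_right integrable_real_indicator) (auto simp: emeasure_lborel_Icc_eq)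
    show "AE t in lebesgue. norm (U t * ((\<phi> (t - h n) - \<phi> t) / h n)) \<le> B3 * B2 * indicator {a..b+1} t" for n
    proof (rule AE_I2)
      fix t
      obtain z where "\<phi> t - \<phi> (t - h n) = (t - (t - h n)) * deriv \<phi> z"
        using MVT2[of "t - h n" t \<phi> "deriv \<phi>"] D\<phi> h(1)[of n] by auto
      then have "\<bar>(\<phi> (t - h n) - \<phi> t) / h n\<bar> \<le> B2"
        using h(1)[of n] B2[of z] by (simp add: abs_minus_commute abs_mult)
      moreover have "t \<notin> {a..b+1} \<Longrightarrow> \<phi> (t - h n) = 0 \<and> \<phi> t = 0"
        using h[of n] by auto
      ultimately show "norm (U t * ((\<phi> (t - h n) - \<phi> t) / h n)) \<le> B3 * B2 * indicator {a..b+1} t"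
        using B3[of t] B0 unfolding real_norm_def abs_mult[of "U t"]
        by (cases "t \<in> {a..b+1}") (auto simp del: abs_divide intro!: mult_mono)
    qed
    show "AE t in lebesgue. (\<lambda>n. U t * ((\<phi> (t - h n) - \<phi> t) / h n)) \<longlonglongrightarrow> U t * (- deriv \<phi> t)"
    proof (rule AE_I2)
      fix t
      have "((\<lambda>z. (\<phi> (t + z) - \<phi> t) / z) \<longlongrightarrow> deriv \<phi> t) (at 0)"
        using D\<phi>[of t] by (simp add: DERIV_def)
      moreover have "filterlim (\<lambda>n. - h n) (at 0) sequentially"
        using tendsto_minus[OF hlim] h(1) by (auto simp: filterlim_at less_imp_neq[symmetric] intro!: always_eventually)
      ultimately have "(\<lambda>n. (\<phi> (t + - h n) - \<phi> t) / - h n) \<longlonglongrightarrow> deriv \<phi> t"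
        by (rule filterlim_compose)
      from tendsto_minus[OF this]
      have "(\<lambda>n. (\<phi> (t - h n) - \<phi> t) / h n) \<longlonglongrightarrow> - deriv \<phi> t" by simp
      then show "(\<lambda>n. U t * ((\<phi> (t - h n) - \<phi> t) / h n)) \<longlonglongrightarrow> U t * (- deriv \<phi> t)"
        by (intro tendsto_intros)
    qed
  qed
  have "integral\<^sup>L lebesgue (\<lambda>t. W t * \<phi> t) = integral\<^sup>L lebesgue (\<lambda>t. U t * (- deriv \<phi> t))"
    using A E unfolding C by (rule LIMSEQ_unique)
  also have "\<dots> = - integral\<^sup>L lebesgue (\<lambda>t. U t * deriv \<phi> t)" by simp
  also have "integral\<^sup>L lebesgue (\<lambda>t. U t * deriv \<phi> t)
     = integral\<^sup>L lebesgue (\<lambda>t. if t \<in> {a<..<b} then u t * deriv \<phi> t else 0)"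
    by (intro Bochner_Integration.integral_cong) (auto simp: U_def)
  also have "\<dots> = integral\<^sup>L (lebesgue_on {a<..<b}) (\<lambda>t. u t * deriv \<phi> t)"
    by (rule Lebesgue_Measure.integral_restrict_UNIV) simp
  also have "integral\<^sup>L lebesgue (\<lambda>t. W t * \<phi> t)
     = integral\<^sup>L lebesgue (\<lambda>t. if t \<in> {a<..<b} then w t * \<phi> t else 0)"
    by (intro Bochner_Integration.integral_cong) (auto simp: W_def)
  also have "\<dots> = integral\<^sup>L (lebesgue_on {a<..<b}) (\<lambda>t. w t * \<phi> t)"
    by (rule Lebesgue_Measure.integral_restrict_UNIV) simp
  finally show "integral\<^sup>L (lebesgue_on {a<..<b}) (\<lambda>t. u t * deriv \<phi> t) =
      - integral\<^sup>L (lebesgue_on {a<..<b}) (\<lambda>t. w t * \<phi> t)" by simp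
qed

text \<open>
  A \<open>C\<^sup>1\<close> approximation of the step function: the second difference quotient of \<open>(max 0 r)\<^sup>2 / 2\<close> rises
  from 0 to 1 on \<open>[0, 2 c]\<close>. Its derivative is the triangular kernel \<open>hat c\<close>, of total mass 1.
\<close>

definition half_square :: "real \<Rightarrow> real" where "half_square r = (max 0 r)\<^sup>2 / 2"

definition ramp :: "real \<Rightarrow> real \<Rightarrow> real" where
  "ramp c r = (half_square r - 2 * half_square (r - c) + half_square (r - 2 * c)) / c\<^sup>2"

definition hat :: "real \<Rightarrow> real \<Rightarrow> real" where
  "hat c r = (max 0 r - 2 * max 0 (r - c) + max 0 (r - 2 * c)) / c\<^sup>2"

lemma has_real_derivative_half_square: "(half_square has_real_derivative max 0 r) (at r)"
proof -
  have "\<bar>half_square (r + h) - half_square r - max 0 r * h\<bar> \<le> h\<^sup>2 / 2" for h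
  proof -
    consider "0 \<le> r" "0 \<le> r + h" | "0 \<le> r" "r + h < 0" | "r < 0" "0 \<le> r + h" | "r < 0" "r + h < 0"
      by linarith
    then show ?thesis
    proof cases
      case 2
      have "0 \<le> (r + h)\<^sup>2" "0 \<le> - (r * (r + 2 * h))" using 2 by (auto simp: mult_nonneg_nonpos)
      then show ?thesis using 2 by (simp add: half_square_def power2_eq_square algebra_simps)
    next
      case 3
      have "(r + h)\<^sup>2 \<le> h\<^sup>2" using 3 by (intro power_mono) auto
      then show ?thesis using 3 by (simp add: half_square_def)
    qed (auto simp: half_square_def power2_eq_square algebra_simps)
  qed
  note b = this
  have "\<bar>(half_square (r + h) - half_square r) / h - max 0 r\<bar> \<le> \<bar>h\<bar>" if "h \<noteq> 0" for h
  proof -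
    have "(half_square (r + h) - half_square r) / h - max 0 r
       = (half_square (r + h) - half_square r - max 0 r * h) / h"
      using that by (simp add: field_simps)
    also have "\<bar>\<dots>\<bar> \<le> (h\<^sup>2 / 2) / \<bar>h\<bar>"
      unfolding abs_divide by (intro divide_right_mono b) auto
    also have "\<dots> \<le> \<bar>h\<bar>" by (cases "h > 0") (auto simp: power2_eq_square)
    finally show ?thesis .
  qed
  then have "\<forall>\<^sub>F h in at 0. norm ((half_square (r + h) - half_square r) / h - max 0 r) \<le> \<bar>h\<bar>"
    by (simp add: eventually_at_filter)
  moreover have "((\<lambda>h. \<bar>h\<bar>) \<longlongrightarrow> 0) (at (0::real))"
    by (rule tendsto_rabs_zero) (rule tendsto_ident_at)
  ultimately have "((\<lambda>h. (half_square (r + h) - half_square r) / h - max 0 r) \<longlongrightarrow> 0) (at 0)"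
    by (rule Lim_null_comparison)
  then show ?thesis unfolding DERIV_def by (simp add: LIM_zero_iff)
qed

lemma has_real_derivative_ramp: "(ramp c has_real_derivative hat c r) (at r)"
proof -
  have shift: "((\<lambda>r. half_square (r - d)) has_real_derivative max 0 (r - d)) (at r)" for d
    using has_real_derivative_half_square[of "r - d"]
      DERIV_shift[of half_square "max 0 (r - d)" r "- d"] by simp
  show ?thesis
    unfolding ramp_def[abs_def] hat_def
    by (intro DERIV_cdivide DERIV_add DERIV_diff DERIV_cmult shift has_real_derivative_half_square)
qed

lemma hat_nonneg: "0 \<le> hat c r"
  if "0 < c" using that unfolding hat_def by (intro divide_nonneg_nonneg) (auto simp: max_def)

lemma hat_eq_0: "hat c r = 0" if "0 < c" "r \<notin> {0..2 * c}"
  using that unfolding hat_def by auto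

lemma continuous_on_hat: "continuous_on S (hat c)" if "0 < c"
  using that unfolding hat_def[abs_def] by (intro continuous_intros) auto

lemma ramp_eq_0: "ramp c r = 0" if "0 < c" "r \<le> 0"
  using that by (simp add: ramp_def half_square_def)

lemma ramp_eq_1: "ramp c r = 1" if "0 < c" "2 * c \<le> r"
  using that by (simp add: ramp_def half_square_def power2_eq_square field_simps)

lemma ramp_bounds: "0 \<le> ramp c r \<and> ramp c r \<le> 1" if c: "0 < c"
proof -
  have mono: "ramp c r \<le> ramp c s" if "r \<le> s" for r s
    by (rule DERIV_nonneg_imp_nondecreasing[OF that])
      (use has_real_derivative_ramp hat_nonneg[OF c] in blast)
  have "ramp c (min r 0) \<le> ramp c r" "ramp c r \<le> ramp c (max r (2 * c))" by (auto intro: mono)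
  then show ?thesis using ramp_eq_0[OF c, of "min r 0"] ramp_eq_1[OF c, of "max r (2 * c)"] by simp
qed

text \<open>
  The kernels \<open>hat (c n)\<close> are nonnegative, have mass 1 and concentrate at 0.
\<close>

lemma hat_mean_tendsto:
  fixes u :: "real \<Rightarrow> real"
  assumes cu: "continuous_on {a..b} u" and s: "a < s" "s < b"
    and c: "\<And>n. 0 < c n" "c \<longlonglongrightarrow> 0"
  shows "(\<lambda>n. integral {a..b} (\<lambda>\<tau>. u \<tau> * hat (c n) (\<tau> - s))) \<longlonglongrightarrow> u s"
proof (rule LIMSEQ_I)
  fix e :: real assume "0 < e"
  then have e2: "0 < e / 2" by simp
  have "s \<in> {a..b}" using s by simp
  with cu e2 have "\<exists>d>0. \<forall>\<tau>\<in>{a..b}. dist \<tau> s < d \<longrightarrow> dist (u \<tau>) (u s) < e / 2"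
    unfolding continuous_on_iff by blast
  then obtain d where d: "0 < d" "\<And>\<tau>. \<tau> \<in> {a..b} \<Longrightarrow> \<bar>\<tau> - s\<bar> < d \<Longrightarrow> \<bar>u \<tau> - u s\<bar> < e / 2"
    by (auto simp: dist_real_def)
  have "0 < min d (b - s) / 2" using d s by simp
  from order_tendstoD(2)[OF c(2) this] obtain N where
    N: "\<And>n. n \<ge> N \<Longrightarrow> c n < min d (b - s) / 2" by (auto simp: eventually_sequentially)
  have "norm (integral {a..b} (\<lambda>\<tau>. u \<tau> * hat (c n) (\<tau> - s)) - u s) < e" if n: "n \<ge> N" for n
  proof -
    have ch: "continuous_on {a..b} (\<lambda>\<tau>. hat (c n) (\<tau> - s))"
      by (rule continuous_on_compose2[OF continuous_on_hat[OF c(1), of UNIV]]) (auto intro!: continuous_intros)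
    have "((\<lambda>\<tau>. hat (c n) (\<tau> - s)) has_integral ramp (c n) (b - s) - ramp (c n) (a - s)) {a..b}"
    proof (rule fundamental_theorem_of_calculus)
      fix \<tau>
      have "((\<lambda>\<tau>. ramp (c n) (\<tau> - s)) has_real_derivative hat (c n) (\<tau> - s)) (at \<tau>)"
        using has_real_derivative_ramp[of "c n" "\<tau> - s"]
          DERIV_shift[of "ramp (c n)" "hat (c n) (\<tau> - s)" \<tau> "- s"] by simp
      then show "((\<lambda>\<tau>. ramp (c n) (\<tau> - s)) has_vector_derivative hat (c n) (\<tau> - s)) (at \<tau> within {a..b})"
        by (simp add: has_real_derivative_iff_has_vector_derivative has_vector_derivative_at_within)
    qed (use s in auto)
    moreover have "ramp (c n) (b - s) = 1" "ramp (c n) (a - s) = 0"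
      using c(1)[of n] N[OF n] s by (auto intro!: ramp_eq_1 ramp_eq_0)
    ultimately have one: "((\<lambda>\<tau>. hat (c n) (\<tau> - s)) has_integral 1) {a..b}" by simp
    have int: "(\<lambda>\<tau>. u \<tau> * hat (c n) (\<tau> - s)) integrable_on {a..b}"
      by (intro integrable_continuous_interval continuous_intros cu ch)
    have "norm (integral {a..b} (\<lambda>\<tau>. u \<tau> * hat (c n) (\<tau> - s)) - u s * 1)
        = norm (integral {a..b} (\<lambda>\<tau>. (u \<tau> - u s) * hat (c n) (\<tau> - s)))"
      using integral_unique[OF has_integral_diff[OF integrable_integral[OF int] has_integral_mult_right[OF one, of "u s"]]]
      by (simp add: algebra_simps)
    also have "\<dots> \<le> integral {a..b} (\<lambda>\<tau>. e / 2 * hat (c n) (\<tau> - s))"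
    proof (rule integral_norm_bound_integral)
      show "norm ((u \<tau> - u s) * hat (c n) (\<tau> - s)) \<le> e / 2 * hat (c n) (\<tau> - s)"
        if \<tau>: "\<tau> \<in> {a..b}" for \<tau>
      proof (cases "\<tau> - s \<in> {0..2 * c n}")
        case True
        then have "\<bar>u \<tau> - u s\<bar> \<le> e / 2" using d(2)[OF \<tau>] N[OF n] by auto
        then show ?thesis
          using hat_nonneg[OF c(1)[of n], of "\<tau> - s"] mult_right_mono[of "\<bar>u \<tau> - u s\<bar>" "e / 2" "hat (c n) (\<tau> - s)"]
          by (simp only: real_norm_def abs_mult abs_of_nonneg)
      qed (simp add: hat_eq_0 c)
    qed (intro integrable_continuous_interval continuous_intros cu ch)+
    also have "\<dots> = e / 2" using integral_unique[OF has_integral_mult_right[OF one, of "e/2"]] by simp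
    finally show ?thesis using \<open>0 < e\<close> by simp
  qed
  then show "\<exists>N. \<forall>n\<ge>N. norm (integral {a..b} (\<lambda>\<tau>. u \<tau> * hat (c n) (\<tau> - s)) - u s) < e" by blast
qed

lemma Lq_space_1_iff: "v \<in> Lq_space 1 S \<longleftrightarrow> integrable (lebesgue_on S) v"
proof -
  have "(\<lambda>t. \<bar>v t\<bar> powr 1) = (\<lambda>t. \<bar>v t\<bar>)" by simp
  then have "v \<in> Lq_space 1 S \<longleftrightarrow>
      v \<in> borel_measurable (lebesgue_on S) \<and> integrable (lebesgue_on S) (\<lambda>t. \<bar>v t\<bar>)"
    by (simp only: Lq_space_def mem_Collect_eq)
  also have "\<dots> \<longleftrightarrow> integrable (lebesgue_on S) v"
    using integrable_abs_iff[of v "lebesgue_on S"] borel_measurable_integrable by blast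
  finally show ?thesis .
qed

lemma integrable_lebesgue_on_subset:
  fixes v :: "real \<Rightarrow> real"
  assumes v: "integrable (lebesgue_on S) v" and S: "S \<in> sets lebesgue" "S' \<in> sets lebesgue" "S' \<subseteq> S"
  shows "integrable (lebesgue_on S') v"
proof -
  have "integrable lebesgue (\<lambda>x. if x \<in> S then v x else 0)"
    using v S by (simp add: Lebesgue_Measure.integrable_restrict_UNIV)
  then have "integrable lebesgue (\<lambda>x. indicator S' x *\<^sub>R (if x \<in> S then v x else 0))"
    using S by (intro integrable_mult_indicator) auto
  also have "(\<lambda>x. indicator S' x *\<^sub>R (if x \<in> S then v x else 0)) = (\<lambda>x. if x \<in> S' then v x else 0)"
    using S by (auto simp: indicator_def fun_eq_iff)
  finally show ?thesis using S by (simp add: Lebesgue_Measure.integrable_restrict_UNIV)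
qed

text \<open>
  The difference of two ramps, starting at \<open>s\<close> and at \<open>t\<close>, is a test function close to the indicator of
  \<open>{s<..t}\<close>. Its derivative is a difference of kernels, so testing yields averages of \<open>u\<close> near \<open>s\<close> and
  near \<open>t\<close> on one side and, in the limit, the integral of \<open>v\<close> on the other.
\<close>

lemma weak_deriv_increment_interior:
  fixes u v :: "real \<Rightarrow> real"
  assumes cu: "continuous_on {a..b} u" and v: "integrable (lebesgue_on {a<..<b}) v"
    and wd: "weak_deriv a b u v" and st: "a < s" "s < t" "t < b"
  shows "integral {s..t} v = u t - u s"
proof -
  \<comment> \<open>The factor 1/3 keeps the second ramp, of width \<open>2 * c n\<close>, away from \<open>b\<close>.\<close>
  define c where "c n = (b - t) / 3 * (1 / real (Suc n))" for n
  have c: "0 < c n" "c n \<le> (b - t) / 3" for n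
  proof -
    show "0 < c n" using st by (simp add: c_def)
    have "(b - t) / 3 * (1 / real (Suc n)) \<le> (b - t) / 3 * 1"
      using st by (intro mult_left_mono) auto
    then show "c n \<le> (b - t) / 3" by (simp add: c_def)
  qed
  have clim: "c \<longlonglongrightarrow> 0"
    unfolding c_def using tendsto_mult_right_zero[OF LIMSEQ_Suc[OF lim_1_over_n], of "(b - t) / 3"] .
  define \<phi> where "\<phi> n \<tau> = ramp (c n) (\<tau> - s) - ramp (c n) (\<tau> - t)" for n \<tau>
  define \<phi>' where "\<phi>' n \<tau> = hat (c n) (\<tau> - s) - hat (c n) (\<tau> - t)" for n \<tau>
  have d: "(\<phi> n has_real_derivative \<phi>' n \<tau>) (at \<tau>)" for n \<tau>
  proof -
    have "((\<lambda>\<tau>. ramp (c n) (\<tau> - r)) has_real_derivative hat (c n) (\<tau> - r)) (at \<tau>)" for r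
      using has_real_derivative_ramp[of "c n" "\<tau> - r"]
        DERIV_shift[of "ramp (c n)" "hat (c n) (\<tau> - r)" \<tau> "- r"] by simp
    then show ?thesis unfolding \<phi>_def[abs_def] \<phi>'_def by (intro DERIV_diff)
  qed
  have ch: "continuous_on S (\<lambda>\<tau>. hat (c n) (\<tau> - r))" for S n r
    by (rule continuous_on_compose2[OF continuous_on_hat[OF c(1), of UNIV]]) (auto intro!: continuous_intros)
  have c\<phi>: "continuous_on UNIV (\<phi> n)" for n
    by (rule DERIV_continuous_on[of _ _ "\<phi>' n"]) (rule d)
  have \<phi>0: "\<phi> n \<tau> = 0" if "\<tau> \<notin> {s..t + 2 * c n}" for n \<tau>
    using that c(1)[of n] st ramp_eq_0[OF c(1)[of n]] ramp_eq_1[OF c(1)[of n]]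
    by (auto simp: \<phi>_def not_le)
  have test: "test_function a b (\<phi> n)" for n
  proof -
    have "{\<tau>. \<phi> n \<tau> \<noteq> 0} \<subseteq> {s..t + 2 * c n}" using \<phi>0 by blast
    then have "closure {\<tau>. \<phi> n \<tau> \<noteq> 0} \<subseteq> {s..t + 2 * c n}" by (rule closure_minimal) simp
    also have "\<dots> \<subseteq> {a<..<b}" using c[of n] st by auto
    finally have "closure {\<tau>. \<phi> n \<tau> \<noteq> 0} \<subseteq> {a<..<b}" .
    moreover have "\<phi> n C1_differentiable_on UNIV"
      unfolding C1_differentiable_on_def using d
      by (intro exI[of _ "\<phi>' n"]) (auto simp: has_real_derivative_iff_has_vector_derivative[symmetric]
          \<phi>'_def[abs_def] intro!: continuous_intros ch)
    ultimately show ?thesis by (simp add: test_function_def)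
  qed
  have eq: "integral\<^sup>L (lebesgue_on {a<..<b}) (\<lambda>\<tau>. u \<tau> * \<phi>' n \<tau>)
      = - integral\<^sup>L (lebesgue_on {a<..<b}) (\<lambda>\<tau>. v \<tau> * \<phi> n \<tau>)" for n
  proof -
    have "deriv (\<phi> n) = \<phi>' n" using d by (auto intro: DERIV_imp_deriv)
    then show ?thesis using wd test[of n] by (auto simp: weak_deriv_def)
  qed
  have left: "integral\<^sup>L (lebesgue_on {a<..<b}) (\<lambda>\<tau>. u \<tau> * \<phi>' n \<tau>)
      = integral {a..b} (\<lambda>\<tau>. u \<tau> * hat (c n) (\<tau> - s)) - integral {a..b} (\<lambda>\<tau>. u \<tau> * hat (c n) (\<tau> - t))" for n
  proof -
    have "continuous_on {a..b} (\<lambda>\<tau>. u \<tau> * \<phi>' n \<tau>)"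
      unfolding \<phi>'_def[abs_def] by (intro continuous_intros cu ch)
    then have "integrable (lebesgue_on {a..b}) (\<lambda>\<tau>. u \<tau> * \<phi>' n \<tau>)"
      by (rule continuous_imp_integrable_real)
    then have "integrable (lebesgue_on {a<..<b}) (\<lambda>\<tau>. u \<tau> * \<phi>' n \<tau>)"
      by (rule integrable_lebesgue_on_subset) auto
    then have "integral\<^sup>L (lebesgue_on {a<..<b}) (\<lambda>\<tau>. u \<tau> * \<phi>' n \<tau>) = integral {a..b} (\<lambda>\<tau>. u \<tau> * \<phi>' n \<tau>)"
      by (simp add: lebesgue_integral_eq_integral integral_open_interval_real)
    also have "\<dots> = integral {a..b} (\<lambda>\<tau>. u \<tau> * hat (c n) (\<tau> - s) - u \<tau> * hat (c n) (\<tau> - t))"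
      by (simp add: \<phi>'_def algebra_simps)
    also have "\<dots> = integral {a..b} (\<lambda>\<tau>. u \<tau> * hat (c n) (\<tau> - s)) - integral {a..b} (\<lambda>\<tau>. u \<tau> * hat (c n) (\<tau> - t))"
      by (intro Henstock_Kurzweil_Integration.integral_diff integrable_continuous_interval continuous_intros cu ch)
    finally show ?thesis .
  qed
  have L: "(\<lambda>n. integral\<^sup>L (lebesgue_on {a<..<b}) (\<lambda>\<tau>. u \<tau> * \<phi>' n \<tau>)) \<longlonglongrightarrow> u s - u t"
    unfolding left by (intro tendsto_diff hat_mean_tendsto cu c clim) (use st in auto)
  have R: "(\<lambda>n. integral\<^sup>L (lebesgue_on {a<..<b}) (\<lambda>\<tau>. v \<tau> * \<phi> n \<tau>))
      \<longlonglongrightarrow> integral\<^sup>L (lebesgue_on {a<..<b}) (\<lambda>\<tau>. v \<tau> * indicator {s<..t} \<tau>)"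
  proof (rule integral_dominated_convergence[where w = "\<lambda>\<tau>. \<bar>v \<tau>\<bar>"])
    have vm: "v \<in> borel_measurable (lebesgue_on {a<..<b})" using v by simp
    have "\<phi> n \<in> borel_measurable (lebesgue_on {a<..<b})" for n
      by (intro continuous_imp_measurable_on_sets_lebesgue continuous_on_subset[OF c\<phi>]) auto
    then show "(\<lambda>\<tau>. v \<tau> * \<phi> n \<tau>) \<in> borel_measurable (lebesgue_on {a<..<b})" for n
      by (intro borel_measurable_times vm)
    have "indicator {s<..t} \<in> borel_measurable (lebesgue_on {a<..<b})"
      by (intro borel_measurable_indicator) (use st in \<open>auto simp: sets_restrict_space_iff\<close>)
    then show "(\<lambda>\<tau>. v \<tau> * indicator {s<..t} \<tau>) \<in> borel_measurable (lebesgue_on {a<..<b})"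
      by (intro borel_measurable_times vm)
    show "integrable (lebesgue_on {a<..<b}) (\<lambda>\<tau>. \<bar>v \<tau>\<bar>)" using v by simp
    show "AE \<tau> in lebesgue_on {a<..<b}. norm (v \<tau> * \<phi> n \<tau>) \<le> \<bar>v \<tau>\<bar>" for n
    proof (rule AE_I2)
      fix \<tau>
      have "\<bar>\<phi> n \<tau>\<bar> \<le> 1"
        using ramp_bounds[OF c(1)[of n], of "\<tau> - s"] ramp_bounds[OF c(1)[of n], of "\<tau> - t"]
        by (auto simp: \<phi>_def)
      then show "norm (v \<tau> * \<phi> n \<tau>) \<le> \<bar>v \<tau>\<bar>" by (simp add: abs_mult mult_left_le)
    qed
    show "AE \<tau> in lebesgue_on {a<..<b}. (\<lambda>n. v \<tau> * \<phi> n \<tau>) \<longlonglongrightarrow> v \<tau> * indicator {s<..t} \<tau>"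
    proof (rule AE_I2)
      fix \<tau>
      have one: "(\<lambda>n. ramp (c n) r) \<longlonglongrightarrow> (if 0 < r then 1 else 0)" for r
      proof (cases "0 < r")
        case True
        then have "0 < r / 2" by simp
        from order_tendstoD(2)[OF clim this]
        have "\<forall>\<^sub>F n in sequentially. ramp (c n) r = 1"
          by eventually_elim (rule ramp_eq_1, use c in auto)
        then show ?thesis using True by (simp add: tendsto_eventually)
      qed (simp add: ramp_eq_0 c)
      have "(\<lambda>n. \<phi> n \<tau>) \<longlonglongrightarrow> (if 0 < \<tau> - s then 1 else 0) - (if 0 < \<tau> - t then 1 else 0)"
        unfolding \<phi>_def by (intro tendsto_diff one)
      also have "(if 0 < \<tau> - s then 1 else 0) - (if 0 < \<tau> - t then 1 else 0) = indicat_real {s<..t} \<tau>"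
        using st by (auto simp: indicator_def)
      finally show "(\<lambda>n. v \<tau> * \<phi> n \<tau>) \<longlonglongrightarrow> v \<tau> * indicator {s<..t} \<tau>" by (intro tendsto_intros)
    qed
  qed
  have "u s - u t = - integral\<^sup>L (lebesgue_on {a<..<b}) (\<lambda>\<tau>. v \<tau> * indicator {s<..t} \<tau>)"
    using LIMSEQ_unique[OF L] tendsto_minus[OF R] by (simp add: eq)
  also have "integral\<^sup>L (lebesgue_on {a<..<b}) (\<lambda>\<tau>. v \<tau> * indicator {s<..t} \<tau>)
      = integral\<^sup>L lebesgue (\<lambda>\<tau>. if \<tau> \<in> {a<..<b} then v \<tau> * indicator {s<..t} \<tau> else 0)"
    by (rule Lebesgue_Measure.integral_restrict_UNIV[symmetric]) simp
  also have "\<dots> = integral\<^sup>L lebesgue (\<lambda>\<tau>. if \<tau> \<in> {s<..t} then v \<tau> else 0)"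
    by (intro Bochner_Integration.integral_cong) (use st in \<open>auto simp: indicator_def\<close>)
  also have "\<dots> = integral\<^sup>L (lebesgue_on {s<..t}) v"
    by (rule Lebesgue_Measure.integral_restrict_UNIV) simp
  also have "\<dots> = integral {s<..t} v"
  proof (rule lebesgue_integral_eq_integral)
    show "integrable (lebesgue_on {s<..t}) v"
      by (rule integrable_lebesgue_on_subset[OF v]) (use st in auto)
  qed simp
  also have "\<dots> = integral {s..t} v"
    by (rule integral_spike_set; rule negligible_subset[OF negligible_sing[of s]]; auto)
  finally show ?thesis by simp
qed

text \<open>
  The fundamental theorem of calculus for weak derivatives. Both \<open>u\<close> and the indefinite integral of \<open>v\<close>
  are continuous on the closed interval, so the interior identity extends to the end points.
\<close>

lemma weak_deriv_has_integral:
  fixes u v :: "real \<Rightarrow> real"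
  assumes ab: "a < b" and cu: "continuous_on {a..b} u" and v: "v \<in> Lq_space 1 {a<..<b}"
    and wd: "weak_deriv a b u v" and st: "a \<le> s" "s \<le> t" "t \<le> b"
  shows "(v has_integral u t - u s) {s..t}"
proof -
  have v': "integrable (lebesgue_on {a<..<b}) v" using v by (simp add: Lq_space_1_iff)
  then have "v integrable_on {a<..<b}" by (intro integrable_on_lebesgue_on) auto
  then have vi: "v integrable_on {a..b}" by (simp add: integrable_on_Icc_iff_Ioo)
  define I where "I r = integral {a..r} v" for r
  have cI: "continuous_on {a..b} I"
    unfolding I_def using vi by (rule indefinite_integral_continuous_1)
  have inc: "I q - I r = integral {r..q} v" if "a \<le> r" "r \<le> q" "q \<le> b" for r q
    using Henstock_Kurzweil_Integration.integral_combine[of a r q v] that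
      integrable_subinterval_real[OF vi, of a q] by (auto simp: I_def)
  define m where "m = (a + b) / 2"
  have m: "a < m" "m < b" using ab by (auto simp: m_def)
  have const: "I r - u r = I m - u m" if "r \<in> {a<..<b}" for r
    using weak_deriv_increment_interior[OF cu v' wd, of r m] weak_deriv_increment_interior[OF cu v' wd, of m r]
      inc[of r m] inc[of m r] m that by (cases r m rule: linorder_cases) auto
  have "I r - u r = I m - u m" if r: "r \<in> {a..b}" for r
  proof (rule continuous_constant_on_closure[of "{a<..<b}" "\<lambda>r. I r - u r"])
    show "continuous_on (closure {a<..<b}) (\<lambda>r. I r - u r)" "r \<in> closure {a<..<b}"
      using ab r by (auto intro!: continuous_intros cI cu)
  qed (rule const)
  from this[of s] this[of t] have "u t - u s = integral {s..t} v"
    using inc[of s t] st by auto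
  then show ?thesis
    using integrable_subinterval_real[OF vi, of s t] st by (auto intro: integrable_integral)
qed

section \<open>Derivatives of Lipschitz functions\<close>

text \<open>
  The Stieltjes measure of \<open>h\<close> is the image of Lebesgue measure under the inverse of \<open>h\<close>. It is absolutely
  continuous because a Lipschitz map sends null sets to null sets, and \<open>w\<close> is its Radon-Nikodym
  density. The lower bound makes \<open>h\<close> invertible.
\<close>

lemma bilipschitz_indefinite_integral:
  fixes h :: "real \<Rightarrow> real"
  assumes lo: "\<And>s t. s \<le> t \<Longrightarrow> t - s \<le> h t - h s" and up: "\<And>s t. s \<le> t \<Longrightarrow> h t - h s \<le> K * (t - s)"
  obtains w where "w \<in> borel_measurable borel" "\<And>s t. s \<le> t \<Longrightarrow> (w has_integral h t - h s) {s..t}"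
proof -
  have K: "\<bar>h s - h t\<bar> \<le> \<bar>K\<bar> * \<bar>s - t\<bar>" for s t
  proof -
    have *: "\<bar>h t - h s\<bar> \<le> \<bar>K\<bar> * \<bar>t - s\<bar>" if "s \<le> t" for s t
      using lo[OF that] up[OF that] that mult_right_mono[OF abs_ge_self[of K], of "t - s"] by simp
    then show ?thesis using *[of s t] *[of t s] by (cases "s \<le> t") (auto simp: abs_minus_commute)
  qed
  have "\<bar>K\<bar>-lipschitz_on UNIV h" using K by (auto simp: lipschitz_on_def dist_real_def)
  then have ch: "continuous_on UNIV h" by (rule lipschitz_on_continuous_on)
  have strict: "strict_mono h"
    by (rule strict_monoI) (use lo in \<open>smt (verit, best)\<close>)
  then have inj: "inj h" by (rule strict_mono_imp_inj_on)
  have "\<exists>t. h t = r" for r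
  proof -
    have "h (min 0 (r - h 0)) \<le> r" using lo[of "min 0 (r - h 0)" 0] by (auto simp: min_def)
    moreover have "r \<le> h (max 0 (r - h 0))" using lo[of 0 "max 0 (r - h 0)"] by (auto simp: max_def)
    ultimately show ?thesis
      using IVT'[of h "min 0 (r - h 0)" r "max 0 (r - h 0)"] continuous_on_subset[OF ch] by fastforce
  qed
  then have surj: "surj h" by (metis surj_def)
  define k where "k = inv h"
  have hk: "h (k r) = r" "k (h t) = t" for r t
    using inj surj by (auto simp: k_def surj_f_inv_f)
  have k_lip: "\<bar>k r - k q\<bar> \<le> \<bar>r - q\<bar>" for r q
    using lo[of "k r" "k q"] lo[of "k q" "k r"] by (cases "k r \<le> k q") (auto simp: hk)
  then have "1-lipschitz_on UNIV k" by (auto simp: lipschitz_on_def dist_real_def)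
  then have km[measurable]: "k \<in> borel_measurable borel"
    by (intro borel_measurable_continuous_onI lipschitz_on_continuous_on)
  define \<nu> where "\<nu> = distr lborel borel k"
  have vim: "k -` A = h ` A" for A
    using hk by (auto simp: image_iff) (metis)
  have \<nu>: "emeasure \<nu> A = emeasure lborel (h ` A)" if "A \<in> sets borel" for A
    using that by (simp add: \<nu>_def emeasure_distr vim)
  have "absolutely_continuous lborel \<nu>"
    unfolding absolutely_continuous_def
  proof
    fix N assume N: "N \<in> null_sets (lborel :: real measure)"
    then have Nb: "N \<in> sets borel" by auto
    have "negligible N" using N by (simp add: negligible_iff_null_sets null_sets_completionI)
    then have "negligible (h ` N)"
      by (rule negligible_locally_Lipschitz_image[rotated])
        (use K in \<open>auto intro!: exI[of _ UNIV] exI[of _ "\<bar>K\<bar>"]\<close>)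
    moreover have "h ` N \<in> sets borel"
      using measurable_sets[OF km Nb] by (simp add: vim)
    ultimately have "emeasure lborel (h ` N) = 0"
      by (simp add: negligible_iff_emeasure0)
    then show "N \<in> null_sets \<nu>" using Nb \<nu>[OF Nb] by (intro null_setsI) (auto simp: \<nu>_def)
  qed
  moreover have "sets \<nu> = sets lborel" by (simp add: \<nu>_def)
  ultimately obtain f where f: "f \<in> borel_measurable lborel" "density lborel f = \<nu>"
    using sigma_finite_measure.Radon_Nikodym[OF lborel.sigma_finite_measure_axioms] by blast
  define w where "w t = enn2real (f t)" for t
  have [measurable]: "f \<in> borel_measurable borel" using f(1) by simp
  have wm: "w \<in> borel_measurable borel" unfolding w_def[abs_def] by measurable
  have "(w has_integral h t - h s) {s..t}" if st: "s \<le> t" for s t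
  proof -
    have hst: "0 \<le> h t - h s" using lo[OF st] st by simp
    have img: "h ` {s..t} = {h s..h t}"
    proof
      show "h ` {s..t} \<subseteq> {h s..h t}" using strict by (auto simp: strict_mono_less_eq)
      show "{h s..h t} \<subseteq> h ` {s..t}"
      proof
        fix r assume "r \<in> {h s..h t}"
        then have "k r \<in> {s..t}" 
          using strict_mono_less_eq[OF strict, of s "k r"] strict_mono_less_eq[OF strict, of "k r" t]
          by (simp add: hk)
        then show "r \<in> h ` {s..t}" by (metis hk(1) image_eqI)
      qed
    qed
    have int: "(\<integral>\<^sup>+x. f x * indicator {s..t} x \<partial>lborel) = ennreal (h t - h s)"
      using emeasure_density[of f lborel "{s..t}"] f(2) \<nu>[of "{s..t}"] hst by (simp add: img)
    then have "AE x in lborel. f x * indicator {s..t} x \<noteq> \<infinity>"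
      by (intro nn_integral_PInf_AE) auto
    then have "(\<integral>\<^sup>+x. ennreal (w x * indicator {s..t} x) \<partial>lborel) = (\<integral>\<^sup>+x. f x * indicator {s..t} x \<partial>lborel)"
      by (intro nn_integral_cong_AE, eventually_elim) (auto simp: w_def indicator_def less_top[symmetric])
    then have "((\<lambda>x. w x * indicator {s..t} x) has_integral h t - h s) UNIV"
      using hst wm by (intro nn_integral_has_integral) (auto simp: int w_def)
    moreover have "(\<lambda>x. w x * indicator {s..t} x) = (\<lambda>x. if x \<in> {s..t} then w x else 0)"
      by (auto simp: indicator_def)
    ultimately show ?thesis by (simp only: has_integral_restrict_UNIV)
  qed
  with wm show ?thesis by (rule that)
qed

text \<open>
  Adding the linear function \<open>(L + 1) t\<close> makes \<open>U\<close> bi-Lipschitz and hence an indefinite integral, to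
  which Lebesgue's differentiation theorem applies.
\<close>

lemma lipschitz_right_derivative_AE:
  fixes U :: "real \<Rightarrow> real"
  assumes lip: "L-lipschitz_on UNIV U"
  obtains w where "w \<in> borel_measurable borel"
    "AE t in lebesgue. (\<lambda>n. (U (t + 1 / real (Suc n)) - U t) / (1 / real (Suc n))) \<longlonglongrightarrow> w t"
proof -
  have l: "\<bar>U t - U s\<bar> \<le> L * (t - s)" if "s \<le> t" for s t
    using lipschitz_onD[OF lip, of t s] that by (simp add: dist_real_def)
  define h where "h t = U t + (L + 1) * t" for t
  have lo: "t - s \<le> h t - h s" and up: "h t - h s \<le> (2 * L + 1) * (t - s)" if "s \<le> t" for s t
    using l[OF that] by (simp_all add: h_def algebra_simps abs_le_iff)
  obtain w where w: "w \<in> borel_measurable borel" "\<And>s t. s \<le> t \<Longrightarrow> (w has_integral h t - h s) {s..t}"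
    by (rule bilipschitz_indefinite_integral[of h "2 * L + 1", OF lo up]) blast+
  have "w integrable_on cbox s t" for s t
    using w(2)[of s t] by (cases "s \<le> t") auto
  from integrable_ccontinuous_explicit[OF this] obtain N where N: "negligible N"
    "\<And>x e. \<lbrakk>x \<notin> N; 0 < e\<rbrakk> \<Longrightarrow> \<exists>d>0. \<forall>\<eta>. 0 < \<eta> \<and> \<eta> < d \<longrightarrow>
        norm (integral (cbox x (x + \<eta> *\<^sub>R One)) w /\<^sub>R \<eta> ^ DIM(real) - w x) < e"
    by metis
  have quot: "(U (x + \<eta>) - U x) / \<eta> = integral (cbox x (x + \<eta> *\<^sub>R One)) w /\<^sub>R \<eta> ^ DIM(real) - (L + 1)"
    if "0 < \<eta>" for x \<eta>
  proof -
    have "integral {x..x + \<eta>} w = h (x + \<eta>) - h x"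
      using w(2)[of x "x + \<eta>"] that by (auto intro: integral_unique)
    then show ?thesis using that by (simp add: h_def field_simps)
  qed
  have "(\<lambda>n. (U (t + 1 / real (Suc n)) - U t) / (1 / real (Suc n))) \<longlonglongrightarrow> w t - (L + 1)" if "t \<notin> N" for t
  proof (rule LIMSEQ_I)
    fix e :: real assume "0 < e"
    from N(2)[OF that this] obtain d where d: "0 < d"
      "\<And>\<eta>. 0 < \<eta> \<Longrightarrow> \<eta> < d \<Longrightarrow> norm (integral (cbox t (t + \<eta> *\<^sub>R One)) w /\<^sub>R \<eta> ^ DIM(real) - w t) < e"
      by blast
    from order_tendstoD(2)[OF LIMSEQ_Suc[OF lim_1_over_n] d(1)] obtain n0 where
      n0: "\<And>n. n \<ge> n0 \<Longrightarrow> 1 / real (Suc n) < d" by (auto simp: eventually_sequentially)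
    have "norm ((U (t + 1 / real (Suc n)) - U t) / (1 / real (Suc n)) - (w t - (L + 1))) < e"
      if "n \<ge> n0" for n
      using d(2)[OF _ n0[OF that]] by (subst quot) auto
    then show "\<exists>n0. \<forall>n\<ge>n0. norm ((U (t + 1 / real (Suc n)) - U t) / (1 / real (Suc n)) - (w t - (L + 1))) < e"
      by blast
  qed
  then have "AE t in lebesgue. (\<lambda>n. (U (t + 1 / real (Suc n)) - U t) / (1 / real (Suc n))) \<longlonglongrightarrow> w t - (L + 1)"
    using N(1) by (intro AE_I'[of N]) (auto simp: negligible_iff_null_sets)
  moreover have "(\<lambda>t. w t - (L + 1)) \<in> borel_measurable borel" using w(1) by measurable
  ultimately show ?thesis using that by blast
qed

section \<open>Function spaces and norms\<close>

lemma continuous_imp_Lq_space: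
  fixes u :: "real \<Rightarrow> real"
  assumes cu: "continuous_on {a..b} u" and q: "0 < q"
  shows "u \<in> Lq_space q {a<..<b}"
proof -
  have int: "integrable (lebesgue_on {a<..<b}) v" if "continuous_on {a..b} v" for v :: "real \<Rightarrow> real"
    by (rule integrable_lebesgue_on_subset[OF continuous_imp_integrable_real[OF that]]) auto
  have "continuous_on {a..b} (\<lambda>t. \<bar>u t\<bar> powr q)"
    using q by (intro continuous_on_powr' continuous_intros cu) auto
  from int[OF this] int[OF cu] show ?thesis
    unfolding Lq_space_def using borel_measurable_integrable by blast
qed

lemma continuous_imp_Linf_space:
  fixes u :: "real \<Rightarrow> real"
  assumes cu: "continuous_on {a..b} u"
  shows "u \<in> Linf_space {a<..<b}"
proof -
  have "bounded (u ` {a..b})"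
    by (intro compact_imp_bounded compact_continuous_image cu) simp
  then obtain B where "\<And>t. t \<in> {a..b} \<Longrightarrow> \<bar>u t\<bar> \<le> B"
    unfolding bounded_iff by (metis image_eqI real_norm_def)
  then have "AE t in lebesgue_on {a<..<b}. \<bar>u t\<bar> \<le> B" by (intro AE_I2) auto
  moreover have "u \<in> borel_measurable (lebesgue_on {a<..<b})"
    using continuous_imp_Lq_space[OF cu, of 1] by (simp add: Lq_space_def)
  ultimately show ?thesis unfolding Linf_space_def by blast
qed

text \<open>
  After extension by constants the previous lemma applies. The limits of the quotients inherit the
  Lipschitz bound, hence are integrable.
\<close>

lemma lipschitz_weak_derivative:
  fixes u :: "real \<Rightarrow> real"
  assumes ab: "a < b" and lip: "L-lipschitz_on {a..b} u"
  obtains w where "w \<in> Lq_space 1 {a<..<b}" "weak_deriv a b u w"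
    "AE t in lebesgue_on {a<..<b}. (\<lambda>n. (u (t + 1 / real (Suc n)) - u t) / (1 / real (Suc n))) \<longlonglongrightarrow> w t"
proof -
  define U where "U t = u (max a (min b t))" for t
  have L0: "0 \<le> L" using lip by (rule lipschitz_on_nonneg)
  have U_lip: "L-lipschitz_on UNIV U"
  proof (rule lipschitz_onI)
    fix s t :: real
    have "dist (U s) (U t) \<le> L * \<bar>max a (min b s) - max a (min b t)\<bar>"
      using lipschitz_onD[OF lip, of "max a (min b s)" "max a (min b t)"] ab
      by (auto simp: U_def dist_real_def)
    also have "\<dots> \<le> L * dist s t" unfolding dist_real_def by (intro mult_left_mono L0) auto
    finally show "dist (U s) (U t) \<le> L * dist s t" .
  qed (rule L0)
  obtain w where w: "w \<in> borel_measurable borel"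
    "AE t in lebesgue. (\<lambda>n. (U (t + 1 / real (Suc n)) - U t) / (1 / real (Suc n))) \<longlonglongrightarrow> w t"
    using lipschitz_right_derivative_AE[OF U_lip] by blast
  have wm: "w \<in> borel_measurable (lebesgue_on {a<..<b})"
    using w(1) by (intro measurable_restrict_space1 measurable_completion) simp
  have lim: "AE t in lebesgue_on {a<..<b}.
      (\<lambda>n. (u (t + 1 / real (Suc n)) - u t) / (1 / real (Suc n))) \<longlonglongrightarrow> w t \<and> \<bar>w t\<bar> \<le> L"
  proof (subst AE_restrict_space_iff)
    show "AE t in lebesgue. t \<in> {a<..<b} \<longrightarrow>
      (\<lambda>n. (u (t + 1 / real (Suc n)) - u t) / (1 / real (Suc n))) \<longlonglongrightarrow> w t \<and> \<bar>w t\<bar> \<le> L"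
      using w(2)
    proof eventually_elim
      case (elim t)
      show ?case
      proof
        assume t: "t \<in> {a<..<b}"
        then have "0 < b - t" by simp
        from order_tendstoD(2)[OF LIMSEQ_Suc[OF lim_1_over_n] this]
        have "\<forall>\<^sub>F n in sequentially. (U (t + 1 / real (Suc n)) - U t) / (1 / real (Suc n))
           = (u (t + 1 / real (Suc n)) - u t) / (1 / real (Suc n))"
        proof eventually_elim
          case (elim n)
          have "0 < 1 / real (Suc n)" by simp
          moreover have "max a (min b (t + \<eta>)) = t + \<eta>" "max a (min b t) = t"
            if "0 < \<eta>" "\<eta> < b - t" for \<eta> using t that by auto
          ultimately have "max a (min b (t + 1 / real (Suc n))) = t + 1 / real (Suc n)" "max a (min b t) = t"
            using elim by blast+
          then show ?case by (simp only: U_def)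
        qed
        from Lim_transform_eventually[OF elim this]
        have "(\<lambda>n. (u (t + 1 / real (Suc n)) - u t) / (1 / real (Suc n))) \<longlonglongrightarrow> w t" .
        moreover have "\<bar>(U (t + 1 / real (Suc n)) - U t) / (1 / real (Suc n))\<bar> \<le> L" for n
        proof -
          have "\<bar>U (t + 1 / real (Suc n)) - U t\<bar> \<le> L * (1 / real (Suc n))"
            using lipschitz_onD[OF U_lip, of "t + 1 / real (Suc n)" t] by (simp add: dist_real_def)
          moreover have "\<bar>d / \<eta>\<bar> \<le> L" if "\<bar>d\<bar> \<le> L * \<eta>" "0 < \<eta>" for d \<eta> :: real
            using that by (simp add: abs_divide pos_divide_le_eq)
          ultimately show ?thesis by (metis of_nat_0_less_iff zero_less_Suc zero_less_divide_1_iff)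
        qed
        then have "\<bar>w t\<bar> \<le> L"
          by (intro LIMSEQ_le_const2[OF tendsto_rabs[OF elim]]) blast
        ultimately show "(\<lambda>n. (u (t + 1 / real (Suc n)) - u t) / (1 / real (Suc n))) \<longlonglongrightarrow> w t \<and> \<bar>w t\<bar> \<le> L"
          by blast
      qed
    qed
  qed simp
  then have lim': "AE t in lebesgue_on {a<..<b}.
      (\<lambda>n. (u (t + 1 / real (Suc n)) - u t) / (1 / real (Suc n))) \<longlonglongrightarrow> w t"
    by (rule eventually_mono) blast
  have "integrable (lebesgue_on {a<..<b}) w"
  proof (rule Bochner_Integration.integrable_bound[OF _ wm])
    show "integrable (lebesgue_on {a<..<b}) (\<lambda>_. L)"
      by (rule integrable_lebesgue_on_subset[OF continuous_imp_integrable_real[of a b]]) auto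
    show "AE t in lebesgue_on {a<..<b}. norm (w t) \<le> norm L"
      using lim by (rule eventually_mono) (use L0 in auto)
  qed
  then have "w \<in> Lq_space 1 {a<..<b}" by (simp add: Lq_space_1_iff)
  moreover have "weak_deriv a b u w"
    by (rule weak_deriv_if_difference_quotients_converge[OF ab lip wm lim'])
  ultimately show ?thesis using lim' by (rule that)
qed

lemma C1_weak_deriv:
  fixes u u' :: "real \<Rightarrow> real"
  assumes ab: "a < b" and cu: "continuous_on {a..b} u" and cu': "continuous_on {a..b} u'"
    and d: "\<And>t. a < t \<Longrightarrow> t < b \<Longrightarrow> (u has_real_derivative u' t) (at t)"
  shows "weak_deriv a b u u'"
proof -
  have "bounded (u' ` {a..b})"
    by (intro compact_imp_bounded compact_continuous_image cu') simp
  then obtain B where B: "\<And>t. t \<in> {a..b} \<Longrightarrow> \<bar>u' t\<bar> \<le> B"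
    unfolding bounded_iff by (metis image_eqI real_norm_def)
  have *: "\<bar>u t - u s\<bar> \<le> B * t - B * s" if "a \<le> s" "s \<le> t" "t \<le> b" for s t
    by (rule deriv_abs_bound_diff[where u' = u' and p' = "\<lambda>_. B"])
      (use that B d in \<open>auto intro!: continuous_on_subset[OF cu] continuous_intros derivative_eq_intros\<close>)
  have "B-lipschitz_on {a..b} u"
  proof (rule lipschitz_onI)
    fix s t assume "s \<in> {a..b}" "t \<in> {a..b}"
    then show "dist (u s) (u t) \<le> B * dist s t"
      using *[of s t] *[of t s] by (cases "s \<le> t") (auto simp: dist_real_def abs_minus_commute algebra_simps)
  next
    show "0 \<le> B" using B[of a] ab by auto
  qed
  moreover have "u' \<in> borel_measurable (lebesgue_on {a<..<b})"
    using continuous_imp_Lq_space[OF cu', of 1] by (simp add: Lq_space_def)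
  moreover have "AE t in lebesgue_on {a<..<b}.
     (\<lambda>n. (u (t + 1 / real (Suc n)) - u t) / (1 / real (Suc n))) \<longlonglongrightarrow> u' t"
  proof (rule AE_I2)
    fix t assume "t \<in> space (lebesgue_on {a<..<b})"
    then have "(u has_real_derivative u' t) (at t)" by (auto intro: d)
    moreover have "filterlim (\<lambda>n. 1 / real (Suc n)) (at 0) sequentially"
      unfolding filterlim_at using LIMSEQ_Suc[OF lim_1_over_n] by (auto intro!: always_eventually)
    ultimately show "(\<lambda>n. (u (t + 1 / real (Suc n)) - u t) / (1 / real (Suc n))) \<longlonglongrightarrow> u' t"
      unfolding DERIV_def by (rule filterlim_compose)
  qed
  ultimately show ?thesis by (intro weak_deriv_if_difference_quotients_converge ab)
qed

lemma C_norm_le: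
  assumes "S \<noteq> {}" "\<And>t. t \<in> S \<Longrightarrow> \<bar>u t\<bar> \<le> B"
  shows "C_norm S u \<le> B" "0 \<le> C_norm S u"
proof -
  show "C_norm S u \<le> B" unfolding C_norm_def using assms by (intro cSUP_least) auto
  obtain t where t: "t \<in> S" using assms by blast
  have "\<bar>u t\<bar> \<le> C_norm S u"
    unfolding C_norm_def using assms by (intro cSUP_upper t bdd_aboveI2[of _ _ B]) auto
  then show "0 \<le> C_norm S u" by simp
qed

lemma C_norm_tendsto_0:
  fixes d :: "real \<Rightarrow> real \<Rightarrow> real"
  assumes S: "S \<noteq> {}"
    and d: "\<And>e. 0 < e \<Longrightarrow> \<exists>\<epsilon>1>0. \<forall>\<epsilon>\<in>{0<..<\<epsilon>1}. \<forall>t\<in>S. \<bar>d \<epsilon> t\<bar> \<le> e"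
  shows "((\<lambda>\<epsilon>. C_norm S (d \<epsilon>)) \<longlongrightarrow> 0) (at_right 0)"
proof (rule tendstoI)
  fix e :: real assume "0 < e"
  then obtain \<epsilon>1 where e1: "0 < \<epsilon>1" "\<And>\<epsilon> t. \<epsilon> \<in> {0<..<\<epsilon>1} \<Longrightarrow> t \<in> S \<Longrightarrow> \<bar>d \<epsilon> t\<bar> \<le> e / 2"
    using d[of "e/2"] by auto
  have "dist (C_norm S (d \<epsilon>)) 0 < e" if "\<epsilon> \<in> {0<..<\<epsilon>1}" for \<epsilon>
    using C_norm_le[of S "d \<epsilon>" "e / 2"] S e1(2)[OF that] \<open>0 < e\<close> by (simp add: dist_real_def)
  then show "\<forall>\<^sub>F \<epsilon> in at_right 0. dist (C_norm S (d \<epsilon>)) 0 < e"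
    using e1(1) by (auto simp: eventually_at_right)
qed

lemma converges_Lq_dominated:
  fixes u :: "real \<Rightarrow> real \<Rightarrow> real"
  assumes q: "0 < q" and cw: "continuous_on {a..b} w" and cu: "\<And>\<epsilon>. 0 < \<epsilon> \<Longrightarrow> continuous_on {a..b} (u \<epsilon>)"
    and B: "\<And>\<epsilon> t. 0 < \<epsilon> \<Longrightarrow> t \<in> {a<..<b} \<Longrightarrow> \<bar>u \<epsilon> t - w t\<bar> \<le> B"
    and lim: "\<And>t. t \<in> {a<..<b} \<Longrightarrow> ((\<lambda>\<epsilon>. u \<epsilon> t) \<longlongrightarrow> w t) (at_right 0)"
  shows "converges_Lq q {a<..<b} u w"
  unfolding converges_Lq_def
proof (intro conjI allI impI)
  show "w \<in> Lq_space q {a<..<b}" by (rule continuous_imp_Lq_space[OF cw q])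
  show "u \<epsilon> \<in> Lq_space q {a<..<b}" if "0 < \<epsilon>" for \<epsilon> by (rule continuous_imp_Lq_space[OF cu[OF that] q])
  have d: "(\<lambda>t. \<bar>u \<epsilon> t - w t\<bar> powr q) \<in> borel_measurable (lebesgue_on {a<..<b})" if "0 < \<epsilon>" for \<epsilon>
    using continuous_imp_Lq_space[of a b "\<lambda>t. u \<epsilon> t - w t" q] q that
    by (auto simp: Lq_space_def intro!: continuous_intros cu cw borel_measurable_integrable)
  have "((\<lambda>\<epsilon>. integral\<^sup>L (lebesgue_on {a<..<b}) (\<lambda>t. \<bar>u \<epsilon> t - w t\<bar> powr q)) \<longlongrightarrow> 0) (at_right 0)"
    unfolding tendsto_at_iff_sequentially comp_def
  proof (intro allI impI)
    fix X :: "nat \<Rightarrow> real" assume X: "\<forall>i. X i \<in> {0<..} - {0}" "X \<longlonglongrightarrow> 0"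
    have "(\<lambda>n. integral\<^sup>L (lebesgue_on {a<..<b}) (\<lambda>t. \<bar>u (X n) t - w t\<bar> powr q))
        \<longlonglongrightarrow> integral\<^sup>L (lebesgue_on {a<..<b}) (\<lambda>t. 0)"
    proof (rule integral_dominated_convergence[where w = "\<lambda>_. B powr q"])
      show "(\<lambda>t. \<bar>u (X n) t - w t\<bar> powr q) \<in> borel_measurable (lebesgue_on {a<..<b})" for n
        using d[of "X n"] X by auto
      show "integrable (lebesgue_on {a<..<b}) (\<lambda>_. B powr q)"
        by (rule integrable_lebesgue_on_subset[OF continuous_imp_integrable_real[of a b]]) auto
      show "AE t in lebesgue_on {a<..<b}. norm (\<bar>u (X n) t - w t\<bar> powr q) \<le> B powr q" for n
        using B[of "X n"] X q by (intro AE_I2) (auto intro!: powr_mono2)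
      show "AE t in lebesgue_on {a<..<b}. (\<lambda>n. \<bar>u (X n) t - w t\<bar> powr q) \<longlonglongrightarrow> 0"
      proof (rule AE_I2)
        fix t assume "t \<in> space (lebesgue_on {a<..<b})"
        then have t: "t \<in> {a<..<b}" by simp
        have "(\<lambda>n. u (X n) t) \<longlonglongrightarrow> w t"
          using lim[OF t] X unfolding tendsto_at_iff_sequentially comp_def by blast
        then have "(\<lambda>n. \<bar>u (X n) t - w t\<bar>) \<longlonglongrightarrow> 0" by (simp add: LIM_zero tendsto_rabs_zero)
        then show "(\<lambda>n. \<bar>u (X n) t - w t\<bar> powr q) \<longlonglongrightarrow> 0"
          by (rule tendsto_zero_powrI[OF _ tendsto_const]) (use q in auto)
      qed
    qed simp
    then show "(\<lambda>n. integral\<^sup>L (lebesgue_on {a<..<b}) (\<lambda>t. \<bar>u (X n) t - w t\<bar> powr q)) \<longlonglongrightarrow> 0" by simp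
  qed
  then show "((\<lambda>\<epsilon>. Lq_norm q {a<..<b} (\<lambda>t. u \<epsilon> t - w t)) \<longlongrightarrow> 0) (at_right 0)"
    unfolding Lq_norm_def
    by (rule tendsto_zero_powrI[OF _ tendsto_const]) (use q in \<open>auto intro!: always_eventually\<close>)
qed

section \<open>Approximate solutions and their stability\<close>

text \<open>
  Monotonicity under a strict condition \<open>0 < \<gamma>\<close> survives uniform limits although the condition is not
  closed: on \<open>{r..t}\<close> with \<open>r > s\<close> the limit \<open>\<gamma>\<close> is bounded below, so the approximations satisfy the
  condition there eventually; then let \<open>r\<close> tend to \<open>s\<close>.
\<close>

lemma limit_nonincreasing:
  fixes x \<gamma> :: "real \<Rightarrow> real" and z \<gamma>n :: "nat \<Rightarrow> real \<Rightarrow> real"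
  assumes st: "s < t" and cx: "continuous_on {s..t} x" and c\<gamma>: "continuous_on {s..t} \<gamma>"
    and gap: "\<And>r. s < r \<Longrightarrow> r \<le> t \<Longrightarrow> 0 < \<gamma> r"
    and zx: "\<And>r. r \<in> {s..t} \<Longrightarrow> (\<lambda>n. z n r) \<longlonglongrightarrow> x r"
    and close: "\<And>n r. r \<in> {s..t} \<Longrightarrow> \<bar>\<gamma>n n r - \<gamma> r\<bar> \<le> e n" and e: "e \<longlonglongrightarrow> 0"
    and mon: "\<And>n r. s < r \<Longrightarrow> r < t \<Longrightarrow> (\<And>q. q \<in> {r<..t} \<Longrightarrow> 0 < \<gamma>n n q) \<Longrightarrow> z n t \<le> z n r"
  shows "x t \<le> x s"
proof -
  have le: "x t \<le> x r" if r: "s < r" "r < t" for r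
  proof -
    have "continuous_on {r..t} \<gamma>" by (rule continuous_on_subset[OF c\<gamma>]) (use r in auto)
    then obtain p where p: "p \<in> {r..t}" "\<And>q. q \<in> {r..t} \<Longrightarrow> \<gamma> p \<le> \<gamma> q"
      using continuous_attains_inf[of "{r..t}" \<gamma>] r by auto
    then have "0 < \<gamma> p" using gap[of p] r by auto
    from order_tendstoD(2)[OF e this] have "\<forall>\<^sub>F n in sequentially. z n t \<le> z n r"
    proof eventually_elim
      case (elim n)
      show ?case
      proof (rule mon[OF r])
        fix q assume "q \<in> {r<..t}"
        then show "0 < \<gamma>n n q" using close[of q n] p(2)[of q] elim r by auto
      qed
    qed
    then show ?thesis
      by (intro tendsto_le[OF _ zx zx]) (use r in auto)
  qed
  have "(x \<longlongrightarrow> x s) (at_right s)" using cx st by (rule continuous_on_Icc_at_rightD)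
  moreover have "\<forall>\<^sub>F r in at_right s. x t \<le> x r"
    using le st by (auto simp: eventually_at_right)
  ultimately show ?thesis by (intro tendsto_lowerbound) auto
qed

text \<open>
  All solutions that occur stay in the box \<open>\<bar>x\<bar> \<le> X\<close>, \<open>\<bar>y\<bar> \<le> R\<close>, on which \<open>g\<close> is bounded by \<open>C\<close> and Lipschitz
  with constant \<open>Lg\<close>. The radii come from the linear growth of \<open>g\<close> in \<open>y\<close>, and from the boundaries.
\<close>

locale play_ode =
  fixes T L X R C Lg A x0 y0 :: real and Fm Fp :: "real \<Rightarrow> real" and g :: "real \<times> real \<times> real \<Rightarrow> real"
  assumes T: "0 < T"
    and Fp: "L-lipschitz_on UNIV Fp" and Fm: "L-lipschitz_on UNIV Fm" and Fm_le_Fp: "Fm y \<le> Fp y"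
    and g_cont: "continuous_on UNIV g"
    and C: "0 \<le> C"
    and g_bound: "\<lbrakk>\<bar>x\<bar> \<le> X; \<bar>y\<bar> \<le> R; t \<in> {0..T}\<rbrakk> \<Longrightarrow> \<bar>g (x, y, t)\<bar> \<le> C"
    and Lg: "0 < Lg"
    and g_lip: "\<lbrakk>\<bar>x1\<bar> \<le> X; \<bar>y1\<bar> \<le> R; \<bar>x2\<bar> \<le> X; \<bar>y2\<bar> \<le> R; t \<in> {0..T}\<rbrakk> \<Longrightarrow>
        \<bar>g (x1, y1, t) - g (x2, y2, t)\<bar> \<le> Lg * (\<bar>x1 - x2\<bar> + \<bar>y1 - y2\<bar>)"
    and A: "0 \<le> A"
    and growth: "t \<in> {0..T} \<Longrightarrow> \<bar>g (x, y, t)\<bar> \<le> A * (1 + \<bar>y\<bar>)"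
    and R: "(1 + y0\<^sup>2) * exp (4 * A * T) \<le> R"
    and X: "\<bar>y\<bar> \<le> R \<Longrightarrow> \<bar>Fm y\<bar> \<le> X \<and> \<bar>Fp y\<bar> \<le> X"
begin

abbreviation xs :: real where "xs \<equiv> min (max (Fm y0) x0) (Fp y0)"

text \<open>
  An approximate solution may violate the constraint and the initial values by \<open>\<delta>\<close>, and need not solve
  the differential equation before time \<open>\<delta>\<close>; the Lipschitz bound controls \<open>y\<close> there. For \<open>\<delta> = 0\<close> this is
  the limit problem.
\<close>

definition approx_sol :: "real \<Rightarrow> (real \<Rightarrow> real) \<Rightarrow> (real \<Rightarrow> real) \<Rightarrow> bool" where
  "approx_sol \<delta> x y \<longleftrightarrow>
     play_within \<delta> 0 T Fm Fp x y \<and> C-lipschitz_on {0..T} y \<and>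
     (\<forall>t\<in>{0..T}. \<bar>x t\<bar> \<le> X \<and> \<bar>y t\<bar> \<le> R) \<and> \<bar>x 0 - xs\<bar> \<le> \<delta> \<and> \<bar>y 0 - y0\<bar> \<le> \<delta> \<and>
     (\<forall>t\<in>{\<delta><..<T}. (y has_real_derivative g (x t, y t, t)) (at t))"

lemma approx_sol_mono:
  assumes "approx_sol \<delta> x y" "\<delta> \<le> \<delta>'"
  shows "approx_sol \<delta>' x y"
  using assms unfolding approx_sol_def play_within_def by (auto; fastforce)

lemma L_nonneg: "0 \<le> L" using Fp by (rule lipschitz_on_nonneg)

lemma continuous_on_g_along:
  assumes "continuous_on S x" "continuous_on S y"
  shows "continuous_on S (\<lambda>t. g (x t, y t, t))"
  by (rule continuous_on_compose2[OF g_cont]) (auto intro!: continuous_intros assms)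

text \<open>
  The weight \<open>\<kappa>\<close> is twice the Lipschitz constant of the right-hand side \<open>g\<close> with the play inserted, so that
  the weighted supremum is reproduced with a factor 1/2 and can be absorbed.
\<close>

definition \<kappa> :: real where "\<kappa> = 2 * (L + 1) * Lg"
definition stab_y :: real where "stab_y = 2 + 2 * C + 2 * Lg * T"
definition stab :: real where "stab = 2 + (L + 1) * (2 * stab_y * exp (\<kappa> * T))"

lemma \<kappa>_pos: "0 < \<kappa>" using L_nonneg Lg by (simp add: \<kappa>_def)
lemma stab_y_nonneg: "0 \<le> stab_y" using C Lg T by (simp add: stab_y_def)
lemma stab_nonneg: "0 \<le> stab" using stab_y_nonneg L_nonneg by (simp add: stab_def)

text \<open>
  Let \<open>m\<close> be the maximum of \<open>exp (- \<kappa> t) \<bar>y1 t - y2 t\<bar>\<close>, attained at \<open>s\<close>. Up to time \<open>t\<close> the distance of the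
  \<open>y\<close>-components is at most \<open>m exp (\<kappa> t)\<close>, hence by \<open>play_compare\<close> that of the \<open>x\<close>-components is
  controlled by the same quantity, and integrating the difference of the two equations up to \<open>s\<close> gives
  \<open>m \<le> stab_y \<delta> + m / 2\<close>. A weighted supremum replaces Gronwall's lemma because the play makes the
  right-hand side depend on the whole past of \<open>y\<close>.
\<close>

lemma approx_sol_stable_y:
  assumes 1: "approx_sol \<delta> x1 y1" and 2: "approx_sol \<delta> x2 y2" and \<delta>: "0 \<le> \<delta>"
    and t: "t \<in> {0..T}"
  shows "\<bar>y1 t - y2 t\<bar> \<le> 2 * stab_y * exp (\<kappa> * T) * \<delta>"
proof -
  have C1: "C-lipschitz_on {0..T} y1" and C2: "C-lipschitz_on {0..T} y2"
    using 1 2 by (auto simp: approx_sol_def)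
  note cy = lipschitz_on_continuous_on[OF C1] lipschitz_on_continuous_on[OF C2]
  have p1: "play_within \<delta> 0 T Fm Fp x1 y1" and p2: "play_within \<delta> 0 T Fm Fp x2 y2"
    using 1 2 by (auto simp: approx_sol_def)
  have init: "\<bar>x1 0 - x2 0\<bar> \<le> 2 * \<delta>" "\<bar>y1 0 - y2 0\<bar> \<le> 2 * \<delta>"
    using 1 2 by (auto simp: approx_sol_def)
  define u where "u s = exp (- \<kappa> * s) * \<bar>y1 s - y2 s\<bar>" for s
  have cu: "continuous_on {0..T} u" unfolding u_def by (intro continuous_intros cy)
  obtain s where s: "s \<in> {0..T}" and max: "\<And>r. r \<in> {0..T} \<Longrightarrow> u r \<le> u s"
    using continuous_attains_sup[OF _ _ cu] T by auto
  define m where "m = u s"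
  have m0: "0 \<le> m" by (simp add: m_def u_def)
  have u_eq: "\<bar>y1 r - y2 r\<bar> = exp (\<kappa> * r) * u r" for r
    by (simp add: u_def mult.assoc[symmetric] exp_add[symmetric])
  have ybd: "\<bar>y1 r - y2 r\<bar> \<le> m * exp (\<kappa> * r)" if "r \<in> {0..T}" for r
    using max[OF that] by (simp add: u_eq m_def mult.commute)
  have xbd: "\<bar>x1 r - x2 r\<bar> \<le> 2 * \<delta> + L * (m * exp (\<kappa> * r))" if r: "r \<in> {0..T}" for r
  proof (rule play_compare[OF p1 p2 Fp Fm, of r "m * exp (\<kappa> * r)"])
    fix q assume q: "q \<in> {0..r}"
    have "\<bar>y1 q - y2 q\<bar> \<le> m * exp (\<kappa> * q)" using q r by (intro ybd) auto
    also have "\<dots> \<le> m * exp (\<kappa> * r)" using q m0 \<kappa>_pos by (intro mult_left_mono) auto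
    finally show "\<bar>y1 q - y2 q\<bar> \<le> m * exp (\<kappa> * r)" .
  next
    have "0 \<le> L * (m * exp (\<kappa> * r))" using L_nonneg m0 by simp
    then show "\<bar>x1 0 - x2 0\<bar> \<le> 2 * \<delta> + L * (m * exp (\<kappa> * r))" using init by linarith
  qed (use \<delta> r in auto)
  \<comment> \<open>Before \<open>\<sigma>\<close> only the Lipschitz bound is available, after \<open>\<sigma>\<close> the equation holds. The case
    \<open>\<sigma> = s\<close> occurs when the maximum is attained within the first \<open>\<delta>\<close> units of time.\<close>
  define \<sigma> where "\<sigma> = min \<delta> s"
  have \<sigma>: "0 \<le> \<sigma>" "\<sigma> \<le> \<delta>" "\<sigma> \<le> s" using \<delta> s by (auto simp: \<sigma>_def)
  have early: "\<bar>y1 \<sigma> - y2 \<sigma>\<bar> \<le> (2 + 2 * C) * \<delta>"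
  proof -
    have "\<bar>y1 \<sigma> - y1 0\<bar> \<le> C * \<sigma>" "\<bar>y2 \<sigma> - y2 0\<bar> \<le> C * \<sigma>"
      using lipschitz_onD[OF C1, of \<sigma> 0] lipschitz_onD[OF C2, of \<sigma> 0] \<sigma> s by (auto simp: dist_real_def)
    moreover have "C * \<sigma> \<le> C * \<delta>" using \<sigma> C by (intro mult_left_mono)
    ultimately show ?thesis using init by (simp add: algebra_simps)
  qed
  have "\<bar>(y1 s - y2 s) - (y1 \<sigma> - y2 \<sigma>)\<bar>
      \<le> (2 * Lg * \<delta> * s + m / 2 * exp (\<kappa> * s)) - (2 * Lg * \<delta> * \<sigma> + m / 2 * exp (\<kappa> * \<sigma>))"
  proof (cases "\<sigma> = s")
    case False
    then have \<sigma>\<delta>: "\<sigma> = \<delta>" by (auto simp: \<sigma>_def)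
    show ?thesis
    proof (rule deriv_abs_bound_diff[where u = "\<lambda>r. y1 r - y2 r" and
          p = "\<lambda>r. 2 * Lg * \<delta> * r + m / 2 * exp (\<kappa> * r)" and
          u' = "\<lambda>r. g (x1 r, y1 r, r) - g (x2 r, y2 r, r)" and
          p' = "\<lambda>r. 2 * Lg * \<delta> + m / 2 * (exp (\<kappa> * r) * \<kappa>)"])
      show "continuous_on {\<sigma>..s} (\<lambda>r. y1 r - y2 r)"
        using \<sigma> s by (intro continuous_intros continuous_on_subset[OF cy(1)] continuous_on_subset[OF cy(2)]) auto
      fix r assume r: "\<sigma> < r" "r < s"
      then have rT: "r \<in> {0..T}" "r \<in> {\<delta><..<T}" using \<sigma> s \<sigma>\<delta> by auto
      show "((\<lambda>r. y1 r - y2 r) has_real_derivative g (x1 r, y1 r, r) - g (x2 r, y2 r, r)) (at r)"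
        using 1 2 rT by (intro derivative_intros) (auto simp: approx_sol_def)
      show "((\<lambda>r. 2 * Lg * \<delta> * r + m / 2 * exp (\<kappa> * r)) has_real_derivative
          2 * Lg * \<delta> + m / 2 * (exp (\<kappa> * r) * \<kappa>)) (at r)"
        by (auto intro!: derivative_eq_intros)
      have "\<bar>g (x1 r, y1 r, r) - g (x2 r, y2 r, r)\<bar> \<le> Lg * (\<bar>x1 r - x2 r\<bar> + \<bar>y1 r - y2 r\<bar>)"
        using 1 2 rT by (intro g_lip) (auto simp: approx_sol_def)
      also have "\<dots> \<le> Lg * ((2 * \<delta> + L * (m * exp (\<kappa> * r))) + m * exp (\<kappa> * r))"
        using Lg by (intro mult_left_mono add_mono xbd ybd rT) auto
      also have "\<dots> = 2 * Lg * \<delta> + m / 2 * (exp (\<kappa> * r) * \<kappa>)"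
        by (simp add: \<kappa>_def algebra_simps)
      finally show "\<bar>g (x1 r, y1 r, r) - g (x2 r, y2 r, r)\<bar> \<le> 2 * Lg * \<delta> + m / 2 * (exp (\<kappa> * r) * \<kappa>)" .
    qed (use \<sigma> in \<open>auto intro!: continuous_intros\<close>)
  qed simp
  moreover have "0 \<le> 2 * Lg * \<delta> * \<sigma>" "0 \<le> m / 2 * exp (\<kappa> * \<sigma>)" using Lg \<delta> \<sigma> m0 by auto
  moreover have "2 * Lg * \<delta> * s \<le> 2 * Lg * \<delta> * T" using Lg \<delta> s by (intro mult_left_mono) auto
  ultimately have "\<bar>y1 s - y2 s\<bar> \<le> (2 + 2 * C) * \<delta> + 2 * Lg * \<delta> * T + m / 2 * exp (\<kappa> * s)"
    using early by linarith
  also have "\<dots> = stab_y * \<delta> + m / 2 * exp (\<kappa> * s)" by (simp add: stab_y_def algebra_simps)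
  finally have "m * exp (\<kappa> * s) \<le> stab_y * \<delta> + m / 2 * exp (\<kappa> * s)"
    by (simp add: u_eq m_def mult.commute)
  then have "m * exp (\<kappa> * s) \<le> 2 * stab_y * \<delta>" by simp
  moreover have "m * 1 \<le> m * exp (\<kappa> * s)" using m0 \<kappa>_pos s by (intro mult_left_mono) auto
  ultimately have mK: "m \<le> 2 * stab_y * \<delta>" by simp
  have "\<bar>y1 t - y2 t\<bar> \<le> m * exp (\<kappa> * t)" by (rule ybd[OF t])
  also have "\<dots> \<le> (2 * stab_y * \<delta>) * exp (\<kappa> * T)"
    using mK m0 t \<kappa>_pos stab_y_nonneg \<delta> by (intro mult_mono) auto
  finally show ?thesis by (simp add: algebra_simps)
qed

lemma approx_sol_stable:
  assumes 1: "approx_sol \<delta> x1 y1" and 2: "approx_sol \<delta> x2 y2" and \<delta>: "0 \<le> \<delta>"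
    and t: "t \<in> {0..T}"
  shows "\<bar>x1 t - x2 t\<bar> \<le> stab * \<delta>" "\<bar>y1 t - y2 t\<bar> \<le> stab * \<delta>"
proof -
  define D where "D = 2 * stab_y * exp (\<kappa> * T) * \<delta>"
  have D0: "0 \<le> D" using stab_y_nonneg \<delta> by (simp add: D_def)
  have stab: "stab * \<delta> = 2 * \<delta> + L * D + D" by (simp add: stab_def D_def algebra_simps)
  have LD: "0 \<le> L * D" using L_nonneg D0 by simp
  have "\<bar>y1 t - y2 t\<bar> \<le> D" using approx_sol_stable_y[OF 1 2 \<delta> t] by (simp add: D_def)
  then show "\<bar>y1 t - y2 t\<bar> \<le> stab * \<delta>" using stab LD \<delta> by linarith
  have "\<bar>x1 t - x2 t\<bar> \<le> 2 * \<delta> + L * D"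
  proof (rule play_compare[of \<delta> 0 T Fm Fp x1 y1 x2 y2 L t D])
    show "\<bar>y1 s - y2 s\<bar> \<le> D" if "s \<in> {0..t}" for s
      using approx_sol_stable_y[OF 1 2 \<delta>, of s] that t by (auto simp: D_def)
  qed (use 1 2 Fp Fm \<delta> LD t in \<open>auto simp: approx_sol_def\<close>)
  then show "\<bar>x1 t - x2 t\<bar> \<le> stab * \<delta>" using stab D0 by linarith
qed

text \<open>
  By stability, approximate solutions with tolerances tending to zero form a uniform Cauchy sequence. The
  constraint and the monotonicity rules pass to the limit, and so does the integral form of the
  differential equation on every interval away from 0.
\<close>

lemma exact_sol_exists_if_approx:
  assumes ex: "\<And>\<delta>. 0 < \<delta> \<Longrightarrow> \<exists>x y. approx_sol \<delta> x y"
  shows "\<exists>x y. approx_sol 0 x y"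
proof -
  define d where "d n = 1 / real (Suc n)" for n
  have d: "0 < d n" for n by (simp add: d_def)
  have dlim: "d \<longlonglongrightarrow> 0" unfolding d_def by (rule LIMSEQ_Suc[OF lim_1_over_n])
  have "\<forall>n. \<exists>z v. approx_sol (d n) z v" using ex d by blast
  then obtain z v where zv: "\<And>n. approx_sol (d n) (z n) (v n)" by metis
  have dmono: "d n \<le> d N" if "N \<le> n" for N n using that by (simp add: d_def frac_le)
  have close: "\<bar>z m t - z n t\<bar> \<le> stab * d N" "\<bar>v m t - v n t\<bar> \<le> stab * d N"
    if "N \<le> m" "N \<le> n" "t \<in> {0..T}" for m n N t
    using approx_sol_stable[OF approx_sol_mono[OF zv[of m] dmono] approx_sol_mono[OF zv[of n] dmono], of N t]
      d[of N] that by auto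
  have Kd: "(\<lambda>n. c * d n) \<longlonglongrightarrow> 0" for c :: real using tendsto_mult_right_zero[OF dlim] .
  have conv: "\<exists>l. (\<lambda>n. w n t) \<longlonglongrightarrow> l"
    if w: "\<And>N m n. N \<le> m \<Longrightarrow> N \<le> n \<Longrightarrow> \<bar>w m t - w n t\<bar> \<le> stab * d N" for w :: "nat \<Rightarrow> real \<Rightarrow> real" and t
  proof -
    have "Cauchy (\<lambda>n. w n t)"
    proof (rule CauchyI)
      fix e :: real assume "0 < e"
      from order_tendstoD(2)[OF Kd[of stab] this] obtain N where "stab * d N < e"
        by (auto simp: eventually_sequentially)
      then show "\<exists>M. \<forall>m\<ge>M. \<forall>n\<ge>M. norm (w m t - w n t) < e"
        using w[of N] by (intro exI[of _ N]) (auto intro: le_less_trans)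
    qed
    then show ?thesis by (simp add: Cauchy_convergent_iff convergent_def)
  qed
  define x where "x t = lim (\<lambda>n. z n t)" for t
  define y where "y t = lim (\<lambda>n. v n t)" for t
  have zx: "(\<lambda>n. z n t) \<longlonglongrightarrow> x t" and vy: "(\<lambda>n. v n t) \<longlonglongrightarrow> y t" if "t \<in> {0..T}" for t
    using conv[of z t] conv[of v t] close that unfolding x_def y_def
    by (metis convergentI convergent_LIMSEQ_iff)+
  have zx': "\<bar>z n t - x t\<bar> \<le> stab * d n" and vy': "\<bar>v n t - y t\<bar> \<le> stab * d n" if t: "t \<in> {0..T}" for n t
  proof -
    show "\<bar>z n t - x t\<bar> \<le> stab * d n"
      by (rule LIMSEQ_le_const2[OF tendsto_rabs[OF tendsto_diff[OF tendsto_const zx[OF t]]]])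
        (use close(1)[of n n _ t] t in auto)
    show "\<bar>v n t - y t\<bar> \<le> stab * d n"
      by (rule LIMSEQ_le_const2[OF tendsto_rabs[OF tendsto_diff[OF tendsto_const vy[OF t]]]])
        (use close(2)[of n n _ t] t in auto)
  qed
  have unif: "uniform_limit {0..T} z x sequentially"
  proof (rule uniform_limitI)
    fix e :: real assume "0 < e"
    from order_tendstoD(2)[OF Kd[of stab] this]
    show "\<forall>\<^sub>F n in sequentially. \<forall>t\<in>{0..T}. dist (z n t) (x t) < e"
      by eventually_elim (simp add: dist_real_def, meson zx' atLeastAtMost_iff le_less_trans)
  qed
  have cz: "continuous_on {0..T} (z n)" for n
    using zv[of n] by (auto simp: approx_sol_def play_within_def)
  have cx: "continuous_on {0..T} x"
    by (rule uniform_limit_theorem[OF always_eventually unif]) (use cz in auto)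
  have ylip: "C-lipschitz_on {0..T} y"
  proof (rule lipschitz_onI[OF _ C])
    fix s t assume st: "s \<in> {0..T}" "t \<in> {0..T}"
    have "\<bar>v n s - v n t\<bar> \<le> C * dist s t" for n
      using zv[of n] lipschitz_onD[of C "{0..T}" "v n" s t] st by (auto simp: approx_sol_def dist_real_def)
    then show "dist (y s) (y t) \<le> C * dist s t"
      unfolding dist_real_def[of "y s"]
      by (intro LIMSEQ_le_const2[OF tendsto_rabs[OF tendsto_diff[OF vy[OF st(1)] vy[OF st(2)]]]]) auto
  qed
  note cy = lipschitz_on_continuous_on[OF ylip]
  have cF: "isCont Fp r" "isCont Fm r" for r
    using lipschitz_on_continuous_on[OF Fp] lipschitz_on_continuous_on[OF Fm]
    by (auto simp: continuous_on_eq_continuous_at)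
  have bnd: "\<bar>x t\<bar> \<le> X" "\<bar>y t\<bar> \<le> R" if t: "t \<in> {0..T}" for t
    using LIMSEQ_le_const2[OF tendsto_rabs[OF zx[OF t]], of X] LIMSEQ_le_const2[OF tendsto_rabs[OF vy[OF t]], of R]
      zv t by (auto simp: approx_sol_def)
  have band: "Fm (y t) \<le> x t" "x t \<le> Fp (y t)" if t: "t \<in> {0..T}" for t
  proof -
    have b: "Fm (v n t) - d n \<le> z n t" "z n t \<le> Fp (v n t) + d n" for n
      using zv[of n] t by (auto simp: approx_sol_def play_within_def)
    have "(\<lambda>n. Fm (v n t) - d n) \<longlonglongrightarrow> Fm (y t) - 0" "(\<lambda>n. Fp (v n t) + d n) \<longlonglongrightarrow> Fp (y t) + 0"
      by (intro tendsto_intros isCont_tendsto_compose[OF cF(1)] isCont_tendsto_compose[OF cF(2)] vy[OF t] dlim)+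
    then show "Fm (y t) \<le> x t" "x t \<le> Fp (y t)"
      using LIMSEQ_le[OF _ zx[OF t]] LIMSEQ_le[OF zx[OF t]] b by fastforce+
  qed
  have F_close: "\<bar>F (v n r) - F (y r)\<bar> \<le> L * (stab * d n)" if "L-lipschitz_on UNIV F" "r \<in> {0..T}" for F n r
  proof -
    have "\<bar>F (v n r) - F (y r)\<bar> \<le> L * \<bar>v n r - y r\<bar>"
      using lipschitz_onD[OF that(1), of "v n r" "y r"] by (simp add: dist_real_def)
    also have "\<dots> \<le> L * (stab * d n)" by (intro mult_left_mono vy' that L_nonneg)
    finally show ?thesis .
  qed
  have elim: "(\<lambda>n. (1 + L) * (stab * d n)) \<longlonglongrightarrow> 0" using tendsto_mult_right_zero[OF Kd] .
  have cFy: "continuous_on {0..T} (\<lambda>t. F (y t))" if "L-lipschitz_on UNIV F" for F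
    by (rule continuous_on_compose2[OF lipschitz_on_continuous_on[OF that] cy]) auto
  have dec: "x t \<le> x s" if st: "0 \<le> s" "s < t" "t \<le> T" and gap: "\<forall>r\<in>{s<..t}. Fm (y r) < x r" for s t
  proof (rule limit_nonincreasing[of s t x "\<lambda>r. x r - Fm (y r)" z "\<lambda>n r. z n r - Fm (v n r)", OF st(2) _ _ _ _ _ elim])
    show "continuous_on {s..t} x" "continuous_on {s..t} (\<lambda>r. x r - Fm (y r))"
      by (rule continuous_on_subset[of "{0..T}"], use st in \<open>auto intro!: continuous_intros cx cFy Fm\<close>)+
    show "\<bar>z n r - Fm (v n r) - (x r - Fm (y r))\<bar> \<le> (1 + L) * (stab * d n)" if "r \<in> {s..t}" for n r
      using F_close[OF Fm, of r n] zx'[of r n] that st by (auto simp: abs_le_iff algebra_simps)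
    show "z n t \<le> z n r" if "s < r" "r < t" "\<And>q. q \<in> {r<..t} \<Longrightarrow> 0 < z n q - Fm (v n q)" for n r
      using zv[of n] that st by (auto simp: approx_sol_def play_within_def)
  qed (use gap zx st in auto)
  have inc: "- x t \<le> - x s" if st: "0 \<le> s" "s < t" "t \<le> T" and gap: "\<forall>r\<in>{s<..t}. x r < Fp (y r)" for s t
  proof (rule limit_nonincreasing[of s t "\<lambda>r. - x r" "\<lambda>r. Fp (y r) - x r" "\<lambda>n r. - z n r" "\<lambda>n r. Fp (v n r) - z n r",
        OF st(2) _ _ _ _ _ elim])
    show "continuous_on {s..t} (\<lambda>r. - x r)" "continuous_on {s..t} (\<lambda>r. Fp (y r) - x r)"
      by (rule continuous_on_subset[of "{0..T}"], use st in \<open>auto intro!: continuous_intros cx cFy Fp\<close>)+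
    show "\<bar>Fp (v n r) - z n r - (Fp (y r) - x r)\<bar> \<le> (1 + L) * (stab * d n)" if "r \<in> {s..t}" for n r
      using F_close[OF Fp, of r n] zx'[of r n] that st by (auto simp: abs_le_iff algebra_simps)
    show "- z n t \<le> - z n r" if "s < r" "r < t" "\<And>q. q \<in> {r<..t} \<Longrightarrow> 0 < Fp (v n q) - z n q" for n r
      using zv[of n] that st by (auto simp: approx_sol_def play_within_def)
  qed (use gap zx st in \<open>auto intro: tendsto_minus\<close>)
  have "play_within 0 0 T Fm Fp x y"
    unfolding play_within_def using cx band dec inc by auto
  moreover have "x 0 = xs" "y 0 = y0"
  proof -
    have 0: "0 \<in> {0..T}" using T by simp
    have b: "\<bar>z n 0 - xs\<bar> \<le> d n" "\<bar>v n 0 - y0\<bar> \<le> d n" for n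
      using zv[of n] by (auto simp: approx_sol_def)
    have "(\<lambda>n. z n 0 - xs) \<longlonglongrightarrow> 0" "(\<lambda>n. v n 0 - y0) \<longlonglongrightarrow> 0"
      by (rule Lim_null_comparison[OF always_eventually dlim], use b in auto)+
    then show "x 0 = xs" "y 0 = y0"
      using LIMSEQ_unique[OF zx[OF 0]] LIMSEQ_unique[OF vy[OF 0]] by (auto simp: LIM_zero_iff)
  qed
  moreover have "(y has_real_derivative g (x t, y t, t)) (at t)" if t: "t \<in> {0<..<T}" for t
  proof -
    define a where "a = t / 2"
    have a: "0 < a" "a < t" using t by (auto simp: a_def)
    define I where "I r = integral {a..r} (\<lambda>q. g (x q, y q, q))" for r
    have cg: "continuous_on {a..T} (\<lambda>q. g (x q, y q, q))"
      by (rule continuous_on_subset[OF continuous_on_g_along[OF cx cy]]) (use a in auto)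
    have dI: "(I has_real_derivative g (x r, y r, r)) (at r within {a..T})" if "r \<in> {a..T}" for r
      unfolding I_def using integral_has_real_derivative[OF cg that] .
    have cI: "continuous_on {a..T} I" using dI by (rule DERIV_continuous_on)
    have y_eq: "y r - y a = I r" if r: "r \<in> {a..<T}" for r
    proof -
      have "\<forall>\<^sub>F n in sequentially. \<bar>v n r - v n a - I r\<bar> \<le> 2 * Lg * (stab * d n) * T"
        using order_tendstoD(2)[OF dlim a(1)]
      proof eventually_elim
        case (elim n)
        have "\<bar>(v n r - I r) - (v n a - I a)\<bar> \<le> 2 * Lg * (stab * d n) * r - 2 * Lg * (stab * d n) * a"
        proof (rule deriv_abs_bound_diff[where u = "\<lambda>r. v n r - I r" and p = "\<lambda>r. 2 * Lg * (stab * d n) * r"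
              and u' = "\<lambda>r. g (z n r, v n r, r) - g (x r, y r, r)" and p' = "\<lambda>_. 2 * Lg * (stab * d n)"])
          have "continuous_on {0..T} (v n)"
            using zv[of n] by (auto simp: approx_sol_def intro: lipschitz_on_continuous_on)
          then show "continuous_on {a..r} (\<lambda>r. v n r - I r)"
            using r a by (intro continuous_intros) (auto elim!: continuous_on_subset intro: continuous_on_subset[OF cI])
          fix q assume q: "a < q" "q < r"
          then have qT: "q \<in> {0..T}" "q \<in> {d n<..<T}" "q \<in> {a..T}" using r a elim by auto
          have "(I has_real_derivative g (x q, y q, q)) (at q)"
            using dI[OF qT(3)] at_within_Icc_at[of a q T] q r by simp
          then show "((\<lambda>r. v n r - I r) has_real_derivative g (z n q, v n q, q) - g (x q, y q, q)) (at q)"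
            using zv[of n] qT by (intro derivative_intros) (auto simp: approx_sol_def)
          show "((\<lambda>r. 2 * Lg * (stab * d n) * r) has_real_derivative 2 * Lg * (stab * d n)) (at q)"
            by (auto intro!: derivative_eq_intros)
          have "\<bar>g (z n q, v n q, q) - g (x q, y q, q)\<bar> \<le> Lg * (\<bar>z n q - x q\<bar> + \<bar>v n q - y q\<bar>)"
            using zv[of n] bnd[OF qT(1)] qT by (intro g_lip) (auto simp: approx_sol_def)
          also have "\<dots> \<le> Lg * (stab * d n + stab * d n)"
            using Lg by (intro mult_left_mono add_mono zx' vy' qT) auto
          finally show "\<bar>g (z n q, v n q, q) - g (x q, y q, q)\<bar> \<le> 2 * Lg * (stab * d n)"
            by (simp add: algebra_simps)
        qed (use r in \<open>auto intro!: continuous_intros\<close>)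
        also have "\<dots> = 2 * Lg * (stab * d n) * (r - a)" by (simp add: algebra_simps)
        also have "\<dots> \<le> 2 * Lg * (stab * d n) * T"
          using r a Lg stab_nonneg d[of n] by (intro mult_left_mono) auto
        finally show ?case by (simp add: I_def algebra_simps)
      qed
      moreover have "(\<lambda>n. 2 * Lg * (stab * d n) * T) \<longlonglongrightarrow> 0"
        using Kd[of "2 * Lg * stab * T"] by (simp add: algebra_simps)
      moreover have "(\<lambda>n. \<bar>v n r - v n a - I r\<bar>) \<longlonglongrightarrow> \<bar>y r - y a - I r\<bar>"
        by (intro tendsto_intros vy) (use r a in auto)
      ultimately have "\<bar>y r - y a - I r\<bar> \<le> 0" by (intro tendsto_le[OF _ _ _ \<open>\<forall>\<^sub>F n in _. _\<close>]) auto
      then show ?thesis by simp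
    qed
    have "(I has_real_derivative g (x t, y t, t)) (at t)"
      using dI[of t] at_within_Icc_at[of a t T] a t by simp
    then have dIy: "((\<lambda>r. I r + y a) has_real_derivative g (x t, y t, t)) (at t)"
      by (auto intro!: derivative_eq_intros)
    have "I r + y a = y r" if "r \<in> {a<..<T}" for r using y_eq[of r] that by simp
    then show ?thesis
      by (intro has_field_derivative_transform_within_open[OF dIy, of "{a<..<T}"]) (use a t in auto)
  qed
  ultimately have "approx_sol 0 x y"
    unfolding approx_sol_def using ylip bnd by auto
  then show ?thesis by blast
qed

end

section \<open>Equivalence with the limit problem\<close>

context play_ode
begin

text \<open>
  At almost every time the derivative of \<open>x\<close> is the limit of right difference quotients. If \<open>x\<close> is above
  the lower boundary at such a time, it remains so for a while by continuity, hence the quotients are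
  eventually nonpositive; likewise at the upper boundary. This yields the variational inequality for
  every admissible \<open>\<xi>\<close>.
\<close>

lemma limit_solution_if_exact:
  assumes ap: "approx_sol 0 x y"
  shows "limit_solution T Fm Fp g x0 y0 x y"
proof -
  have play: "play_within 0 0 T Fm Fp x y" and ylip: "C-lipschitz_on {0..T} y"
    and init: "x 0 = xs" "y 0 = y0"
    and dy: "\<And>t. t \<in> {0<..<T} \<Longrightarrow> (y has_real_derivative g (x t, y t, t)) (at t)"
    using ap by (auto simp: approx_sol_def)
  have cx: "continuous_on {0..T} x" and band: "\<And>t. t \<in> {0..T} \<Longrightarrow> x t \<in> {Fm (y t)..Fp (y t)}"
    and dec: "\<And>s t. \<lbrakk>0 \<le> s; s < t; t \<le> T; \<And>r. r \<in> {s<..t} \<Longrightarrow> Fm (y r) < x r\<rbrakk> \<Longrightarrow> x t \<le> x s"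
    and inc: "\<And>s t. \<lbrakk>0 \<le> s; s < t; t \<le> T; \<And>r. r \<in> {s<..t} \<Longrightarrow> x r < Fp (y r)\<rbrakk> \<Longrightarrow> x s \<le> x t"
    using play by (auto simp: play_within_def)
  note cy = lipschitz_on_continuous_on[OF ylip]
  have cg: "continuous_on {0..T} (\<lambda>t. g (x t, y t, t))" by (rule continuous_on_g_along[OF cx cy])
  have cFy: "continuous_on {0..T} (\<lambda>t. F (y t))" if "L-lipschitz_on UNIV F" for F
    by (rule continuous_on_compose2[OF lipschitz_on_continuous_on[OF that] cy]) auto
  obtain w where w: "w \<in> Lq_space 1 {0<..<T}" "weak_deriv 0 T x w"
    "AE t in lebesgue_on {0<..<T}. (\<lambda>n. (x (t + 1 / real (Suc n)) - x t) / (1 / real (Suc n))) \<longlonglongrightarrow> w t"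
    using lipschitz_weak_derivative[OF T play_lipschitz[OF play ylip Fp Fm]] by blast
  have pos_near: "\<forall>\<^sub>F n in sequentially. 1 / real (Suc n) < T - t \<and> (\<forall>r\<in>{t<..t + 1 / real (Suc n)}. 0 < \<gamma> r)"
    if t: "t \<in> {0<..<T}" and c: "continuous_on {0..T} \<gamma>" and p: "0 < \<gamma> t" for t and \<gamma> :: "real \<Rightarrow> real"
  proof -
    have "isCont \<gamma> t" by (rule continuous_on_interior[OF c]) (use t in auto)
    then have "\<forall>\<^sub>F r in at t. 0 < \<gamma> r" 
      using p order_tendstoD(1)[of \<gamma> "\<gamma> t" "at t" 0] by (simp add: isCont_def)
    then obtain d where d: "0 < d" "\<And>r. r \<noteq> t \<Longrightarrow> \<bar>r - t\<bar> < d \<Longrightarrow> 0 < \<gamma> r"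
      by (auto simp: eventually_at dist_real_def)
    have "0 < min d (T - t)" using d t by auto
    from order_tendstoD(2)[OF LIMSEQ_Suc[OF lim_1_over_n] this]
    show ?thesis
    proof eventually_elim
      case (elim n)
      moreover have "\<eta> < T - t \<and> (\<forall>r\<in>{t<..t + \<eta>}. 0 < \<gamma> r)" if "\<eta> < min d (T - t)" for \<eta>
        using that d(2) by auto
      ultimately show ?case by blast
    qed
  qed
  have "AE t in lebesgue_on {0<..<T}. \<forall>\<xi>\<in>{Fm (y t)..Fp (y t)}. w t * (x t - \<xi>) \<le> 0"
    using w(3) AE_space
  proof eventually_elim
    case (elim t)
    then have t: "t \<in> {0<..<T}" by simp
    have neg: "w t \<le> 0" if "Fm (y t) < x t"
    proof -
      have "0 < x t - Fm (y t)" using that by simp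
      from pos_near[OF t continuous_on_diff[OF cx cFy[OF Fm]] this]
      have "\<forall>\<^sub>F n in sequentially. (x (t + 1 / real (Suc n)) - x t) / (1 / real (Suc n)) \<le> 0"
      proof eventually_elim
        case (elim n)
        have "x (t + \<eta>) \<le> x t" if "0 < \<eta>" "\<eta> < T - t \<and> (\<forall>r\<in>{t<..t + \<eta>}. 0 < x r - Fm (y r))" for \<eta>
          using dec[of t "t + \<eta>"] t that by auto
        then show ?case using elim by (intro divide_nonpos_pos) (auto simp del: of_nat_Suc)
      qed
      then show ?thesis by (intro tendsto_upperbound[OF elim(1)]) auto
    qed
    have pos: "0 \<le> w t" if "x t < Fp (y t)"
    proof -
      have "0 < Fp (y t) - x t" using that by simp
      from pos_near[OF t continuous_on_diff[OF cFy[OF Fp] cx] this]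
      have "\<forall>\<^sub>F n in sequentially. 0 \<le> (x (t + 1 / real (Suc n)) - x t) / (1 / real (Suc n))"
      proof eventually_elim
        case (elim n)
        have "x t \<le> x (t + \<eta>)" if "0 < \<eta>" "\<eta> < T - t \<and> (\<forall>r\<in>{t<..t + \<eta>}. 0 < Fp (y r) - x r)" for \<eta>
          using inc[of t "t + \<eta>"] t that by auto
        then show ?case using elim by (intro divide_nonneg_pos) (auto simp del: of_nat_Suc)
      qed
      then show ?thesis by (intro tendsto_lowerbound[OF elim(1)]) auto
    qed
    show ?case
    proof
      fix \<xi> assume \<xi>: "\<xi> \<in> {Fm (y t)..Fp (y t)}"
      show "w t * (x t - \<xi>) \<le> 0"
      proof (cases "x t" \<xi> rule: linorder_cases)
        case less
        then show ?thesis using pos \<xi> by (auto intro: mult_nonneg_nonpos)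
      next
        case greater
        then show ?thesis using neg \<xi> by (auto intro: mult_nonpos_nonneg)
      qed simp
    qed
  qed
  moreover have "weak_deriv 0 T y (\<lambda>t. g (x t, y t, t))"
    by (rule C1_weak_deriv[OF T cy cg]) (use dy in auto)
  moreover have "(\<lambda>t. g (x t, y t, t)) \<in> Lq_space 1 {0<..<T}"
    by (rule continuous_imp_Lq_space[OF cg]) simp
  ultimately show ?thesis
    unfolding limit_solution_def using cx cy w(1,2) band init by auto
qed

text \<open>
  Choosing \<open>\<xi>\<close> as the lower boundary value shows that the weak derivative of \<open>x\<close> is nonpositive almost
  everywhere on intervals where \<open>x\<close> is strictly above it, so \<open>x\<close>, being the integral of this derivative,
  is nonincreasing there. The a priori bounds follow from the growth of \<open>g\<close>.
\<close>

lemma exact_if_limit_solution: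
  assumes "limit_solution T Fm Fp g x0 y0 x y"
  shows "approx_sol 0 x y"
proof -
  obtain x' y' where cx: "continuous_on {0..T} x" and cy: "continuous_on {0..T} y"
    and x': "x' \<in> Lq_space 1 {0<..<T}" "weak_deriv 0 T x x'"
    and y': "y' \<in> Lq_space 1 {0<..<T}" "weak_deriv 0 T y y'"
    and ode: "AE t in lebesgue_on {0<..<T}. y' t = g (x t, y t, t)"
    and vi: "AE t in lebesgue_on {0<..<T}. \<forall>\<xi>\<in>{Fm (y t)..Fp (y t)}. x' t * (x t - \<xi>) \<le> 0"
    and init: "y 0 = y0" "x 0 = xs"
    and band: "\<And>t. t \<in> {0..T} \<Longrightarrow> x t \<in> {Fm (y t)..Fp (y t)}"
    using assms unfolding limit_solution_def by blast
  have null: "\<exists>N. negligible N \<and> (\<forall>t. t \<in> {0<..<T} - N \<longrightarrow> P t)" if "AE t in lebesgue_on {0<..<T}. P t" for P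
  proof -
    have "AE t in lebesgue. t \<in> {0<..<T} \<longrightarrow> P t"
      using that by (subst (asm) AE_restrict_space_iff) auto
    then obtain N where "N \<in> null_sets lebesgue" "{t \<in> space lebesgue. \<not> (t \<in> {0<..<T} \<longrightarrow> P t)} \<subseteq> N"
      unfolding eventually_ae_filter by blast
    then show ?thesis by (intro exI[of _ N]) (auto simp: negligible_iff_null_sets)
  qed
  from null[OF ode] obtain N1 where N1: "negligible N1" "\<And>t. t \<in> {0<..<T} - N1 \<Longrightarrow> y' t = g (x t, y t, t)"
    by blast
  from null[OF vi] obtain N2 where N2: "negligible N2"
    "\<And>t \<xi>. t \<in> {0<..<T} - N2 \<Longrightarrow> \<xi> \<in> {Fm (y t)..Fp (y t)} \<Longrightarrow> x' t * (x t - \<xi>) \<le> 0" by blast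
  have cg: "continuous_on {0..T} (\<lambda>t. g (x t, y t, t))" by (rule continuous_on_g_along[OF cx cy])

  have int_g: "((\<lambda>t. g (x t, y t, t)) has_integral y t - y 0) {0..t}" if t: "t \<in> {0..T}" for t
  proof (rule has_integral_spike[of "N1 \<union> {0, T}"])
    show "(y' has_integral y t - y 0) {0..t}"
      by (rule weak_deriv_has_integral[OF T cy y']) (use t in auto)
    show "g (x r, y r, r) = y' r" if "r \<in> {0..t} - (N1 \<union> {0, T})" for r
      using N1(2)[of r] that t by auto
  qed (use N1 in auto)
  have y_int: "y t = y 0 + integral {0..t} (\<lambda>t. g (x t, y t, t))" if "t \<in> {0..T}" for t
    using integral_unique[OF int_g[OF that]] by simp
  have dy: "(y has_real_derivative g (x t, y t, t)) (at t)" if t: "0 < t" "t < T" for t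
  proof -
    have "((\<lambda>t. integral {0..t} (\<lambda>t. g (x t, y t, t))) has_real_derivative g (x t, y t, t)) (at t within {0..T})"
      using t by (intro integral_has_real_derivative[OF cg]) auto
    then have "((\<lambda>t. integral {0..t} (\<lambda>t. g (x t, y t, t))) has_real_derivative g (x t, y t, t)) (at t)"
      using at_within_Icc_at[of 0 t T] t by simp
    from DERIV_add[OF DERIV_const this, of "y 0"]
    have dI: "((\<lambda>t. y 0 + integral {0..t} (\<lambda>t. g (x t, y t, t))) has_real_derivative g (x t, y t, t)) (at t)"
      by (simp only: add_0_left)
    show ?thesis
      by (rule has_field_derivative_transform_within_open[OF dI, of "{0<..<T}"])
        (use t in \<open>auto simp only: greaterThanLessThan_iff open_greaterThanLessThan intro!: y_int[symmetric]\<close>, auto)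
  qed
  have yR: "\<bar>y t\<bar> \<le> R" if t: "t \<in> {0..T}" for t
  proof -
    have "\<bar>y t\<bar> \<le> (1 + (y 0)\<^sup>2) * exp (4 * A * T)"
      by (rule linear_growth_bound[OF cy A dy growth t]) auto
    then show ?thesis using R init by simp
  qed
  have xX: "\<bar>x t\<bar> \<le> X" if t: "t \<in> {0..T}" for t
    using X[OF yR[OF t]] band[OF t] by auto
  have ylip: "C-lipschitz_on {0..T} y"
  proof (rule lipschitz_onI[OF _ C])
    have *: "\<bar>y t - y s\<bar> \<le> C * t - C * s" if "0 \<le> s" "s \<le> t" "t \<le> T" for s t
      by (rule deriv_abs_bound_diff[where u' = "\<lambda>t. g (x t, y t, t)" and p' = "\<lambda>_. C"])
        (use that dy xX yR in \<open>auto intro!: continuous_on_subset[OF cy] continuous_intros derivative_eq_intros g_bound\<close>)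
    fix s t assume "s \<in> {0..T}" "t \<in> {0..T}"
    then show "dist (y s) (y t) \<le> C * dist s t"
      using *[of s t] *[of t s] by (cases "s \<le> t") (auto simp: dist_real_def abs_minus_commute algebra_simps)
  qed
  have int_x: "(x' has_integral x t - x s) {s..t}" if "0 \<le> s" "s \<le> t" "t \<le> T" for s t
    by (rule weak_deriv_has_integral[OF T cx x' that])
  have dec: "x t \<le> x s" if st: "0 \<le> s" "s < t" "t \<le> T" and gap: "\<forall>r\<in>{s<..t}. Fm (y r) < x r" for s t
  proof -
    have "x t - x s \<le> 0"
    proof (rule has_integral_le)
      show "(x' has_integral x t - x s) {s..t}" using st by (intro int_x) auto
      show "((\<lambda>r. if r \<in> N2 \<union> {s, t} then x' r else 0) has_integral 0) {s..t}"
        by (rule has_integral_negligible[of "N2 \<union> {s, t}"]) (use N2 in auto)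
      fix r assume r: "r \<in> {s..t}"
      show "x' r \<le> (if r \<in> N2 \<union> {s, t} then x' r else 0)"
      proof (cases "r \<in> N2 \<union> {s, t}")
        case False
        then have "r \<in> {0<..<T} - N2" "Fm (y r) < x r" using r st gap by auto
        moreover from this(1) have "x' r * (x r - Fm (y r)) \<le> 0"
          using Fm_le_Fp by (intro N2(2)) auto
        ultimately have "x' r \<le> 0" by (auto simp: mult_le_0_iff)
        then show ?thesis using False by simp
      qed simp
    qed
    then show ?thesis by simp
  qed
  have inc: "x s \<le> x t" if st: "0 \<le> s" "s < t" "t \<le> T" and gap: "\<forall>r\<in>{s<..t}. x r < Fp (y r)" for s t
  proof -
    have "0 \<le> x t - x s"
    proof (rule has_integral_le)
      show "(x' has_integral x t - x s) {s..t}" using st by (intro int_x) auto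
      show "((\<lambda>r. if r \<in> N2 \<union> {s, t} then x' r else 0) has_integral 0) {s..t}"
        by (rule has_integral_negligible[of "N2 \<union> {s, t}"]) (use N2 in auto)
      fix r assume r: "r \<in> {s..t}"
      show "(if r \<in> N2 \<union> {s, t} then x' r else 0) \<le> x' r"
      proof (cases "r \<in> N2 \<union> {s, t}")
        case False
        then have "r \<in> {0<..<T} - N2" "x r < Fp (y r)" using r st gap by auto
        moreover from this(1) have "x' r * (x r - Fp (y r)) \<le> 0"
          using Fm_le_Fp by (intro N2(2)) auto
        ultimately have "0 \<le> x' r" by (auto simp: mult_le_0_iff)
        then show ?thesis using False by simp
      qed simp
    qed
    then show ?thesis by simp
  qed
  have "play_within 0 0 T Fm Fp x y"
    unfolding play_within_def using cx band dec inc by auto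
  then show ?thesis
    unfolding approx_sol_def using ylip xX yR init dy by auto
qed

end

section \<open>The fast-slow system and its initial layer\<close>

text \<open>
  The quantity \<open>x\<close> falls with speed at least \<open>\<nu>\<close> whenever it is above \<open>\<phi> + \<delta>\<close>, and \<open>\<phi>\<close> moves with speed at
  most \<open>l < \<nu>\<close>. So \<open>x - \<phi>\<close> falls with speed \<open>\<nu> - l\<close> above \<open>\<delta>\<close>: it cannot leave \<open>{..\<delta>}\<close> and enters it within
  the time needed at this speed. The lower end of the band is obtained by applying this to \<open>- x\<close> and \<open>- \<phi>\<close>.
\<close>

lemma band_entrance:
  fixes x \<phi> :: "real \<Rightarrow> real"
  assumes cx: "continuous_on {0..T} x"
    and \<phi>: "\<And>s t. 0 \<le> s \<Longrightarrow> s \<le> t \<Longrightarrow> t \<le> T \<Longrightarrow> \<bar>\<phi> t - \<phi> s\<bar> \<le> l * (t - s)"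
    and dx: "\<And>t. 0 < t \<Longrightarrow> t < T \<Longrightarrow> (x has_real_derivative x' t) (at t)"
    and attract: "\<And>t. 0 < t \<Longrightarrow> t < T \<Longrightarrow> \<phi> t + \<delta> < x t \<Longrightarrow> x' t \<le> - \<nu>"
    and \<nu>: "l < \<nu>" and \<delta>: "0 < \<delta>" and l: "0 \<le> l"
  shows band_invariant: "\<And>\<sigma> t. 0 \<le> \<sigma> \<Longrightarrow> x \<sigma> \<le> \<phi> \<sigma> + \<delta> \<Longrightarrow> t \<in> {\<sigma>..T} \<Longrightarrow> x t \<le> \<phi> t + \<delta>"
    and band_hit: "\<phi> 0 \<le> x 0 \<Longrightarrow> (x 0 - \<phi> 0) / (\<nu> - l) \<le> T \<Longrightarrow>
      \<exists>\<tau>\<in>{0..(x 0 - \<phi> 0) / (\<nu> - l)}. \<phi> \<tau> \<le> x \<tau> \<and> x \<tau> \<le> \<phi> \<tau> + \<delta>"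
proof -
  have "l-lipschitz_on {0..T} \<phi>"
  proof (rule lipschitz_onI[OF _ l])
    fix s t assume "s \<in> {0..T}" "t \<in> {0..T}"
    then show "dist (\<phi> s) (\<phi> t) \<le> l * dist s t"
      using \<phi>[of s t] \<phi>[of t s] by (cases "s \<le> t") (auto simp: dist_real_def abs_minus_commute)
  qed
  then have c\<phi>: "continuous_on {0..T} \<phi>" by (rule lipschitz_on_continuous_on)
  define h where "h t = x t - \<phi> t" for t
  have ch: "continuous_on {0..T} h" unfolding h_def by (intro continuous_intros cx c\<phi>)
  have rate: "h t \<le> h s - (\<nu> - l) * (t - s)"
    if st: "0 \<le> s" "s \<le> t" "t \<le> T" and out: "\<And>r. s < r \<Longrightarrow> r < t \<Longrightarrow> \<delta> < h r" for s t
  proof -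
    have "x t - x s \<le> - \<nu> * t - - \<nu> * s"
    proof (rule deriv_bound_diff[where u = x and p = "\<lambda>t. - \<nu> * t" and u' = x' and p' = "\<lambda>_. - \<nu>"])
      show "continuous_on {s..t} x" by (rule continuous_on_subset[OF cx]) (use st in auto)
      show "continuous_on {s..t} (\<lambda>t. - \<nu> * t)" by (intro continuous_intros)
      fix r assume r: "s < r" "r < t"
      then show "(x has_real_derivative x' r) (at r)" using st by (intro dx) auto
      show "((\<lambda>t. - \<nu> * t) has_real_derivative - \<nu>) (at r)" by (rule DERIV_cmult_Id)
      show "x' r \<le> - \<nu>" using attract[of r] out[of r] r st by (auto simp: h_def)
    qed (use st in auto)
    then show ?thesis using \<phi>[of s t] st by (simp add: h_def algebra_simps abs_le_iff)
  qed
  show "x t \<le> \<phi> t + \<delta>" if "0 \<le> \<sigma>" "x \<sigma> \<le> \<phi> \<sigma> + \<delta>" "t \<in> {\<sigma>..T}" for \<sigma> t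
  proof -
    have "h t \<le> \<delta>"
    proof (rule upper_barrier[of \<sigma> T h \<delta> t])
      show "continuous_on {\<sigma>..T} h" by (rule continuous_on_subset[OF ch]) (use that in auto)
      show "h r \<le> h s" if sr: "\<sigma> \<le> s" "s < r" "r \<le> T" "\<And>q. s < q \<Longrightarrow> q \<le> r \<Longrightarrow> \<delta> < h q" for s r
      proof -
        have "h r \<le> h s - (\<nu> - l) * (r - s)" by (rule rate) (use sr \<open>0 \<le> \<sigma>\<close> in auto)
        moreover have "0 \<le> (\<nu> - l) * (r - s)" using \<nu> sr by simp
        ultimately show ?thesis by simp
      qed
    qed (use that in \<open>auto simp: h_def\<close>)
    then show ?thesis by (simp add: h_def)
  qed
  show "\<exists>\<tau>\<in>{0..(x 0 - \<phi> 0) / (\<nu> - l)}. \<phi> \<tau> \<le> x \<tau> \<and> x \<tau> \<le> \<phi> \<tau> + \<delta>"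
    if h0: "\<phi> 0 \<le> x 0" and le: "(x 0 - \<phi> 0) / (\<nu> - l) \<le> T"
  proof -
    define B where "B = (x 0 - \<phi> 0) / (\<nu> - l)"
    have B: "0 \<le> B" "B \<le> T" using h0 le \<nu> by (auto simp: B_def)
    have "\<exists>\<tau>\<in>{0..B}. 0 \<le> h \<tau> \<and> h \<tau> \<le> \<delta>"
    proof (cases "h 0 \<le> \<delta>")
      case True
      then show ?thesis using h0 B by (intro bexI[of _ 0]) (auto simp: h_def)
    next
      case False
      have "\<exists>s\<in>{0..B}. h s \<le> \<delta>"
      proof (rule ccontr)
        assume "\<not> ?thesis"
        then have out: "\<delta> < h s" if "s \<in> {0..B}" for s using that by force
        then have "h B \<le> h 0 - (\<nu> - l) * (B - 0)" by (intro rate) (use B in auto)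
        moreover have "\<delta> < h B" using out B by auto
        moreover have "(\<nu> - l) * B = h 0" using \<nu> by (simp add: B_def h_def)
        ultimately show False using \<delta> by simp
      qed
      then obtain s where s: "s \<in> {0..B}" "h s \<le> \<delta>" by blast
      obtain \<tau> where "0 \<le> \<tau>" "\<tau> \<le> s" "h \<tau> = \<delta>"
        using IVT2'[of h s \<delta> 0] s False B continuous_on_subset[OF ch, of "{0..s}"] by auto
      then show ?thesis using s \<delta> by (intro bexI[of _ \<tau>]) auto
    qed
    then show ?thesis by (auto simp: h_def B_def)
  qed
qed

lemma compact_positive_lower_bound:
  fixes h :: "'a::topological_space \<Rightarrow> real"
  assumes "compact S" "continuous_on S h" "\<And>p. p \<in> S \<Longrightarrow> 0 < h p"
  shows "\<exists>\<mu>>0. \<forall>p\<in>S. \<mu> \<le> h p"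
proof (cases "S = {}")
  case False
  then obtain p where "p \<in> S" "\<And>q. q \<in> S \<Longrightarrow> h p \<le> h q"
    using continuous_attains_inf[OF assms(1) _ assms(2)] by blast
  then show ?thesis using assms(3) by blast
qed (auto intro: exI[of _ 1])

locale fast_slow = play_ode +
  fixes f :: "real \<times> real \<Rightarrow> real" and xe ye :: "real \<Rightarrow> real \<Rightarrow> real"
  assumes f_cont: "continuous_on UNIV f"
    and f_neg: "Fp y < x \<Longrightarrow> f (x, y) < 0"
    and f_zero: "x \<in> {Fm y..Fp y} \<Longrightarrow> f (x, y) = 0"
    and f_pos: "x < Fm y \<Longrightarrow> 0 < f (x, y)"
    and x0_X: "\<bar>x0\<bar> \<le> X"
    and sol: "0 < \<epsilon> \<Longrightarrow> fast_slow_solution T f g x0 y0 \<epsilon> (xe \<epsilon>) (ye \<epsilon>)"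
begin

lemma f_nonpos: "Fm y \<le> x \<Longrightarrow> f (x, y) \<le> 0" and f_nonneg: "x \<le> Fp y \<Longrightarrow> 0 \<le> f (x, y)"
  using f_neg[of y x] f_zero[of x y] f_pos[of x y] Fm_le_Fp[of y] 
  by (cases "x \<le> Fp y"; cases "Fm y \<le> x"; simp)+

context
  fixes \<epsilon> :: real
  assumes \<epsilon>: "0 < \<epsilon>"
begin

abbreviation "x \<equiv> xe \<epsilon>"
abbreviation "y \<equiv> ye \<epsilon>"

lemma sol_init: "x 0 = x0" "y 0 = y0"
  using sol[OF \<epsilon>] by (auto simp: fast_slow_solution_def)

lemma sol_deriv_within:
  assumes "t \<in> {0..T}"
  shows "(x has_real_derivative f (x t, y t) / \<epsilon>) (at t within {0..T})"
    "(y has_real_derivative g (x t, y t, t)) (at t within {0..T})"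
  using sol[OF \<epsilon>] assms unfolding fast_slow_solution_def by blast+

lemma sol_continuous: "continuous_on {0..T} x" "continuous_on {0..T} y"
  by (rule DERIV_continuous_on, erule sol_deriv_within)+

lemma sol_deriv:
  assumes "0 < t" "t < T"
  shows "(x has_real_derivative f (x t, y t) / \<epsilon>) (at t)"
    "(y has_real_derivative g (x t, y t, t)) (at t)"
  using sol_deriv_within[of t] assms unfolding at_within_Icc_at[OF assms] by auto

lemma sol_y_bound: "\<bar>y t\<bar> \<le> R" if t: "t \<in> {0..T}"
proof -
  have "\<bar>y t\<bar> \<le> (1 + (y 0)\<^sup>2) * exp (4 * A * T)"
    by (rule linear_growth_bound[OF sol_continuous(2) A sol_deriv(2) growth t]) auto
  then show ?thesis using R by (simp add: sol_init)
qed

lemma sol_x_decreasing: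
  assumes st: "0 \<le> s" "s < t" "t \<le> T" and above: "\<And>r. s < r \<Longrightarrow> r < t \<Longrightarrow> Fm (y r) \<le> x r"
  shows "x t \<le> x s"
proof -
  have "x t - x s \<le> (\<lambda>_. 0) t - (\<lambda>_. 0) s"
  proof (rule deriv_bound_diff[where u = x and p = "\<lambda>_. 0" and u' = "\<lambda>t. f (x t, y t) / \<epsilon>" and p' = "\<lambda>_. 0"])
    show "f (x r, y r) / \<epsilon> \<le> 0" if "s < r" "r < t" for r
      using f_nonpos[OF above[OF that]] \<epsilon> by (simp add: divide_nonpos_pos)
  qed (use st sol_deriv in \<open>auto intro!: continuous_on_subset[OF sol_continuous(1)]\<close>)
  then show ?thesis by simp
qed

lemma sol_x_increasing:
  assumes st: "0 \<le> s" "s < t" "t \<le> T" and below: "\<And>r. s < r \<Longrightarrow> r < t \<Longrightarrow> x r \<le> Fp (y r)"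
  shows "x s \<le> x t"
proof -
  have "(\<lambda>_. 0) t - (\<lambda>_. 0) s \<le> x t - x s"
  proof (rule deriv_bound_diff[where p = x and u = "\<lambda>_. 0" and p' = "\<lambda>t. f (x t, y t) / \<epsilon>" and u' = "\<lambda>_. 0"])
    show "0 \<le> f (x r, y r) / \<epsilon>" if "s < r" "r < t" for r
      using f_nonneg[OF below[OF that]] \<epsilon> by simp
  qed (use st sol_deriv in \<open>auto intro!: continuous_on_subset[OF sol_continuous(1)]\<close>)
  then show ?thesis by simp
qed

lemma sol_x_bound: "\<bar>x t\<bar> \<le> X" if t: "t \<in> {0..T}"
proof -
  have "x t \<le> X"
  proof (rule upper_barrier[OF sol_continuous(1) _ _ t])
    fix s r assume sr: "0 \<le> s" "s < r" "r \<le> T" and out: "\<And>q. s < q \<Longrightarrow> q \<le> r \<Longrightarrow> X < x q"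
    show "x r \<le> x s"
    proof (rule sol_x_decreasing[OF sr])
      fix q assume q: "s < q" "q < r"
      then show "Fm (y q) \<le> x q" using X[OF sol_y_bound[of q]] out[of q] sr by auto
    qed
  qed (use x0_X in \<open>auto simp: sol_init\<close>)
  moreover have "- x t \<le> X"
  proof (rule upper_barrier[of 0 T "\<lambda>t. - x t", OF _ _ _ t])
    fix s r assume sr: "0 \<le> s" "s < r" "r \<le> T" and out: "\<And>q. s < q \<Longrightarrow> q \<le> r \<Longrightarrow> X < - x q"
    have "x s \<le> x r"
    proof (rule sol_x_increasing[OF sr])
      fix q assume q: "s < q" "q < r"
      then show "x q \<le> Fp (y q)" using X[OF sol_y_bound[of q]] out[of q] sr by auto
    qed
    then show "- x r \<le> - x s" by simp
  qed (use x0_X in \<open>auto simp: sol_init intro!: continuous_intros sol_continuous\<close>)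
  ultimately show ?thesis by simp
qed

lemma sol_y_lipschitz: "C-lipschitz_on {0..T} y"
proof (rule lipschitz_onI[OF _ C])
  have *: "\<bar>y t - y s\<bar> \<le> C * t - C * s" if "0 \<le> s" "s \<le> t" "t \<le> T" for s t
    by (rule deriv_abs_bound_diff[where u' = "\<lambda>t. g (x t, y t, t)" and p' = "\<lambda>_. C"])
      (use that sol_deriv sol_x_bound sol_y_bound in
        \<open>auto intro!: continuous_on_subset[OF sol_continuous(2)] continuous_intros derivative_eq_intros g_bound\<close>)
  fix s t assume "s \<in> {0..T}" "t \<in> {0..T}"
  then show "dist (y s) (y t) \<le> C * dist s t"
    using *[of s t] *[of t s] by (cases "s \<le> t") (auto simp: dist_real_def abs_minus_commute algebra_simps)
qed

text \<open>
  Freezing both components at time \<open>\<tau>\<close> during the initial layer removes the fast transient. A frozen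
  solution is constant before \<open>\<tau>\<close>, so the monotonicity rules hold there trivially.
\<close>

lemma frozen_approx_sol:
  assumes \<tau>: "0 \<le> \<tau>" "\<tau> \<le> T" "\<tau> \<le> \<delta>" "C * \<tau> \<le> \<delta>" and init: "\<bar>x \<tau> - xs\<bar> \<le> \<delta>"
    and band: "\<And>t. t \<in> {\<tau>..T} \<Longrightarrow> Fm (y t) - \<delta> \<le> x t \<and> x t \<le> Fp (y t) + \<delta>"
  shows "approx_sol \<delta> (\<lambda>t. x (max t \<tau>)) (\<lambda>t. y (max t \<tau>))"
proof -
  have in': "max t \<tau> \<in> {0..T}" "max t \<tau> \<in> {\<tau>..T}" if "t \<in> {0..T}" for t using that \<tau> by auto
  have "continuous_on {0..T} (\<lambda>t. x (max t \<tau>))"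
    by (rule continuous_on_compose2[OF sol_continuous(1)]) (use in' in \<open>auto intro!: continuous_intros\<close>)
  moreover have "Fm (y (max t \<tau>)) - \<delta> \<le> x (max t \<tau>) \<and> x (max t \<tau>) \<le> Fp (y (max t \<tau>)) + \<delta>"
    if "t \<in> {0..T}" for t using band[OF in'(2)[OF that]] .
  moreover have "x (max t \<tau>) \<le> x (max s \<tau>)"
    if st: "0 \<le> s" "s < t" "t \<le> T" and "\<forall>r\<in>{s<..t}. Fm (y (max r \<tau>)) < x (max r \<tau>)" for s t
  proof (cases "t \<le> \<tau>")
    case False
    show ?thesis
    proof (rule sol_x_decreasing)
      fix r assume "max s \<tau> < r" "r < max t \<tau>"
      then show "Fm (y r) \<le> x r" using that(4)[rule_format, of r] st False by (auto simp: max_def split: if_splits)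
    qed (use st \<tau> False in auto)
  qed (use st in auto)
  moreover have "x (max s \<tau>) \<le> x (max t \<tau>)"
    if st: "0 \<le> s" "s < t" "t \<le> T" and "\<forall>r\<in>{s<..t}. x (max r \<tau>) < Fp (y (max r \<tau>))" for s t
  proof (cases "t \<le> \<tau>")
    case False
    show ?thesis
    proof (rule sol_x_increasing)
      fix r assume "max s \<tau> < r" "r < max t \<tau>"
      then show "x r \<le> Fp (y r)" using that(4)[rule_format, of r] st False by (auto simp: max_def split: if_splits)
    qed (use st \<tau> False in auto)
  qed (use st in auto)
  ultimately have "play_within \<delta> 0 T Fm Fp (\<lambda>t. x (max t \<tau>)) (\<lambda>t. y (max t \<tau>))"
    unfolding play_within_def by blast
  moreover have "C-lipschitz_on {0..T} (\<lambda>t. y (max t \<tau>))"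
  proof (rule lipschitz_onI[OF _ C])
    fix s t assume st: "s \<in> {0..T}" "t \<in> {0..T}"
    have "dist (y (max s \<tau>)) (y (max t \<tau>)) \<le> C * dist (max s \<tau>) (max t \<tau>)"
      by (rule lipschitz_onD[OF sol_y_lipschitz in'(1)[OF st(1)] in'(1)[OF st(2)]])
    also have "\<dots> \<le> C * dist s t" by (intro mult_left_mono C) (auto simp: dist_real_def)
    finally show "dist (y (max s \<tau>)) (y (max t \<tau>)) \<le> C * dist s t" .
  qed
  moreover have "\<bar>y \<tau> - y0\<bar> \<le> \<delta>"
    using lipschitz_onD[OF sol_y_lipschitz, of \<tau> 0] \<tau> by (auto simp: dist_real_def sol_init)
  moreover have "((\<lambda>t. y (max t \<tau>)) has_real_derivative g (x (max t \<tau>), y (max t \<tau>), t)) (at t)"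
    if t: "t \<in> {\<delta><..<T}" for t
  proof (rule has_field_derivative_transform_within_open[of y _ t "{\<tau><..<T}"])
    show "(y has_real_derivative g (x (max t \<tau>), y (max t \<tau>), t)) (at t)"
      using sol_deriv(2)[of t] t \<tau> by (simp add: max_def)
  qed (use t \<tau> in auto)
  ultimately show ?thesis
    unfolding approx_sol_def using in'(1) sol_x_bound sol_y_bound init \<tau>(1) by (simp add: max_absorb2)
qed

end

text \<open>
  Outside a \<open>\<delta>\<close>-neighbourhood of the critical set, \<open>f\<close> is bounded away from zero by compactness of the box.
\<close>

lemma fast_drift_bound:
  assumes \<delta>: "0 < \<delta>"
  shows "\<exists>\<mu>>0. \<forall>x y. \<bar>x\<bar> \<le> X \<longrightarrow> \<bar>y\<bar> \<le> R \<longrightarrow>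
    (Fp y + \<delta> \<le> x \<longrightarrow> f (x, y) \<le> - \<mu>) \<and> (x \<le> Fm y - \<delta> \<longrightarrow> \<mu> \<le> f (x, y))"
proof -
  have cF: "continuous_on UNIV (\<lambda>p :: real \<times> real. Fp (snd p))" "continuous_on UNIV (\<lambda>p :: real \<times> real. Fm (snd p))"
    by (rule continuous_on_compose2[OF lipschitz_on_continuous_on[OF Fp]]
        continuous_on_compose2[OF lipschitz_on_continuous_on[OF Fm]]; auto intro!: continuous_intros)+
  define Up Lo where "Up = ({-X..X} \<times> {-R..R}) \<inter> {p. Fp (snd p) + \<delta> \<le> fst p}"
    and "Lo = ({-X..X} \<times> {-R..R}) \<inter> {p. fst p \<le> Fm (snd p) - \<delta>}"
  have "compact Up" "compact Lo" unfolding Up_def Lo_def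
    by (intro compact_Int_closed compact_Times compact_Icc closed_Collect_le continuous_intros cF)+
  moreover have "0 < - f p" if "p \<in> Up" for p
    using that f_neg[of "snd p" "fst p"] \<delta> by (auto simp: Up_def)
  moreover have "0 < f p" if "p \<in> Lo" for p
    using that f_pos[of "fst p" "snd p"] \<delta> by (auto simp: Lo_def)
  ultimately obtain \<mu>1 \<mu>2 where
    \<mu>: "0 < \<mu>1" "\<And>p. p \<in> Up \<Longrightarrow> \<mu>1 \<le> - f p" "0 < \<mu>2" "\<And>p. p \<in> Lo \<Longrightarrow> \<mu>2 \<le> f p"
    using compact_positive_lower_bound[of Up "\<lambda>p. - f p"] compact_positive_lower_bound[of Lo f]
      continuous_on_subset[OF f_cont] by (metis continuous_on_minus subset_UNIV)
  show ?thesis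
  proof (intro exI[of _ "min \<mu>1 \<mu>2"] conjI allI impI)
    fix x y assume xy: "\<bar>x\<bar> \<le> X" "\<bar>y\<bar> \<le> R"
    show "f (x, y) \<le> - min \<mu>1 \<mu>2" if "Fp y + \<delta> \<le> x"
      using \<mu>(2)[of "(x, y)"] xy that by (simp add: Up_def abs_le_iff)
    show "min \<mu>1 \<mu>2 \<le> f (x, y)" if "x \<le> Fm y - \<delta>"
      using \<mu>(4)[of "(x, y)"] xy that by (simp add: Lo_def abs_le_iff)
  qed (use \<mu> in simp)
qed

text \<open>
  For small \<open>\<epsilon>\<close> the fast speed \<open>\<mu> / \<epsilon>\<close> outside the \<open>\<delta> / 2\<close>-band dominates the speed \<open>L * C\<close> of the boundaries, so the
  band is entered at some \<open>\<tau> = O(\<epsilon>)\<close> on the side where \<open>x0\<close> lies. By then the boundary has moved by at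
  most \<open>\<delta> / 2\<close>, hence \<open>x \<tau>\<close> is within \<open>\<delta>\<close> of the projection \<open>xs\<close> of \<open>x0\<close>.
\<close>

lemma initial_layer:
  assumes \<delta>: "0 < \<delta>"
  shows "\<exists>\<epsilon>1>0. \<exists>Cl>0. \<forall>\<epsilon>\<in>{0<..<\<epsilon>1}. \<exists>\<tau>\<in>{0..<T}. \<tau> \<le> \<epsilon> * Cl \<and> \<tau> \<le> \<delta> \<and>
    (x0 \<in> {Fm y0..Fp y0} \<longrightarrow> \<tau> = 0) \<and>
    approx_sol \<delta> (\<lambda>t. xe \<epsilon> (max t \<tau>)) (\<lambda>t. ye \<epsilon> (max t \<tau>))"
proof -
  define d where "d = \<delta> / 2"
  have d: "0 < d" and \<delta>_eq: "\<delta> = d + d" using \<delta> by (simp_all add: d_def)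
  obtain \<mu> where \<mu>: "0 < \<mu>"
    and up: "\<And>x y. \<bar>x\<bar> \<le> X \<Longrightarrow> \<bar>y\<bar> \<le> R \<Longrightarrow> Fp y + d \<le> x \<Longrightarrow> f (x, y) \<le> - \<mu>"
    and lo: "\<And>x y. \<bar>x\<bar> \<le> X \<Longrightarrow> \<bar>y\<bar> \<le> R \<Longrightarrow> x \<le> Fm y - d \<Longrightarrow> \<mu> \<le> f (x, y)"
    using fast_drift_bound[OF d] by blast
  define l where "l = L * C"
  have l: "0 \<le> l" using L_nonneg C by (simp add: l_def)
  have X0: "0 \<le> X" using x0_X by simp
  \<comment> \<open>The distance to cover is at most \<open>2 * X\<close>, at speed at least \<open>\<mu> / (2 * \<epsilon>)\<close>; adding 1 makes the constant positive.\<close>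
  define Cl where "Cl = 4 * X / \<mu> + 1"
  have Cl: "0 < Cl" using X0 \<mu> by (simp add: Cl_def add_nonneg_pos)
  \<comment> \<open>Times below \<open>m\<close> are smaller than \<open>T\<close> and than \<open>\<delta>\<close>, and both \<open>y\<close> and the boundaries move by at most \<open>\<delta> / 2\<close>.\<close>
  define m where "m = min d (T / 2) / ((1 + C) * (1 + L))"
  have CL: "1 \<le> (1 + C) * (1 + L)" using C L_nonneg mult_mono[of 1 "1 + C" 1 "1 + L"] by simp
  have m: "0 < m" using d T CL by (simp add: m_def)
  have mCL: "m * ((1 + C) * (1 + L)) = min d (T / 2)" using C L_nonneg by (auto simp: m_def)
  have m_le: "c * \<tau> \<le> min d (T / 2)" if "c \<le> (1 + C) * (1 + L)" "0 \<le> c" "0 \<le> \<tau>" "\<tau> \<le> m" for c \<tau>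
    using mult_mono[OF that(4,1)] m that mCL by (simp add: mult.commute)
  define \<epsilon>1 where "\<epsilon>1 = min (\<mu> / (2 * (l + 1))) (m / Cl)"
  have \<epsilon>1: "0 < \<epsilon>1" using \<mu> l m Cl by (simp add: \<epsilon>1_def)
  have y0R: "\<bar>y0\<bar> \<le> R" using sol_y_bound[of 1 0] sol_init[of 1] T by simp
  show ?thesis
  proof (rule exI[of _ \<epsilon>1], rule conjI[OF \<epsilon>1], rule exI[of _ Cl], rule conjI[OF Cl], rule ballI)
    fix \<epsilon> assume e: "\<epsilon> \<in> {0<..<\<epsilon>1}"
    then have \<epsilon>: "0 < \<epsilon>" and e1: "\<epsilon> < \<mu> / (2 * (l + 1))" and e2: "\<epsilon> * Cl < m"
      using Cl by (auto simp: \<epsilon>1_def pos_less_divide_eq)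
    let ?x = "xe \<epsilon>" and ?y = "ye \<epsilon>"
    note init = sol_init[OF \<epsilon>] and xX = sol_x_bound[OF \<epsilon>] and yR = sol_y_bound[OF \<epsilon>]
      and dx = sol_deriv(1)[OF \<epsilon>] and cx = sol_continuous(1)[OF \<epsilon>]
    define \<nu> where "\<nu> = \<mu> / \<epsilon>"
    have "l + 1 < \<mu> / (2 * \<epsilon>)" using e1 \<epsilon> l by (simp add: field_simps)
    then have \<nu>l: "l < \<nu>" "\<mu> / (2 * \<epsilon>) \<le> \<nu> - l" using \<mu> \<epsilon> by (auto simp: \<nu>_def field_simps)
    have hit_le: "r / (\<nu> - l) \<le> \<epsilon> * Cl" if "0 \<le> r" "r \<le> 2 * X" for r
    proof -
      have "r / (\<nu> - l) \<le> 2 * X / (\<mu> / (2 * \<epsilon>))"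
        using that \<nu>l \<mu> \<epsilon> by (intro frac_le) auto
      also have "\<dots> = \<epsilon> * (4 * X / \<mu>)" by simp
      also have "\<dots> \<le> \<epsilon> * Cl" unfolding Cl_def using \<epsilon> by (intro mult_left_mono) auto
      finally show ?thesis .
    qed
    have F_lip: "\<bar>F (?y t) - F (?y s)\<bar> \<le> l * (t - s)"
      if F: "L-lipschitz_on UNIV F" and st: "0 \<le> s" "s \<le> t" "t \<le> T" for F s t
    proof -
      have "\<bar>F (?y t) - F (?y s)\<bar> \<le> L * \<bar>?y t - ?y s\<bar>"
        using lipschitz_onD[OF F, of "?y t" "?y s"] by (simp add: dist_real_def)
      also have "\<bar>?y t - ?y s\<bar> \<le> C * (t - s)"
        using lipschitz_onD[OF sol_y_lipschitz[OF \<epsilon>], of t s] st by (simp add: dist_real_def)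
      finally show ?thesis using L_nonneg by (simp add: l_def mult_left_mono mult.assoc)
    qed
    have up': "f (?x t, ?y t) / \<epsilon> \<le> - \<nu>" if "0 < t" "t < T" "Fp (?y t) + d < ?x t" for t
      using up[OF xX[of t] yR[of t]] that \<epsilon> by (simp add: \<nu>_def divide_simps)
    have lo': "- (f (?x t, ?y t) / \<epsilon>) \<le> - \<nu>" if "0 < t" "t < T" "- Fm (?y t) + d < - ?x t" for t
      using lo[OF xX[of t] yR[of t]] that \<epsilon> by (simp add: \<nu>_def divide_simps)
    note up_band = band_entrance[of T ?x "\<lambda>t. Fp (?y t)" l "\<lambda>t. f (?x t, ?y t) / \<epsilon>" d \<nu>,
        OF cx F_lip[OF Fp] dx up' \<nu>l(1) d l]
    have cx': "continuous_on {0..T} (\<lambda>t. - ?x t)" by (intro continuous_intros cx)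
    have Fm_lip: "\<bar>- Fm (?y t) - - Fm (?y s)\<bar> \<le> l * (t - s)" if "0 \<le> s" "s \<le> t" "t \<le> T" for s t
      using F_lip[OF Fm that] by (simp add: abs_minus_commute)
    note lo_band = band_entrance[of T "\<lambda>t. - ?x t" "\<lambda>t. - Fm (?y t)" l "\<lambda>t. - (f (?x t, ?y t) / \<epsilon>)" d \<nu>,
        OF cx' Fm_lip DERIV_minus[OF dx] lo' \<nu>l(1) d l]
    have small: "\<tau> \<le> d" "\<tau> < T" "C * \<tau> \<le> d" "l * \<tau> \<le> d" if "0 \<le> \<tau>" "\<tau> \<le> \<epsilon> * Cl" for \<tau>
    proof -
      have "\<tau> \<le> m" using that e2 by simp
      moreover have "C \<le> (1 + C) * (1 + L)" "l \<le> (1 + C) * (1 + L)" using C L_nonneg by (auto simp: l_def algebra_simps)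
      ultimately show "\<tau> \<le> d" "\<tau> < T" "C * \<tau> \<le> d" "l * \<tau> \<le> d"
        using m_le[of 1 \<tau>] m_le[of C \<tau>] m_le[of l \<tau>] that CL C l T by auto
    qed
    have "\<exists>\<tau>. 0 \<le> \<tau> \<and> \<tau> \<le> \<epsilon> * Cl \<and> (x0 \<in> {Fm y0..Fp y0} \<longrightarrow> \<tau> = 0) \<and> \<bar>?x \<tau> - xs\<bar> \<le> \<delta> \<and>
        ?x \<tau> \<le> Fp (?y \<tau>) + d \<and> - ?x \<tau> \<le> - Fm (?y \<tau>) + d"
    proof -
      consider "x0 \<in> {Fm y0..Fp y0}" | "Fp y0 < x0" | "x0 < Fm y0" by force
      then show ?thesis
      proof cases
        case 1
        then show ?thesis
          using d \<delta> \<epsilon> Cl by (intro exI[of _ 0]) (auto simp: init)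
      next
        case 2
        have le: "(x0 - Fp y0) / (\<nu> - l) \<le> \<epsilon> * Cl" using 2 X[OF y0R] x0_X by (intro hit_le) auto
        have "(x0 - Fp y0) / (\<nu> - l) \<le> T"
          by (intro less_imp_le small(2)[OF _ le]) (use 2 \<nu>l in auto)
        then obtain \<tau> where \<tau>: "0 \<le> \<tau>" "\<tau> \<le> (x0 - Fp y0) / (\<nu> - l)"
            "Fp (?y \<tau>) \<le> ?x \<tau>" "?x \<tau> \<le> Fp (?y \<tau>) + d"
          using up_band(2) 2 by (auto simp: init)
        have \<tau>': "\<tau> \<le> \<epsilon> * Cl" using \<tau> le by simp
        have xs: "xs = Fp y0" using 2 Fm_le_Fp[of y0] by auto
        have "\<bar>Fp (?y \<tau>) - Fp y0\<bar> \<le> d"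
          using F_lip[OF Fp, of 0 \<tau>] small[OF \<tau>(1) \<tau>'] \<tau> T by (simp add: init)
        then have "\<bar>?x \<tau> - xs\<bar> \<le> \<delta>" using \<tau> unfolding xs \<delta>_eq by linarith
        moreover have "- ?x \<tau> \<le> - Fm (?y \<tau>) + d" using \<tau> Fm_le_Fp[of "?y \<tau>"] d by linarith
        ultimately show ?thesis using \<tau> \<tau>' 2 by (intro exI[of _ \<tau>]) auto
      next
        case 3
        have le: "(Fm y0 - x0) / (\<nu> - l) \<le> \<epsilon> * Cl" using 3 X[OF y0R] x0_X by (intro hit_le) auto
        have "(Fm y0 - x0) / (\<nu> - l) \<le> T"
          by (intro less_imp_le small(2)[OF _ le]) (use 3 \<nu>l in auto)
        then obtain \<tau> where \<tau>: "0 \<le> \<tau>" "\<tau> \<le> (Fm y0 - x0) / (\<nu> - l)"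
            "?x \<tau> \<le> Fm (?y \<tau>)" "- ?x \<tau> \<le> - Fm (?y \<tau>) + d"
          using lo_band(2) 3 by (auto simp: init)
        have \<tau>': "\<tau> \<le> \<epsilon> * Cl" using \<tau> le by simp
        have xs: "xs = Fm y0" using 3 Fm_le_Fp[of y0] by auto
        have "\<bar>Fm (?y \<tau>) - Fm y0\<bar> \<le> d"
          using F_lip[OF Fm, of 0 \<tau>] small[OF \<tau>(1) \<tau>'] \<tau> T by (simp add: init)
        then have "\<bar>?x \<tau> - xs\<bar> \<le> \<delta>" using \<tau> unfolding xs \<delta>_eq by linarith
        moreover have "?x \<tau> \<le> Fp (?y \<tau>) + d" using \<tau> Fm_le_Fp[of "?y \<tau>"] d by linarith
        ultimately show ?thesis using \<tau> \<tau>' 3 by (intro exI[of _ \<tau>]) auto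
      qed
    qed
    then obtain \<tau> where \<tau>: "0 \<le> \<tau>" "\<tau> \<le> \<epsilon> * Cl" "x0 \<in> {Fm y0..Fp y0} \<longrightarrow> \<tau> = 0" "\<bar>?x \<tau> - xs\<bar> \<le> \<delta>"
        "?x \<tau> \<le> Fp (?y \<tau>) + d" "- ?x \<tau> \<le> - Fm (?y \<tau>) + d" by blast
    have band: "Fm (?y t) - \<delta> \<le> ?x t \<and> ?x t \<le> Fp (?y t) + \<delta>" if "t \<in> {\<tau>..T}" for t
    proof -
      have "?x t \<le> Fp (?y t) + d" by (rule up_band(1)[of \<tau> t]) (use \<tau> that in auto)
      moreover have "- ?x t \<le> - Fm (?y t) + d" by (rule lo_band(1)[of \<tau> t]) (use \<tau> that in auto)
      ultimately show ?thesis using d unfolding \<delta>_eq by linarith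
    qed
    have "\<tau> \<le> \<delta>" "C * \<tau> \<le> \<delta>" "\<tau> < T" using small[OF \<tau>(1,2)] \<delta> T by (auto simp: d_def)
    then show "\<exists>\<tau>\<in>{0..<T}. \<tau> \<le> \<epsilon> * Cl \<and> \<tau> \<le> \<delta> \<and>
      (x0 \<in> {Fm y0..Fp y0} \<longrightarrow> \<tau> = 0) \<and>
      approx_sol \<delta> (\<lambda>t. xe \<epsilon> (max t \<tau>)) (\<lambda>t. ye \<epsilon> (max t \<tau>))"
      using \<tau> frozen_approx_sol[OF \<epsilon>, of \<tau> \<delta>] band by (intro bexI[of _ \<tau>]) auto
  qed
qed

end

section \<open>Convergence\<close>

lemma C1_spaceI:
  fixes u u' :: "real \<Rightarrow> real"
  assumes cu: "continuous_on {a..b} u" and cu': "continuous_on {a..b} u'"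
    and d: "\<And>t. a < t \<Longrightarrow> t < b \<Longrightarrow> (u has_real_derivative u' t) (at t)"
    and S: "S \<subseteq> {a<..<b}"
  shows "u \<in> C1_space S"
proof -
  have S': "S \<subseteq> {a..b}" using S by auto
  have bd: "bounded (v ` S)" if "continuous_on {a..b} v" for v :: "real \<Rightarrow> real"
    by (rule bounded_subset[OF compact_imp_bounded[OF compact_continuous_image[OF that compact_Icc]]])
      (use S' in blast)
  have deriv: "deriv u t = u' t" if "t \<in> S" for t
    using d[of t] S that by (intro DERIV_imp_deriv) auto
  have "deriv u ` S = u' ` S" using deriv by (intro image_cong) auto
  moreover have "u C1_differentiable_on S"
    unfolding C1_differentiable_on_def
    using d S continuous_on_subset[OF cu' S']
    by (intro exI[of _ u']) (auto simp: has_real_derivative_iff_has_vector_derivative[symmetric])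
  ultimately show ?thesis unfolding C1_space_def using bd cu cu' by simp
qed

context fast_slow
begin

lemma exact_sol_exists: "\<exists>x y. approx_sol 0 x y"
proof (rule exact_sol_exists_if_approx)
  fix \<delta> :: real assume "0 < \<delta>"
  from initial_layer[OF this] obtain \<epsilon>1 Cl where e1: "0 < \<epsilon>1" and
    l: "\<forall>\<epsilon>\<in>{0<..<\<epsilon>1}. \<exists>\<tau>\<in>{0..<T}. \<tau> \<le> \<epsilon> * Cl \<and> \<tau> \<le> \<delta> \<and> (x0 \<in> {Fm y0..Fp y0} \<longrightarrow> \<tau> = 0) \<and>
      approx_sol \<delta> (\<lambda>t. xe \<epsilon> (max t \<tau>)) (\<lambda>t. ye \<epsilon> (max t \<tau>))" by auto
  have "\<epsilon>1 / 2 \<in> {0<..<\<epsilon>1}" using e1 by simp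
  from l[rule_format, OF this] show "\<exists>x y. approx_sol \<delta> x y" by blast
qed

lemma exact_sol_unique:
  assumes "approx_sol 0 x1 y1" "approx_sol 0 x2 y2" "t \<in> {0..T}"
  shows "x1 t = x2 t" "y1 t = y2 t"
  using approx_sol_stable[OF assms(1,2) _ assms(3)] by auto

lemma exact_sol_continuous:
  assumes "approx_sol 0 xb yb"
  shows "continuous_on {0..T} xb" "continuous_on {0..T} yb"
    "continuous_on {0..T} (\<lambda>t. g (xb t, yb t, t))"
proof -
  show 1: "continuous_on {0..T} xb" and 2: "continuous_on {0..T} yb"
    using assms by (auto simp: approx_sol_def play_within_def intro: lipschitz_on_continuous_on)
  show "continuous_on {0..T} (\<lambda>t. g (xb t, yb t, t))" by (rule continuous_on_g_along[OF 1 2])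
qed

text \<open>
  Stability between the frozen fast-slow solution and the exact one. After \<open>\<tau>\<close> the frozen \<open>x\<close>-component is
  the true one; for \<open>y\<close>, freezing changes the value by at most \<open>C \<tau>\<close> also before \<open>\<tau>\<close>.
\<close>

lemma approximation_with_layer:
  assumes ex: "approx_sol 0 xb yb" and \<eta>: "0 < \<eta>"
  shows "\<exists>\<epsilon>1>0. \<exists>Cl>0. \<forall>\<epsilon>\<in>{0<..<\<epsilon>1}. \<exists>\<tau>\<in>{0..<T}. \<tau> \<le> \<epsilon> * Cl \<and> \<tau> \<le> \<eta> \<and>
    (x0 \<in> {Fm y0..Fp y0} \<longrightarrow> \<tau> = 0) \<and>
    (\<forall>t\<in>{0..T}. \<bar>ye \<epsilon> t - yb t\<bar> \<le> \<eta>) \<and> (\<forall>t\<in>{\<tau>..T}. \<bar>xe \<epsilon> t - xb t\<bar> \<le> \<eta>)"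
proof -
  define \<delta> where "\<delta> = \<eta> / (stab + C + 1)"
  have KC: "0 < stab + C + 1" using stab_nonneg C by simp
  have \<delta>: "0 < \<delta>" using \<eta> KC by (simp add: \<delta>_def)
  have "(stab + C + 1) * \<delta> = \<eta>" using KC by (simp add: \<delta>_def)
  then have \<eta>_eq: "\<eta> = stab * \<delta> + C * \<delta> + \<delta>" by (simp add: distrib_right)
  have le: "stab * \<delta> \<le> \<eta>" "stab * \<delta> + C * \<delta> \<le> \<eta>" "\<delta> \<le> \<eta>"
    using \<delta> stab_nonneg C unfolding \<eta>_eq by auto
  have ex\<delta>: "approx_sol \<delta> xb yb" by (rule approx_sol_mono[OF ex]) (use \<delta> in simp)
  obtain \<epsilon>1 Cl where "0 < \<epsilon>1" "0 < Cl" and l: "\<And>\<epsilon>. \<epsilon> \<in> {0<..<\<epsilon>1} \<Longrightarrow>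
    \<exists>\<tau>\<in>{0..<T}. \<tau> \<le> \<epsilon> * Cl \<and> \<tau> \<le> \<delta> \<and> (x0 \<in> {Fm y0..Fp y0} \<longrightarrow> \<tau> = 0) \<and>
      approx_sol \<delta> (\<lambda>t. xe \<epsilon> (max t \<tau>)) (\<lambda>t. ye \<epsilon> (max t \<tau>))"
    using initial_layer[OF \<delta>] by blast
  have "\<exists>\<tau>\<in>{0..<T}. \<tau> \<le> \<epsilon> * Cl \<and> \<tau> \<le> \<eta> \<and>
    (x0 \<in> {Fm y0..Fp y0} \<longrightarrow> \<tau> = 0) \<and>
    (\<forall>t\<in>{0..T}. \<bar>ye \<epsilon> t - yb t\<bar> \<le> \<eta>) \<and> (\<forall>t\<in>{\<tau>..T}. \<bar>xe \<epsilon> t - xb t\<bar> \<le> \<eta>)" if e: "\<epsilon> \<in> {0<..<\<epsilon>1}" for \<epsilon>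
  proof -
    obtain \<tau> where \<tau>: "\<tau> \<in> {0..<T}" "\<tau> \<le> \<epsilon> * Cl" "\<tau> \<le> \<delta>" "x0 \<in> {Fm y0..Fp y0} \<longrightarrow> \<tau> = 0"
      and ap: "approx_sol \<delta> (\<lambda>t. xe \<epsilon> (max t \<tau>)) (\<lambda>t. ye \<epsilon> (max t \<tau>))"
      using l[OF e] by blast
    have st: "\<bar>xe \<epsilon> (max t \<tau>) - xb t\<bar> \<le> stab * \<delta>" "\<bar>ye \<epsilon> (max t \<tau>) - yb t\<bar> \<le> stab * \<delta>" if "t \<in> {0..T}" for t
      using approx_sol_stable[OF ap ex\<delta> _ that] \<delta> by auto
    have "\<bar>ye \<epsilon> t - yb t\<bar> \<le> \<eta>" if t: "t \<in> {0..T}" for t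
    proof -
      have mt: "max t \<tau> \<in> {0..T}" using t \<tau> by auto
      have "\<bar>ye \<epsilon> t - ye \<epsilon> (max t \<tau>)\<bar> \<le> C * \<bar>t - max t \<tau>\<bar>"
        using lipschitz_onD[OF sol_y_lipschitz, of \<epsilon> t "max t \<tau>"] e t mt by (simp add: dist_real_def)
      also have "\<dots> \<le> C * \<delta>" using t \<tau> by (intro mult_left_mono C) auto
      finally show ?thesis using st(2)[OF t] le by linarith
    qed
    moreover have "\<bar>xe \<epsilon> t - xb t\<bar> \<le> \<eta>" if t: "t \<in> {\<tau>..T}" for t
    proof -
      have "max t \<tau> = t" "t \<in> {0..T}" using t \<tau> by auto
      then show ?thesis using st(1)[of t] le by simp
    qed
    ultimately show ?thesis using \<tau> le by (intro bexI[of _ \<tau>]) auto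
  qed
  with \<open>0 < \<epsilon>1\<close> \<open>0 < Cl\<close> show ?thesis by blast
qed

text \<open>
  If \<open>x0\<close> satisfies the constraint there is no layer and \<open>c = 0\<close> is allowed; otherwise every \<open>c > 0\<close> exceeds
  the layer for small \<open>\<epsilon>\<close>. The bound on \<open>g\<close> along the solutions is the one for the derivatives of \<open>y\<close>.
\<close>

lemma uniform_approximation:
  assumes ex: "approx_sol 0 xb yb" and c: "0 \<le> c" "x0 \<in> {Fm y0..Fp y0} \<or> 0 < c" and e: "0 < e"
  shows "\<exists>\<epsilon>1>0. \<forall>\<epsilon>\<in>{0<..<\<epsilon>1}. (\<forall>t\<in>{0..T}. \<bar>ye \<epsilon> t - yb t\<bar> \<le> e) \<and>
    (\<forall>t\<in>{c..T}. \<bar>xe \<epsilon> t - xb t\<bar> \<le> e \<and> \<bar>g (xe \<epsilon> t, ye \<epsilon> t, t) - g (xb t, yb t, t)\<bar> \<le> e)"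
proof -
  define \<eta> where "\<eta> = min (min e (e / (2 * Lg))) (if 0 < c then c else e)"
  have \<eta>: "0 < \<eta>" "\<eta> \<le> e" "0 < c \<Longrightarrow> \<eta> \<le> c" using e Lg by (auto simp: \<eta>_def)
  have "\<eta> \<le> e / (2 * Lg)" by (auto simp: \<eta>_def)
  then have \<eta>L: "Lg * (\<eta> + \<eta>) \<le> e" using Lg by (simp add: field_simps)
  obtain \<epsilon>1 Cl where e1: "0 < \<epsilon>1" and l: "\<forall>\<epsilon>\<in>{0<..<\<epsilon>1}. \<exists>\<tau>\<in>{0..<T}. \<tau> \<le> \<epsilon> * Cl \<and> \<tau> \<le> \<eta> \<and>
    (x0 \<in> {Fm y0..Fp y0} \<longrightarrow> \<tau> = 0) \<and>
    (\<forall>t\<in>{0..T}. \<bar>ye \<epsilon> t - yb t\<bar> \<le> \<eta>) \<and> (\<forall>t\<in>{\<tau>..T}. \<bar>xe \<epsilon> t - xb t\<bar> \<le> \<eta>)"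
    using approximation_with_layer[OF ex \<eta>(1)] by blast
  show ?thesis
  proof (rule exI[of _ \<epsilon>1], rule conjI[OF e1], rule ballI)
    fix \<epsilon> assume \<epsilon>: "\<epsilon> \<in> {0<..<\<epsilon>1}"
    obtain \<tau> where \<tau>: "\<tau> \<in> {0..<T}" "\<tau> \<le> \<eta>" "x0 \<in> {Fm y0..Fp y0} \<longrightarrow> \<tau> = 0"
      and y: "\<And>t. t \<in> {0..T} \<Longrightarrow> \<bar>ye \<epsilon> t - yb t\<bar> \<le> \<eta>"
      and x: "\<And>t. t \<in> {\<tau>..T} \<Longrightarrow> \<bar>xe \<epsilon> t - xb t\<bar> \<le> \<eta>"
      using bspec[OF l \<epsilon>] by blast
    have \<tau>c: "\<tau> \<le> c" using \<tau> c \<eta>(3) by (cases "0 < c") auto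
    have "\<bar>g (xe \<epsilon> t, ye \<epsilon> t, t) - g (xb t, yb t, t)\<bar> \<le> e" if t: "t \<in> {c..T}" for t
    proof -
      have t': "t \<in> {0..T}" "t \<in> {\<tau>..T}" using t \<tau>c c by auto
      have "\<bar>g (xe \<epsilon> t, ye \<epsilon> t, t) - g (xb t, yb t, t)\<bar> \<le> Lg * (\<bar>xe \<epsilon> t - xb t\<bar> + \<bar>ye \<epsilon> t - yb t\<bar>)"
        using ex t' \<epsilon> by (intro g_lip sol_x_bound sol_y_bound) (auto simp: approx_sol_def)
      also have "\<dots> \<le> Lg * (\<eta> + \<eta>)" using Lg by (intro mult_left_mono add_mono x y t') auto
      finally show ?thesis using \<eta>L by simp
    qed
    moreover have "\<bar>ye \<epsilon> t - yb t\<bar> \<le> e" if "t \<in> {0..T}" for t using y[OF that] \<eta> by simp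
    moreover have "\<bar>xe \<epsilon> t - xb t\<bar> \<le> e" if "t \<in> {c..T}" for t using x[of t] that \<tau>c \<eta> by force
    ultimately show "(\<forall>t\<in>{0..T}. \<bar>ye \<epsilon> t - yb t\<bar> \<le> e) \<and>
      (\<forall>t\<in>{c..T}. \<bar>xe \<epsilon> t - xb t\<bar> \<le> e \<and> \<bar>g (xe \<epsilon> t, ye \<epsilon> t, t) - g (xb t, yb t, t)\<bar> \<le> e)" by blast
  qed
qed

lemma exact_sol_deriv:
  assumes "approx_sol 0 xb yb" "0 < t" "t < T"
  shows "(yb has_real_derivative g (xb t, yb t, t)) (at t)"
  using assms by (auto simp: approx_sol_def)

lemma convergence_from:
  assumes ex: "approx_sol 0 xb yb" and c: "0 \<le> c" "c < T" "x0 \<in> {Fm y0..Fp y0} \<or> 0 < c"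
  shows "converges_C {0..T} ye yb" "converges_C {c..T} xe xb" "converges_C1 {c<..<T} ye yb"
proof -
  note cont = exact_sol_continuous[OF ex]
  note u = uniform_approximation[OF ex c(1,3)]
  have "((\<lambda>\<epsilon>. C_norm {0..T} (\<lambda>t. ye \<epsilon> t - yb t)) \<longlongrightarrow> 0) (at_right 0)"
  proof (rule C_norm_tendsto_0)
    fix e :: real assume "0 < e"
    from u[OF this] show "\<exists>\<epsilon>1>0. \<forall>\<epsilon>\<in>{0<..<\<epsilon>1}. \<forall>t\<in>{0..T}. \<bar>ye \<epsilon> t - yb t\<bar> \<le> e" by blast
  qed (use T in simp)
  then show "converges_C {0..T} ye yb"
    unfolding converges_C_def using cont sol_continuous by blast
  have "((\<lambda>\<epsilon>. C_norm {c..T} (\<lambda>t. xe \<epsilon> t - xb t)) \<longlongrightarrow> 0) (at_right 0)"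
  proof (rule C_norm_tendsto_0)
    fix e :: real assume "0 < e"
    from u[OF this] show "\<exists>\<epsilon>1>0. \<forall>\<epsilon>\<in>{0<..<\<epsilon>1}. \<forall>t\<in>{c..T}. \<bar>xe \<epsilon> t - xb t\<bar> \<le> e" by blast
  qed (use c in simp)
  then show "converges_C {c..T} xe xb"
    unfolding converges_C_def using c
    by (auto intro: continuous_on_subset[OF cont(1)] continuous_on_subset[OF sol_continuous(1)])
  have cg: "continuous_on {0..T} (\<lambda>t. g (xe \<epsilon> t, ye \<epsilon> t, t))" if "0 < \<epsilon>" for \<epsilon>
    by (intro continuous_on_g_along sol_continuous that)
  have S: "{c<..<T} \<subseteq> {0<..<T}" "{c<..<T} \<noteq> {}" using c by auto
  have "yb \<in> C1_space {c<..<T}"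
    by (rule C1_spaceI[OF cont(2,3) exact_sol_deriv[OF ex] S(1)])
  moreover have "ye \<epsilon> \<in> C1_space {c<..<T}" if "0 < \<epsilon>" for \<epsilon>
    by (rule C1_spaceI[OF sol_continuous(2)[OF that] cg[OF that] sol_deriv(2)[OF that] S(1)])
  moreover have "((\<lambda>\<epsilon>. C1_norm {c<..<T} (\<lambda>t. ye \<epsilon> t - yb t)) \<longlongrightarrow> 0) (at_right 0)"
  proof -
    have "((\<lambda>\<epsilon>. C_norm {c<..<T} (\<lambda>t. ye \<epsilon> t - yb t)) \<longlongrightarrow> 0) (at_right 0)"
    proof (rule C_norm_tendsto_0[OF S(2)])
      fix e :: real assume "0 < e"
      moreover have "{c<..<T} \<subseteq> {0..T}" using c by auto
      ultimately show "\<exists>\<epsilon>1>0. \<forall>\<epsilon>\<in>{0<..<\<epsilon>1}. \<forall>t\<in>{c<..<T}. \<bar>ye \<epsilon> t - yb t\<bar> \<le> e"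
        using u by (meson subsetD)
    qed
    moreover have "((\<lambda>\<epsilon>. C_norm {c<..<T} (deriv (\<lambda>t. ye \<epsilon> t - yb t))) \<longlongrightarrow> 0) (at_right 0)"
    proof (rule C_norm_tendsto_0[OF S(2)])
      fix e :: real assume "0 < e"
      from u[OF this] obtain \<epsilon>1 where e1: "0 < \<epsilon>1" and
        b: "\<And>\<epsilon> t. \<epsilon> \<in> {0<..<\<epsilon>1} \<Longrightarrow> t \<in> {c..T} \<Longrightarrow> \<bar>g (xe \<epsilon> t, ye \<epsilon> t, t) - g (xb t, yb t, t)\<bar> \<le> e"
        by blast
      have "\<bar>deriv (\<lambda>t. ye \<epsilon> t - yb t) t\<bar> \<le> e" if "\<epsilon> \<in> {0<..<\<epsilon>1}" "t \<in> {c<..<T}" for \<epsilon> t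
      proof -
        have "((\<lambda>t. ye \<epsilon> t - yb t) has_real_derivative g (xe \<epsilon> t, ye \<epsilon> t, t) - g (xb t, yb t, t)) (at t)"
          using that c by (intro DERIV_diff sol_deriv exact_sol_deriv[OF ex]) auto
        then have "deriv (\<lambda>t. ye \<epsilon> t - yb t) t = g (xe \<epsilon> t, ye \<epsilon> t, t) - g (xb t, yb t, t)"
          by (rule DERIV_imp_deriv)
        then show ?thesis using b[of \<epsilon> t] that by simp
      qed
      then show "\<exists>\<epsilon>1>0. \<forall>\<epsilon>\<in>{0<..<\<epsilon>1}. \<forall>t\<in>{c<..<T}. \<bar>deriv (\<lambda>t. ye \<epsilon> t - yb t) t\<bar> \<le> e"
        using e1 by blast
    qed
    ultimately show ?thesis unfolding C1_norm_def by (rule tendsto_add_zero)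
  qed
  ultimately show "converges_C1 {c<..<T} ye yb" unfolding converges_C1_def by blast
qed

text \<open>
  Convergence is pointwise on the open interval, since each time \<open>t > 0\<close> lies beyond the layer eventually,
  and the functions involved are bounded uniformly in \<open>\<epsilon>\<close>.
\<close>

lemma convergence_Lq:
  assumes ex: "approx_sol 0 xb yb" and q: "0 < q"
  shows "converges_W1q q 0 T ye yb" "converges_Lq q {0<..<T} xe xb"
proof -
  note cont = exact_sol_continuous[OF ex]
  have bX: "\<bar>xb t\<bar> \<le> X" "\<bar>yb t\<bar> \<le> R" if "t \<in> {0<..<T}" for t using ex that by (auto simp: approx_sol_def)
  have eX: "\<bar>xe \<epsilon> t\<bar> \<le> X" "\<bar>ye \<epsilon> t\<bar> \<le> R" if "0 < \<epsilon>" "t \<in> {0<..<T}" for \<epsilon> t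
    using sol_x_bound[OF that(1), of t] sol_y_bound[OF that(1), of t] that by auto
  have cg: "continuous_on {0..T} (\<lambda>t. g (xe \<epsilon> t, ye \<epsilon> t, t))" if "0 < \<epsilon>" for \<epsilon>
    by (intro continuous_on_g_along sol_continuous that)
  have pointwise: "((\<lambda>\<epsilon>. u \<epsilon>) \<longlongrightarrow> w) (at_right 0)"
    if "\<And>e. 0 < e \<Longrightarrow> \<exists>\<epsilon>1>0. \<forall>\<epsilon>\<in>{0<..<\<epsilon>1}. \<bar>u \<epsilon> - w\<bar> \<le> e" for u :: "real \<Rightarrow> real" and w
  proof (rule tendstoI)
    fix e :: real assume "0 < e"
    then have "0 < e / 2" by simp
    from that[OF this] obtain \<epsilon>1 where "0 < \<epsilon>1" "\<forall>\<epsilon>\<in>{0<..<\<epsilon>1}. \<bar>u \<epsilon> - w\<bar> \<le> e / 2" by blast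
    then have "\<forall>\<epsilon>>0. \<epsilon> < \<epsilon>1 \<longrightarrow> dist (u \<epsilon>) w < e" using \<open>0 < e\<close> by (force simp: dist_real_def)
    then show "\<forall>\<^sub>F \<epsilon> in at_right 0. dist (u \<epsilon>) w < e"
      using \<open>0 < \<epsilon>1\<close> unfolding eventually_at_right_field by blast
  qed
  have lim: "((\<lambda>\<epsilon>. xe \<epsilon> t) \<longlongrightarrow> xb t) (at_right 0)" "((\<lambda>\<epsilon>. ye \<epsilon> t) \<longlongrightarrow> yb t) (at_right 0)"
    "((\<lambda>\<epsilon>. g (xe \<epsilon> t, ye \<epsilon> t, t)) \<longlongrightarrow> g (xb t, yb t, t)) (at_right 0)" if t: "t \<in> {0<..<T}" for t
  proof -
    have t': "0 \<le> t" "x0 \<in> {Fm y0..Fp y0} \<or> 0 < t" "t \<in> {0..T}" "t \<in> {t..T}" using t by auto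
    note u = uniform_approximation[OF ex t'(1,2)]
    show "((\<lambda>\<epsilon>. xe \<epsilon> t) \<longlongrightarrow> xb t) (at_right 0)" "((\<lambda>\<epsilon>. ye \<epsilon> t) \<longlongrightarrow> yb t) (at_right 0)"
      "((\<lambda>\<epsilon>. g (xe \<epsilon> t, ye \<epsilon> t, t)) \<longlongrightarrow> g (xb t, yb t, t)) (at_right 0)"
      by (rule pointwise, use u t'(3,4) in meson)+
  qed
  show "converges_Lq q {0<..<T} xe xb"
  proof (rule converges_Lq_dominated[OF q cont(1) _ _ lim(1)])
    show "\<bar>xe \<epsilon> t - xb t\<bar> \<le> 2 * X" if "0 < \<epsilon>" "t \<in> {0<..<T}" for \<epsilon> t
      using bX[OF that(2)] eX[OF that] by linarith
  qed (auto intro: sol_continuous)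
  have "converges_Lq q {0<..<T} ye yb"
  proof (rule converges_Lq_dominated[OF q cont(2) _ _ lim(2)])
    show "\<bar>ye \<epsilon> t - yb t\<bar> \<le> 2 * R" if "0 < \<epsilon>" "t \<in> {0<..<T}" for \<epsilon> t
      using bX[OF that(2)] eX[OF that] by linarith
  qed (auto intro: sol_continuous)
  moreover have "converges_Lq q {0<..<T} (\<lambda>\<epsilon> t. g (xe \<epsilon> t, ye \<epsilon> t, t)) (\<lambda>t. g (xb t, yb t, t))"
  proof (rule converges_Lq_dominated[OF q cont(3) _ _ lim(3)])
    show "\<bar>g (xe \<epsilon> t, ye \<epsilon> t, t) - g (xb t, yb t, t)\<bar> \<le> 2 * C" if "0 < \<epsilon>" "t \<in> {0<..<T}" for \<epsilon> t
    proof -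
      have "t \<in> {0..T}" using that by simp
      then show ?thesis using g_bound[OF bX[OF that(2)], of t] g_bound[OF eX[OF that], of t] by linarith
    qed
  qed (rule cg)
  moreover have "weak_deriv 0 T yb (\<lambda>t. g (xb t, yb t, t))"
    by (rule C1_weak_deriv[OF T cont(2,3) exact_sol_deriv[OF ex]])
  moreover have "weak_deriv 0 T (ye \<epsilon>) (\<lambda>t. g (xe \<epsilon> t, ye \<epsilon> t, t))" if "0 < \<epsilon>" for \<epsilon>
    by (rule C1_weak_deriv[OF T sol_continuous(2)[OF that] cg[OF that] sol_deriv(2)[OF that]])
  ultimately show "converges_W1q q 0 T ye yb"
    unfolding converges_W1q_def
    by (intro conjI allI impI exI[of _ "\<lambda>\<epsilon> t. g (xe \<epsilon> t, ye \<epsilon> t, t)"] exI[of _ "\<lambda>t. g (xb t, yb t, t)"]) blast+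
qed

lemma exact_sol_regularity:
  assumes ex: "approx_sol 0 xb yb"
  shows "yb \<in> C1_space {0<..<T}" "yb \<in> W1inf_space 0 T"
proof -
  note cont = exact_sol_continuous[OF ex]
  show "yb \<in> C1_space {0<..<T}" by (rule C1_spaceI[OF cont(2,3) exact_sol_deriv[OF ex]]) auto
  have "weak_deriv 0 T yb (\<lambda>t. g (xb t, yb t, t))"
    by (rule C1_weak_deriv[OF T cont(2,3) exact_sol_deriv[OF ex]])
  then show "yb \<in> W1inf_space 0 T"
    unfolding W1inf_space_def using continuous_imp_Linf_space cont(2,3) by blast
qed

lemma norm_estimate:
  assumes ex: "approx_sol 0 xb yb" and \<eta>: "0 < \<eta>"
  shows "\<exists>\<epsilon>1>0. \<exists>Cl>0. \<forall>\<epsilon>\<in>{0<..<\<epsilon>1}. \<exists>\<tau>\<in>{0..<T}.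
    C_norm {0..T} (\<lambda>t. ye \<epsilon> t - yb t) + C_norm {\<tau>..T} (\<lambda>t. xe \<epsilon> t - xb t) < \<eta> \<and>
    (x0 \<in> {Fm y0..Fp y0} \<longrightarrow> \<tau> = 0) \<and> (x0 \<notin> {Fm y0..Fp y0} \<longrightarrow> \<tau> \<le> \<epsilon> * Cl)"
proof -
  have "0 < \<eta> / 3" using \<eta> by simp
  from approximation_with_layer[OF ex this] obtain \<epsilon>1 Cl where *: "0 < \<epsilon>1" "0 < Cl"
    "\<forall>\<epsilon>\<in>{0<..<\<epsilon>1}. \<exists>\<tau>\<in>{0..<T}. \<tau> \<le> \<epsilon> * Cl \<and> \<tau> \<le> \<eta> / 3 \<and>
    (x0 \<in> {Fm y0..Fp y0} \<longrightarrow> \<tau> = 0) \<and>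
    (\<forall>t\<in>{0..T}. \<bar>ye \<epsilon> t - yb t\<bar> \<le> \<eta> / 3) \<and> (\<forall>t\<in>{\<tau>..T}. \<bar>xe \<epsilon> t - xb t\<bar> \<le> \<eta> / 3)"
    by blast
  have "\<exists>\<tau>\<in>{0..<T}.
    C_norm {0..T} (\<lambda>t. ye \<epsilon> t - yb t) + C_norm {\<tau>..T} (\<lambda>t. xe \<epsilon> t - xb t) < \<eta> \<and>
    (x0 \<in> {Fm y0..Fp y0} \<longrightarrow> \<tau> = 0) \<and> (x0 \<notin> {Fm y0..Fp y0} \<longrightarrow> \<tau> \<le> \<epsilon> * Cl)"
    if e: "\<epsilon> \<in> {0<..<\<epsilon>1}" for \<epsilon>
  proof -
    obtain \<tau> where \<tau>: "\<tau> \<in> {0..<T}" "\<tau> \<le> \<epsilon> * Cl" "x0 \<in> {Fm y0..Fp y0} \<longrightarrow> \<tau> = 0"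
      and b: "\<And>t. t \<in> {0..T} \<Longrightarrow> \<bar>ye \<epsilon> t - yb t\<bar> \<le> \<eta> / 3" "\<And>t. t \<in> {\<tau>..T} \<Longrightarrow> \<bar>xe \<epsilon> t - xb t\<bar> \<le> \<eta> / 3"
      using bspec[OF *(3) e] by blast
    have "C_norm {0..T} (\<lambda>t. ye \<epsilon> t - yb t) \<le> \<eta> / 3" by (rule C_norm_le(1)) (use T b in auto)
    moreover have "C_norm {\<tau>..T} (\<lambda>t. xe \<epsilon> t - xb t) \<le> \<eta> / 3" by (rule C_norm_le(1)) (use \<tau> b in auto)
    ultimately show ?thesis using \<tau> \<eta> by (intro bexI[of _ \<tau>]) auto
  qed
  with *(1,2) show ?thesis by blast
qed

end

section \<open>The convergence theorem\<close>

lemma C2_continuous: "continuous_on UNIV h" if "C2 h" for h :: "'a::real_normed_vector \<Rightarrow> real"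
  using that unfolding C2_def by (auto intro: continuous_at_imp_continuous_on has_derivative_continuous)

lemma C2_lipschitz_on_compact_convex:
  fixes h :: "'a::real_normed_vector \<Rightarrow> real"
  assumes h: "C2 h" and S: "compact S" "convex S"
  shows "\<exists>B>0. \<forall>p\<in>S. \<forall>q\<in>S. \<bar>h p - h q\<bar> \<le> B * norm (p - q)"
proof -
  obtain h' :: "'a \<Rightarrow> 'a \<Rightarrow>\<^sub>L real" and h'' where
    d: "\<And>p. (h has_derivative blinfun_apply (h' p)) (at p)"
      "\<And>p. (h' has_derivative blinfun_apply (h'' p)) (at p)"
    using h unfolding C2_def by blast
  have "continuous_on S h'"
    using d(2) by (auto intro!: continuous_at_imp_continuous_on intro: has_derivative_continuous)
  then have "bounded (h' ` S)" by (intro compact_imp_bounded compact_continuous_image S)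
  then obtain B where B: "0 < B" "\<And>p. p \<in> S \<Longrightarrow> norm (h' p) \<le> B"
    unfolding bounded_pos by blast
  have "\<bar>h p - h q\<bar> \<le> B * norm (p - q)" if "p \<in> S" "q \<in> S" for p q
    using differentiable_bound[OF S(2), of h "\<lambda>p. blinfun_apply (h' p)" B p q] that d(1) B(2)
    by (auto simp: norm_blinfun.rep_eq has_derivative_at_withinI)
  with B(1) show ?thesis by blast
qed

theorem theorem4p1:
  fixes T x0 y0 Lp Lm :: real
    and f :: "real \<times> real \<Rightarrow> real"
    and g :: "real \<times> real \<times> real \<Rightarrow> real"
    and Fp Fm M G :: "real \<Rightarrow> real"
    and xe ye :: "real \<Rightarrow> real \<Rightarrow> real"
  assumes "T > 0"
    and A1: "C2 g" "C2 f"
    and A2: "\<forall>y. Fm y < Fp y"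
            "\<forall>x y. x > Fp y \<longrightarrow> f (x, y) < 0"
            "\<forall>x y. x \<in> {Fm y..Fp y} \<longrightarrow> f (x, y) = 0"
            "\<forall>x y. x < Fm y \<longrightarrow> f (x, y) > 0"
    and A3: "Lp-lipschitz_on UNIV Fp" "Lm-lipschitz_on UNIV Fm" "mono Fp" "mono Fm"
    and A4: "continuous_on UNIV M" "\<forall>t. M t > 0" "bounded (range G)"
            "\<forall>x y t. \<bar>g (x, y, t)\<bar> \<le> M t * (1 + G x + \<bar>y\<bar>)"
    and fast_slow: "\<forall>\<epsilon>>0. fast_slow_solution T f g x0 y0 \<epsilon> (xe \<epsilon>) (ye \<epsilon>)"
  shows "(\<exists>xbar ybar. limit_solution T Fm Fp g x0 y0 xbar ybar) \<and>
    (\<forall>x1 y1 x2 y2. limit_solution T Fm Fp g x0 y0 x1 y1 \<longrightarrow>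
       limit_solution T Fm Fp g x0 y0 x2 y2 \<longrightarrow>
       (\<forall>t\<in>{0..T}. x1 t = x2 t \<and> y1 t = y2 t)) \<and>
    (\<forall>xbar ybar. limit_solution T Fm Fp g x0 y0 xbar ybar \<longrightarrow>
       continuous_on {0..T} ybar \<and> ybar \<in> C1_space {0<..<T} \<and> ybar \<in> W1inf_space 0 T \<and>
       (\<forall>\<eta>1>0. \<exists>\<epsilon>1>0. \<exists>C>0. \<forall>\<epsilon>\<in>{0<..<\<epsilon>1}. \<exists>t\<epsilon>\<in>{0..<T}.
          C_norm {0..T} (\<lambda>t. ye \<epsilon> t - ybar t) + C_norm {t\<epsilon>..T} (\<lambda>t. xe \<epsilon> t - xbar t) < \<eta>1 \<and>
          (x0 \<in> {Fm y0..Fp y0} \<longrightarrow> t\<epsilon> = 0) \<and>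
          (x0 \<notin> {Fm y0..Fp y0} \<longrightarrow> t\<epsilon> \<le> \<epsilon> * C)) \<and>
       (x0 \<in> {Fm y0..Fp y0} \<longrightarrow>
          converges_C {0..T} ye ybar \<and> converges_C1 {0<..<T} ye ybar \<and>
          converges_C {0..T} xe xbar) \<and>
       (x0 \<notin> {Fm y0..Fp y0} \<longrightarrow>
          (\<forall>\<eta>2\<in>{0<..<T}.
             converges_C {0..T} ye ybar \<and> converges_C1 {\<eta>2<..<T} ye ybar \<and>
             converges_C {\<eta>2..T} xe xbar)) \<and>
       (\<forall>q>1. converges_W1q q 0 T ye ybar \<and> converges_Lq q {0<..<T} xe xbar))"
proof -
  have bd: "\<exists>B. \<forall>p\<in>S. \<bar>h p\<bar> \<le> B" if "compact S" "continuous_on UNIV h"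
    for S :: "'b::topological_space set" and h :: "'b \<Rightarrow> real"
    using compact_imp_bounded[OF compact_continuous_image[OF continuous_on_subset[OF that(2)] that(1)]]
    unfolding bounded_iff by (metis image_eqI real_norm_def subset_UNIV)
  define L where "L = max Lp Lm"
  have Fp: "L-lipschitz_on UNIV Fp" and Fm: "L-lipschitz_on UNIV Fm"
    using A3 by (auto simp: L_def intro: lipschitz_on_le)
  obtain Mb where Mb: "\<And>t. t \<in> {0..T} \<Longrightarrow> \<bar>M t\<bar> \<le> Mb" using bd[OF compact_Icc A4(1)] by blast
  have Mb0: "0 \<le> Mb" using Mb[of 0] \<open>T > 0\<close> by simp
  obtain Gb where Gb: "\<And>x. \<bar>G x\<bar> \<le> Gb" using A4(3) by (auto simp: bounded_iff)
  have Gb0: "0 \<le> Gb" using Gb[of 0] by simp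
  define A where "A = Mb * (1 + Gb)"
  have A: "0 \<le> A" using Mb0 Gb0 by (simp add: A_def)
  have growth: "\<bar>g (x, y, t)\<bar> \<le> A * (1 + \<bar>y\<bar>)" if t: "t \<in> {0..T}" for x y t
  proof -
    have "\<bar>g (x, y, t)\<bar> \<le> M t * (1 + G x + \<bar>y\<bar>)" using A4(4) by blast
    also have "\<dots> \<le> M t * ((1 + Gb) * (1 + \<bar>y\<bar>))"
    proof (rule mult_left_mono)
      have "0 \<le> Gb * \<bar>y\<bar>" using Gb0 by simp
      moreover have "G x \<le> Gb" using Gb[of x] by simp
      ultimately show "1 + G x + \<bar>y\<bar> \<le> (1 + Gb) * (1 + \<bar>y\<bar>)" by (simp add: algebra_simps)
      show "0 \<le> M t" using A4(2) by (simp add: less_imp_le)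
    qed
    also have "\<dots> \<le> Mb * ((1 + Gb) * (1 + \<bar>y\<bar>))"
      using Mb[OF t] Gb0 by (intro mult_right_mono) auto
    finally show ?thesis by (simp add: A_def mult.assoc)
  qed
  \<comment> \<open>The order of choices matters: \<open>R\<close> depends only on the growth of \<open>g\<close>, then \<open>X\<close> on the boundaries over \<open>{-R..R}\<close>,
    and the constants of \<open>g\<close> on the resulting box.\<close>
  define R where "R = (1 + y0\<^sup>2) * exp (4 * A * T)"
  obtain Bp Bm where B: "\<And>y. y \<in> {-R..R} \<Longrightarrow> \<bar>Fp y\<bar> \<le> Bp" "\<And>y. y \<in> {-R..R} \<Longrightarrow> \<bar>Fm y\<bar> \<le> Bm"
    using bd[OF compact_Icc lipschitz_on_continuous_on[OF Fp]] bd[OF compact_Icc lipschitz_on_continuous_on[OF Fm]]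
    by metis
  define X where "X = max \<bar>x0\<bar> (max Bp Bm)"
  have X: "\<bar>Fm y\<bar> \<le> X \<and> \<bar>Fp y\<bar> \<le> X" if "\<bar>y\<bar> \<le> R" for y
  proof -
    have "y \<in> {-R..R}" using that by auto
    from B[OF this] show ?thesis by (auto simp: X_def)
  qed
  define Q where "Q = {-X..X} \<times> {-R..R} \<times> {0..T}"
  have Q: "compact Q" "convex Q" by (auto simp: Q_def intro!: compact_Times convex_Times)
  have inQ: "(x, y, t) \<in> Q" if "\<bar>x\<bar> \<le> X" "\<bar>y\<bar> \<le> R" "t \<in> {0..T}" for x y t
    using that by (auto simp: Q_def)
  obtain C' where C': "\<And>p. p \<in> Q \<Longrightarrow> \<bar>g p\<bar> \<le> C'" using bd[OF Q(1) C2_continuous[OF A1(1)]] by blast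
  define C where "C = \<bar>C'\<bar>"
  obtain Lg where Lg: "0 < Lg" "\<And>p q. p \<in> Q \<Longrightarrow> q \<in> Q \<Longrightarrow> \<bar>g p - g q\<bar> \<le> Lg * norm (p - q)"
    using C2_lipschitz_on_compact_convex[OF A1(1) Q] by blast
  interpret fast_slow T L X R C Lg A x0 y0 Fm Fp g f xe ye
  proof unfold_locales
    show "\<bar>g (x, y, t)\<bar> \<le> C" if "\<bar>x\<bar> \<le> X" "\<bar>y\<bar> \<le> R" "t \<in> {0..T}" for x y t
      using C'[OF inQ[OF that]] by (simp add: C_def)
    show "\<bar>g (x1, y1, t) - g (x2, y2, t)\<bar> \<le> Lg * (\<bar>x1 - x2\<bar> + \<bar>y1 - y2\<bar>)"
      if "\<bar>x1\<bar> \<le> X" "\<bar>y1\<bar> \<le> R" "\<bar>x2\<bar> \<le> X" "\<bar>y2\<bar> \<le> R" "t \<in> {0..T}" for x1 y1 x2 y2 t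
    proof -
      have "\<bar>g (x1, y1, t) - g (x2, y2, t)\<bar> \<le> Lg * norm ((x1, y1, t) - (x2, y2, t))"
        using that by (intro Lg(2) inQ)
      also have "norm ((x1, y1, t) - (x2, y2, t)) \<le> \<bar>x1 - x2\<bar> + \<bar>y1 - y2\<bar>"
        using sqrt_sum_squares_le_sum_abs[of "x1 - x2" "y1 - y2"] by (simp add: norm_Pair)
      finally show ?thesis using Lg(1) by (simp add: mult_left_mono)
    qed
  qed (use \<open>T > 0\<close> Fp Fm A2 A growth X Lg fast_slow C2_continuous[OF A1(1)] C2_continuous[OF A1(2)]
      in \<open>auto simp: R_def C_def X_def less_imp_le\<close>)
  show ?thesis
  proof (intro conjI allI impI)
    show "\<exists>xbar ybar. limit_solution T Fm Fp g x0 y0 xbar ybar"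
      using exact_sol_exists limit_solution_if_exact by blast
    show "\<forall>t\<in>{0..T}. x1 t = x2 t \<and> y1 t = y2 t"
      if "limit_solution T Fm Fp g x0 y0 x1 y1" "limit_solution T Fm Fp g x0 y0 x2 y2" for x1 y1 x2 y2
      using exact_sol_unique[OF exact_if_limit_solution[OF that(1)] exact_if_limit_solution[OF that(2)]] by blast
  next
    fix xb yb assume "limit_solution T Fm Fp g x0 y0 xb yb"
    then have ex: "approx_sol 0 xb yb" by (rule exact_if_limit_solution)
    show "continuous_on {0..T} yb" by (rule exact_sol_continuous(2)[OF ex])
    show "yb \<in> C1_space {0<..<T}" "yb \<in> W1inf_space 0 T" by (rule exact_sol_regularity[OF ex])+
    show "\<exists>\<epsilon>1>0. \<exists>C>0. \<forall>\<epsilon>\<in>{0<..<\<epsilon>1}. \<exists>t\<epsilon>\<in>{0..<T}.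
          C_norm {0..T} (\<lambda>t. ye \<epsilon> t - yb t) + C_norm {t\<epsilon>..T} (\<lambda>t. xe \<epsilon> t - xb t) < \<eta>1 \<and>
          (x0 \<in> {Fm y0..Fp y0} \<longrightarrow> t\<epsilon> = 0) \<and>
          (x0 \<notin> {Fm y0..Fp y0} \<longrightarrow> t\<epsilon> \<le> \<epsilon> * C)" if "0 < \<eta>1" for \<eta>1
      by (rule norm_estimate[OF ex that])
    show "converges_C {0..T} ye yb" "converges_C1 {0<..<T} ye yb" "converges_C {0..T} xe xb"
      if "x0 \<in> {Fm y0..Fp y0}"
      using convergence_from[OF ex, of 0] T that by auto
    show "\<forall>\<eta>2\<in>{0<..<T}. converges_C {0..T} ye yb \<and> converges_C1 {\<eta>2<..<T} ye yb \<and>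
        converges_C {\<eta>2..T} xe xb"
    proof (intro ballI conjI)
      fix \<eta>2 assume "\<eta>2 \<in> {0<..<T}"
      then have \<eta>2: "0 \<le> \<eta>2" "\<eta>2 < T" "x0 \<in> {Fm y0..Fp y0} \<or> 0 < \<eta>2" by auto
      show "converges_C {0..T} ye yb" "converges_C1 {\<eta>2<..<T} ye yb" "converges_C {\<eta>2..T} xe xb"
        by (rule convergence_from[OF ex \<eta>2])+
    qed
    show "converges_W1q q 0 T ye yb" "converges_Lq q {0<..<T} xe xb" if "1 < q" for q
      using convergence_Lq[OF ex, of q] that by auto
  qed
qed

end
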